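(* Let $n,d$ be integers with $3\leq d\leq n-3$, and let $G\in\mathcal{B}(n,d)$ with $G\neq B_{n,d}$ (i.e. $G$ is not isomorphic to $B_{n,d}$). Let $t$ be the number of common vertices of the two cycles $C_a$, $C_b$ of $G$. If $t=0$ (i.e. $G$ contains two vertex-disjoint cycles), then for every orientation $\sigma$ of $G$, $$G^{\sigma}\succ B^{-,-,-}_{n,d}.$$
   Context: All graphs are finite and simple. For an undirected graph $G$ on vertex set $\{1,\dots,n\}$, an orientation $\sigma$ assigns a direction to each edge, giving the oriented graph $G^{\sigma}$. Its skew-adjacency matrix $S(G^{\sigma})=[s_{ij}]$ has $s_{ij}=1$, $s_{ji}=-1$ if $(i,j)$ is an arc, and $s_{ij}=s_{ji}=0$ otherwise. Write the skew characteristic polynomial as $\phi(G^{\sigma};x)=\det(xI_n-S(G^{\sigma}))=\sum_{i=0}^{n}a_i(G^{\sigma})x^{n-i}$. (One has $a_{2i}\ge 0$ and $a_{2i+1}=0$.) For oriented graphs $G_1^{\sigma_1},G_2^{\sigma_2}$ of the same order $n$: $G_1^{\sigma_1}\succeq G_2^{\sigma_2}$ means $a_{2i}(G_1^{\sigma_1})\ge a_{2i}(G_2^{\sigma_2})$ for all $0\le i\le\lfloor n/2\rfloor$; $G_1^{\sigma_1}\succ G_2^{\sigma_2}$ means in addition that the inequality is strict for at least one index. A bicyclic graph on $n$ vertices is a connected graph with $n+1$ edges. It contains either exactly two cycles $C_a,C_b$, having $t\le 1$ common vertices, or exactly three cycles, in which case $C_a,C_b$ are two of them having $t\geq 2$ common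 vertices. In particular $t=0$ exactly when $G$ contains two vertex-disjoint cycles. $\mathcal{B}(n)$ is the class of bicyclic graphs on $n$ vertices containing no two vertex-disjoint odd cycles of lengths $s$ and $l$ with $s+l\equiv 2\pmod 4$. For $2\le d\le n-3$, $\mathcal{B}(n,d)$ is the class of graphs in $\mathcal{B}(n)$ with diameter $d$ (the greatest distance between two vertices). $B_{n,d}$ is the bicyclic graph obtained from $K_{2,3}$, whose two vertices of degree three are $x,y$, by identifying an end vertex of the path $P_{d-2}$ on $d-2$ vertices with $x$ and attaching $n-d-2$ pendent edges at $y$. An even cycle of an oriented graph is evenly oriented if, when traversed in a chosen direction, an even number of its edges are oriented in that direction. $B^{-,-,-}_{n,d}$ denotes $B_{n,d}$ with an orientation in which all three 4-cycles are evenly oriented (the coefficients $a_i$ do not depend on which such orientation is chosen). *)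

theory Defs
  imports
    "Graph_Theory.Graph_Theory"
    "Jordan_Normal_Form.Char_Poly"
begin

text \<open>
  A simple graph is a \<^locale>\<open>pair_graph\<close>, that is, a finite, loop-free, symmetric set of arcs in
  which the two arcs \<open>(u,v)\<close> and \<open>(v,u)\<close> together represent the edge \<open>{u,v}\<close>. An oriented graph is
  a \<^typ>\<open>nat pair_pre_digraph\<close> containing exactly one of these two arcs for each edge. A graph on
  \<open>n\<close> vertices has vertex set \<open>{0..<n}\<close>, matching the index range of \<open>n \<times> n\<close> matrices.
\<close>

type_synonym pgraph = "nat pair_pre_digraph"

subsection \<open>Orientations and the skew characteristic polynomial\<close>

definition orientation :: "pgraph \<Rightarrow> pgraph \<Rightarrow> bool" where
  "orientation G D \<longleftrightarrow>
     pverts D = pverts G \<and> parcs D \<subseteq> parcs G \<and>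
     (\<forall>u v. (u, v) \<in> parcs G \<longrightarrow> ((u, v) \<in> parcs D) \<noteq> ((v, u) \<in> parcs D))"

definition skew_adjacency :: "pgraph \<Rightarrow> int mat" where
  "skew_adjacency D =
     mat (card (pverts D)) (card (pverts D))
       (\<lambda>(i, j). if (i, j) \<in> parcs D then 1 else if (j, i) \<in> parcs D then -1 else 0)"

text \<open>The index counts from the top: \<open>skew_coeff D i\<close> is the coefficient of \<open>x\<^bsup>n-i\<^esup>\<close>.\<close>

definition skew_coeff :: "pgraph \<Rightarrow> nat \<Rightarrow> int" where
  "skew_coeff D i = coeff (char_poly (skew_adjacency D)) (card (pverts D) - i)"

definition skew_ge :: "pgraph \<Rightarrow> pgraph \<Rightarrow> bool" (infix \<open>\<succeq>\<close> 50) where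
  "D1 \<succeq> D2 \<longleftrightarrow>
     card (pverts D1) = card (pverts D2) \<and>
     (\<forall>i \<le> card (pverts D1) div 2. skew_coeff D1 (2 * i) \<ge> skew_coeff D2 (2 * i))"

definition skew_gt :: "pgraph \<Rightarrow> pgraph \<Rightarrow> bool" (infix \<open>\<succ>\<close> 50) where
  "D1 \<succ> D2 \<longleftrightarrow>
     D1 \<succeq> D2 \<and>
     (\<exists>i \<le> card (pverts D1) div 2. skew_coeff D1 (2 * i) > skew_coeff D2 (2 * i))"

subsection \<open>Cycles and bicyclic graphs\<close>

definition edges :: "pgraph \<Rightarrow> nat set set" where
  "edges G = (\<lambda>(u, v). {u, v}) ` parcs G"

text \<open>
  A cycle is given by its cyclic sequence of arcs, which fixes a starting vertex and a direction of
  traversal. The bound on the length excludes the closed walks \<open>[(u,v), (v,u)]\<close>, which are cycles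
  of the symmetric digraph but not of the undirected graph.
\<close>

definition graph_cycle :: "pgraph \<Rightarrow> (nat \<times> nat) list \<Rightarrow> bool" where
  "graph_cycle G C \<longleftrightarrow> pre_digraph.cycle (with_proj G) C \<and> 3 \<le> length C"

definition cycle_verts :: "(nat \<times> nat) list \<Rightarrow> nat set" where
  "cycle_verts C = fst ` set C"

definition cycle_edges :: "(nat \<times> nat) list \<Rightarrow> nat set set" where
  "cycle_edges C = (\<lambda>(u, v). {u, v}) ` set C"

definition bicyclic :: "nat \<Rightarrow> pgraph \<Rightarrow> bool" where
  "bicyclic n G \<longleftrightarrow>
     pair_graph G \<and> pverts G = {0..<n} \<and>
     Digraph_Component.connected (with_proj G) \<and> card (edges G) = n + 1"

text \<open>
  Different arc sequences may traverse the same cycle, hence distinctness of two cycles is expressed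
  through their edge sets.
\<close>

definition distinct_cycles :: "pgraph \<Rightarrow> (nat \<times> nat) list \<Rightarrow> (nat \<times> nat) list \<Rightarrow> bool" where
  "distinct_cycles G Ca Cb \<longleftrightarrow>
     graph_cycle G Ca \<and> graph_cycle G Cb \<and> cycle_edges Ca \<noteq> cycle_edges Cb"

definition bicyclic_class :: "nat \<Rightarrow> pgraph set" (\<open>\<B>\<close>) where
  "\<B> n = {G. bicyclic n G \<and>
     \<not> (\<exists>C C'. graph_cycle G C \<and> graph_cycle G C' \<and> cycle_verts C \<inter> cycle_verts C' = {} \<and>
           odd (length C) \<and> odd (length C') \<and> (length C + length C') mod 4 = 2)}"

text \<open>Distances are shortest-path lengths for unit arc weights.\<close>

definition diameter :: "pgraph \<Rightarrow> ereal" where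
  "diameter G =
     Max ((\<lambda>(u, v). wf_digraph.\<mu> (with_proj G) (\<lambda>_. 1) u v) ` (pverts G \<times> pverts G))"

definition bicyclic_diam_class :: "nat \<Rightarrow> nat \<Rightarrow> pgraph set" (\<open>\<B>\<^sub>d\<close>) where
  "\<B>\<^sub>d n d = {G \<in> \<B> n. diameter G = ereal (real d)}"

subsection \<open>The graph \<open>B\<^bsub>n,d\<^esub>\<close> and its orientations\<close>

text \<open>
  For \<open>3 \<le> d\<close> and \<open>d + 3 \<le> n\<close>: the path on \<open>d - 2\<close> vertices is \<open>0, \<dots>, d - 3\<close>, its end vertex
  \<open>x = d - 3\<close> and \<open>y = d + 1\<close> are the vertices of degree three of \<open>K\<^bsub>2,3\<^esub>\<close>, whose remaining vertices
  are \<open>d - 2\<close>, \<open>d - 1\<close>, \<open>d\<close>, and the \<open>n - d - 2\<close> pendent neighbours of \<open>y\<close> are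
  \<open>d + 2, \<dots>, n - 1\<close>.
\<close>

definition B_graph :: "nat \<Rightarrow> nat \<Rightarrow> pgraph" where
  "B_graph n d = mk_symmetric (with_proj
     \<lparr> pverts = {0..<n},
       parcs = {(i, i + 1) |i. i < d - 3}
             \<union> {d - 3} \<times> {d - 2, d - 1, d}
             \<union> {d - 2, d - 1, d} \<times> {d + 1}
             \<union> {d + 1} \<times> {d + 2..<n} \<rparr>)"

text \<open>
  For an even cycle the parity of the number of arcs of \<open>D\<close> met along \<open>C\<close> does not depend on the
  direction of traversal.
\<close>

definition evenly_oriented :: "pgraph \<Rightarrow> (nat \<times> nat) list \<Rightarrow> bool" where
  "evenly_oriented D C \<longleftrightarrow> even (length C) \<and> even (length (filter (\<lambda>a. a \<in> parcs D) C))"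

definition B_minus_orientation :: "nat \<Rightarrow> nat \<Rightarrow> pgraph \<Rightarrow> bool" where
  "B_minus_orientation n d D \<longleftrightarrow>
     orientation (B_graph n d) D \<and>
     (\<forall>C. graph_cycle (B_graph n d) C \<and> length C = 4 \<longrightarrow> evenly_oriented D C)"

text \<open>Orienting every edge of \<open>B\<^bsub>n,d\<^esub>\<close> away from the end \<open>0\<close> of the path makes all 4-cycles evenly oriented.\<close>

lemma B_minus_orientation_exists:
  assumes "3 \<le> d" "d + 3 \<le> n"
  shows "\<exists>D. B_minus_orientation n d D"
proof -
  define A where "A = {(i, i + 1) |i. i < d - 3} \<union> {d - 3} \<times> {d - 2, d - 1, d}
             \<union> {d - 2, d - 1, d} \<times> {d + 1} \<union> {d + 1} \<times> {d + 2..<n}"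
  define D where "D = \<lparr>pverts = {0..<n}, parcs = A\<rparr>"
  define L :: "nat \<Rightarrow> int" where "L = (\<lambda>i. if i \<le> d - 3 then int i else if i \<le> d then int d - 2
      else if i = d + 1 then int d - 1 else int d)"
  have L: "L v = L u + 1" if "(u, v) \<in> A" for u v
    using that assms unfolding A_def L_def by (auto simp: of_nat_diff)
  have P: "parcs (B_graph n d) = A \<union> A\<inverse>" "pverts (B_graph n d) = {0..<n}"
    unfolding B_graph_def A_def[symmetric] mk_symmetric_def by auto
  have asym: "(v, u) \<notin> A" if "(u, v) \<in> A" for u v
    using L[OF that] L[of v u] by auto
  have walk: "2 * int (length (filter (\<lambda>a. a \<in> A) p)) - int (length p) = L v - L u"
    if "pcas u p v" "set p \<subseteq> A \<union> A\<inverse>" for u p v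
    using that
  proof (induction p arbitrary: u)
    case (Cons e p)
    obtain a b where e: "e = (a, b)" by force
    with Cons.prems have "pcas b p v" "set p \<subseteq> A \<union> A\<inverse>" "u = a" "(a, b) \<in> A \<or> (b, a) \<in> A" by auto
    with Cons.IH[of b] show ?case using L[of a b] L[of b a] asym e by auto
  qed simp
  have "evenly_oriented D C" if "graph_cycle (B_graph n d) C" "length C = 4" for C
  proof -
    from that obtain u where "pcas u C u" "set C \<subseteq> A \<union> A\<inverse>"
      by (auto simp: graph_cycle_def pre_digraph.cycle_def pre_digraph.awalk_def cas_with_proj_eq P)
    from walk[OF this] that(2) have "length (filter (\<lambda>a. a \<in> A) C) = 2" by linarith
    then show ?thesis using that(2) by (simp add: evenly_oriented_def D_def)
  qed
  moreover have "orientation (B_graph n d) D"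
    using asym by (auto simp: orientation_def P D_def)
  ultimately show ?thesis unfolding B_minus_orientation_def by blast
qed

end

theory Submission
  imports Defs
begin

text \<open>
  The coefficient \<open>a\<^bsub>2i\<^esub>\<close> is the sum of the principal minors of the skew-adjacency matrix of
  order \<open>2i\<close>. Such a minor is nonnegative, and modulo 2 it counts the perfect matchings of the
  induced subgraph, so \<open>a\<^bsub>2i\<^esub>(G)\<close> is at least the number of \<open>i\<close>-matchings \<open>M\<close> of \<open>G\<close> such that the
  subgraph induced on the vertices of \<open>M\<close> has no other perfect matching. The edge sets of \<open>G\<close>
  meeting every vertex an even number of times are \<open>{}\<close>, \<open>C\<^sub>a\<close>, \<open>C\<^sub>b\<close> and \<open>C\<^sub>a \<union> C\<^sub>b\<close>, so every
  matching that contains a perfect matching of neither cycle has this property. Such matchings are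
  counted along a diametral path: those inside the path, those with one edge off the path, and those
  with two off-path edges, one of them in a cycle and the other in neither cycle.

  In \<open>B\<^sup>-\<close> the three vertices of degree two of the \<open>K\<^bsub>2,3\<^esub>\<close> have proportional rows, and so have the
  pendent neighbours of \<open>y\<close>. Hence \<open>a\<^bsub>2i\<^esub>(B\<^sup>-)\<close> is at most the number of \<open>i\<close>-matchings, weighted, of a
  path with \<open>d\<close> edges of weights \<open>1, \<dots>, 1, 3, 3, n - d - 2\<close>, and this number is exactly the lower bound
  for \<open>G\<close>. For \<open>i = 2\<close>, a pair of off-path edges from different cycles is left over.
\<close>

section \<open>Principal minors of skew-symmetric matrices\<close>

text \<open>On an evenly oriented even cycle the two perfect matchings cancel in the Pfaffian. Since
  the orientation is arbitrary, a matching is counted only if it is alone on its vertex set, which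
  is why matchings that fill a cycle are discarded. The bookkeeping runs over the off-path edges, of
  which there are \<open>n + 1 - d = (n - d - 3) + 4\<close>. Let \<alpha> and \<gamma> be the
  numbers of ways to complete one off-path edge to an \<open>i\<close>-matching inside a path with
  \<open>d - 2\<close>, respectively \<open>d - 4\<close> edges, and \<beta> the number of ways to
  complete two off-path edges inside a path with \<open>d - 4\<close> edges. Each cycle has at least
  two off-path edges. Two of them are charged \<alpha> + \<gamma>, the critical case being a 4-cycle
  with three vertices on the path; every further off-path edge is charged \<alpha> + 2 \<beta>. The
  same sum comes out of the weighted path by splitting \<open>3 = 1 + 2\<close> and
  \<open>n - d - 2 = 1 + (n - d - 3)\<close>.\<close>

definition pdet :: "(nat \<Rightarrow> nat \<Rightarrow> 'a::comm_ring_1) \<Rightarrow> nat set \<Rightarrow> 'a" where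
  "pdet a X = (\<Sum>p | p permutes X. of_int (sign p) * (\<Prod>i\<in>X. a i (p i)))"

lemma pdet_empty [simp]: "pdet a {} = 1"
  by (simp add: pdet_def)

lemma pdet_cong: "(\<And>i j. i \<in> X \<Longrightarrow> j \<in> X \<Longrightarrow> a i j = b i j) \<Longrightarrow> pdet a X = pdet b X"
  unfolding pdet_def by (intro sum.cong refl arg_cong2[where f = "(*)"] prod.cong)
    (auto simp: permutes_in_image)

lemma of_int_pdet: "of_int (pdet a X) = (pdet (\<lambda>i j. of_int (a i j)) X :: 'a::comm_ring_1)"
  unfolding pdet_def by simp

text \<open>A permutation that moves some \<open>i\<close> in \<open>X - Y\<close> picks the
  vanishing entry \<open>a i (p i)\<close>, so only permutations supported in \<open>Y\<close>
  survive.\<close>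

lemma pdet_restrict:
  assumes "finite X" "Y \<subseteq> X" "\<And>i j. i \<in> X - Y \<Longrightarrow> j \<in> X \<Longrightarrow> i \<noteq> j \<Longrightarrow> a i j = 0"
  shows "pdet a X = (\<Prod>i\<in>X - Y. a i i) * pdet a Y"
proof -
  have "pdet a X = (\<Sum>p | p permutes Y. of_int (sign p) * (\<Prod>i\<in>X. a i (p i)))"
    unfolding pdet_def
  proof (rule sum.mono_neutral_right)
    show "finite {p. p permutes X}" using assms by (simp add: finite_permutations)
    show "{p. p permutes Y} \<subseteq> {p. p permutes X}"
      using assms by (auto intro: permutes_subset)
    show "\<forall>p\<in>{p. p permutes X} - {p. p permutes Y}. of_int (sign p) * (\<Prod>i\<in>X. a i (p i)) = 0"
    proof
      fix p assume p: "p \<in> {p. p permutes X} - {p. p permutes Y}"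
      then obtain i where i: "i \<in> X - Y" "p i \<noteq> i"
        using permutes_superset[of p X Y] by blast
      then have "a i (p i) = 0" using assms(3)[of i "p i"] p by (auto simp: permutes_in_image)
      then show "of_int (sign p) * (\<Prod>i\<in>X. a i (p i)) = 0"
        using i assms(1) by (metis DiffD1 mult_zero_right prod_zero)
    qed
  qed
  also have "\<dots> = (\<Sum>p | p permutes Y. (\<Prod>i\<in>X - Y. a i i) * (of_int (sign p) * (\<Prod>i\<in>Y. a i (p i))))"
  proof (intro sum.cong refl)
    fix p assume "p \<in> {p. p permutes Y}"
    then have "(\<Prod>i\<in>X - Y. a i (p i)) = (\<Prod>i\<in>X - Y. a i i)"
      by (intro prod.cong refl) (auto simp: permutes_not_in)
    moreover have "(\<Prod>i\<in>X. a i (p i)) = (\<Prod>i\<in>X - Y. a i (p i)) * (\<Prod>i\<in>Y. a i (p i))"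
      using assms by (intro prod.subset_diff) auto
    ultimately show "of_int (sign p) * (\<Prod>i\<in>X. a i (p i)) = 
        (\<Prod>i\<in>X - Y. a i i) * (of_int (sign p) * (\<Prod>i\<in>Y. a i (p i)))" by (simp add: mult_ac)
  qed
  also have "\<dots> = (\<Prod>i\<in>X - Y. a i i) * pdet a Y"
    by (simp add: pdet_def sum_distrib_left)
  finally show ?thesis .
qed

lemma pdet_zero_row:
  assumes "finite X" "u \<in> X" "\<And>w. w \<in> X \<Longrightarrow> a u w = 0"
  shows "pdet a X = 0"
proof -
  have "(\<Prod>i\<in>X. a i (p i)) = 0" if "p permutes X" for p
    using assms that by (metis permutes_in_image prod_zero)
  then show ?thesis unfolding pdet_def by simp
qed

text \<open>Composing with the transposition of \<open>u\<close> and \<open>w\<close> multiplies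
  each product by \<open>c * c = 1\<close> but flips the sign, so the Leibniz sum equals its own
  negative. The factor \<open>c\<close> is a sign because twins in an oriented graph agree only up
  to the direction of their arcs.\<close>

lemma pdet_proportional_rows:
  fixes a :: "nat \<Rightarrow> nat \<Rightarrow> int"
  assumes "finite X" "u \<in> X" "w \<in> X" "u \<noteq> w" "\<And>j. j \<in> X \<Longrightarrow> a u j = c * a w j" "c * c = 1"
  shows "pdet a X = 0"
proof -
  let ?t = "Transposition.transpose u w"
  let ?f = "\<lambda>p. sign p * (\<Prod>i\<in>X. a i (p i))"
  have t: "?t permutes X" using assms by (simp add: permutes_swap_id)
  have c: "a w j = c * a u j" if "j \<in> X" for j
    using assms(5)[OF that] assms(6) by (metis mult.assoc mult_1)
  have "(\<Sum>p | p permutes X. ?f p) = (\<Sum>p | p permutes X. ?f (p \<circ> ?t))"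
    by (rule sum_permutations_compose_right[OF t])
  also have "\<dots> = (\<Sum>p | p permutes X. - ?f p)"
  proof (intro sum.cong refl)
    fix p assume p: "p \<in> {p. p permutes X}"
    have X: "X = insert u (insert w (X - {u, w}))" using assms by auto
    have split: "(\<Prod>i\<in>X. g i) = g u * (g w * (\<Prod>i\<in>X - {u, w}. g i))" for g :: "nat \<Rightarrow> int"
      by (subst X, subst prod.insert, use assms(1,4) in simp, use assms(4) in simp, subst prod.insert)
        (use assms(1) in auto)
    have "(\<Prod>i\<in>X. a i ((p \<circ> ?t) i)) = a u (p w) * (a w (p u) * (\<Prod>i\<in>X - {u, w}. a i ((p \<circ> ?t) i)))"
      by (subst split) simp
    also have "(\<Prod>i\<in>X - {u, w}. a i ((p \<circ> ?t) i)) = (\<Prod>i\<in>X - {u, w}. a i (p i))"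
      by (intro prod.cong refl) (auto simp: Transposition.transpose_def)
    also have "a u (p w) = c * a w (p w)" using assms p by (simp add: permutes_in_image)
    also have "a w (p u) = c * a u (p u)" using assms p c by (simp add: permutes_in_image)
    also have "c * a w (p w) * (c * a u (p u) * (\<Prod>i\<in>X - {u, w}. a i (p i)))
      = (c * c) * (a u (p u) * (a w (p w) * (\<Prod>i\<in>X - {u, w}. a i (p i))))" by (simp add: mult_ac)
    also have "\<dots> = (\<Prod>i\<in>X. a i (p i))"
      by (subst split) (simp add: assms(6))
    finally have 1: "(\<Prod>i\<in>X. a i ((p \<circ> ?t) i)) = (\<Prod>i\<in>X. a i (p i))" .
    have "sign (p \<circ> ?t) = - sign p"
      using p assms t permutes_imp_permutation[OF assms(1)]
      by (subst sign_compose) (auto simp: sign_swap_id)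
    with 1 show "?f (p \<circ> ?t) = - ?f p" by simp
  qed
  finally have "(\<Sum>p | p permutes X. ?f p) = 0" by (simp add: sum_negf)
  then show ?thesis by (simp add: pdet_def)
qed

text \<open>In every surviving term row \<open>u\<close> forces \<open>p u = v\<close> and column
  \<open>u\<close> forces \<open>p v = u\<close>, so \<open>p\<close> is the transposition of
  \<open>u\<close> and \<open>v\<close> composed with a permutation of the rest.\<close>

lemma pdet_pendant:
  fixes a :: "nat \<Rightarrow> nat \<Rightarrow> int"
  assumes X: "finite X" "u \<in> X" "v \<in> X" "u \<noteq> v"
    and u: "\<And>w. w \<in> X \<Longrightarrow> w \<noteq> v \<Longrightarrow> a u w = 0" "\<And>w. w \<in> X \<Longrightarrow> w \<noteq> v \<Longrightarrow> a w u = 0"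
  shows "pdet a X = - (a u v * a v u) * pdet a (X - {u, v})"
proof -
  let ?t = "Transposition.transpose u v"
  let ?f = "\<lambda>p. sign p * (\<Prod>i\<in>X. a i (p i))"
  let ?Y = "X - {u, v}"
  have t: "?t permutes X" using X by (simp add: permutes_swap_id)
  have Xe: "X = insert u (insert v ?Y)" using X by auto
  have inj: "inj_on (\<lambda>q. ?t \<circ> q) {q. q permutes ?Y}"
    by (rule inj_onI) (metis comp_assoc id_comp transpose_comp_involutory)
  have "pdet a X = (\<Sum>p\<in>(\<lambda>q. ?t \<circ> q) ` {q. q permutes ?Y}. ?f p)"
    unfolding pdet_def of_int_eq_id id_apply
  proof (rule sum.mono_neutral_right)
    show "finite {p. p permutes X}" using X by (simp add: finite_permutations)
    show "(\<lambda>q. ?t \<circ> q) ` {q. q permutes ?Y} \<subseteq> {p. p permutes X}"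
      using t by (auto intro!: permutes_compose intro: permutes_subset)
    show "\<forall>p\<in>{p. p permutes X} - (\<lambda>q. ?t \<circ> q) ` {q. q permutes ?Y}. ?f p = 0"
    proof (rule ballI, rule ccontr)
      fix p assume p: "p \<in> {p. p permutes X} - (\<lambda>q. ?t \<circ> q) ` {q. q permutes ?Y}" and "?f p \<noteq> 0"
      then have nz: "a i (p i) \<noteq> 0" if "i \<in> X" for i
        using that X by (metis mult_zero_right prod_zero)
      have pX: "p permutes X" using p by simp
      have uv: "p u = v" using nz[of u] u(1)[of "p u"] X pX by (auto simp: permutes_in_image)
      obtain w where w: "w \<in> X" "p w = u" using pX X by (metis imageE permutes_image)
      then have vu: "p v = u" using nz[of w] u(2)[of w] by auto
      have "?t \<circ> p permutes X" using pX t by (rule permutes_compose)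
      then have "?t \<circ> p permutes ?Y"
        by (rule permutes_superset) (use uv vu in auto)
      moreover have "p = ?t \<circ> (?t \<circ> p)" by (metis comp_assoc id_comp transpose_comp_involutory)
      ultimately show False using p by blast
    qed
  qed
  also have "\<dots> = (\<Sum>q | q permutes ?Y. ?f (?t \<circ> q))"
    by (subst sum.reindex[OF inj]) simp
  also have "\<dots> = (\<Sum>q | q permutes ?Y. - (a u v * a v u) * (sign q * (\<Prod>i\<in>?Y. a i (q i))))"
  proof (intro sum.cong refl)
    fix q assume "q \<in> {q. q permutes ?Y}"
    then have q: "q permutes ?Y" by simp
    have "permutation q" using q X by (meson finite_Diff permutes_imp_permutation)
    then have s: "sign (?t \<circ> q) = - sign q"
      using X by (subst sign_compose) (auto simp: sign_swap_id permutation_swap_id)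
    have quv: "q u = u" "q v = v" using q by (auto simp: permutes_def)
    have "(\<Prod>i\<in>X. a i ((?t \<circ> q) i)) = a u v * (a v u * (\<Prod>i\<in>?Y. a i ((?t \<circ> q) i)))"
      by (subst Xe) (use X quv in \<open>simp add: prod.insert\<close>)
    also have "(\<Prod>i\<in>?Y. a i ((?t \<circ> q) i)) = (\<Prod>i\<in>?Y. a i (q i))"
    proof (intro prod.cong refl)
      fix i assume "i \<in> ?Y"
      then have "q i \<in> ?Y" using permutes_in_image[OF q] by blast
      then show "a i ((?t \<circ> q) i) = a i (q i)" by (auto simp: Transposition.transpose_def)
    qed
    finally show "?f (?t \<circ> q) = - (a u v * a v u) * (sign q * (\<Prod>i\<in>?Y. a i (q i)))"
      using s by simp
  qed
  also have "\<dots> = - (a u v * a v u) * pdet a ?Y" by (simp add: pdet_def sum_distrib_left)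
  finally show ?thesis .
qed

text \<open>The Leibniz sum ranges over an arbitrary vertex set, so that principal minors need no
  renumbering; library determinants enter only through sets \<open>{0..<n}\<close>.\<close>

lemma pdet_eq_det: "pdet a {0..<n} = det (mat n n (\<lambda>(i, j). a i j))"
proof -
  have "(\<Prod>i = 0..<n. a i (p i)) = (\<Prod>i = 0..<n. mat n n (\<lambda>(i, j). a i j) $$ (i, p i))"
    if "p permutes {0..<n}" for p
    using that by (intro prod.cong refl) (auto dest: permutes_in_image[of _ _ "_::nat"])
  then show ?thesis
    unfolding pdet_def by (subst det_def'[of _ n]) (auto intro!: sum.cong)
qed

text \<open>Pairing a kernel vector with itself kills the skew part and leaves \<open>t\<close>
  times its sum of squares, so the kernel is trivial.\<close>

lemma pdet_skew_plus_diag_nz: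
  fixes b :: "nat \<Rightarrow> nat \<Rightarrow> real"
  assumes X: "finite X" and skew: "\<And>i j. b j i = - b i j" and t: "t > 0"
  shows "pdet (\<lambda>i j. (if i = j then t else 0) + b i j) X \<noteq> 0"
proof
  let ?c = "\<lambda>i j. (if i = j then t else 0) + b i j"
  assume 0: "pdet ?c X = 0"
  \<comment> \<open>Bordering by the identity turns the minor on \<open>X\<close> into a determinant
    on \<open>{0..<n}\<close>, where a zero determinant yields a kernel vector.\<close>
  define m where "m = (\<lambda>i j. if i \<in> X \<and> j \<in> X then ?c i j else if i = j then 1 else 0)"
  obtain n where n: "X \<subseteq> {0..<n}"
    using X by (metis atLeast0LessThan finite_nat_iff_bounded)
  have "pdet m {0..<n} = (\<Prod>i\<in>{0..<n} - X. m i i) * pdet m X"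
    by (rule pdet_restrict) (use n in \<open>auto simp: m_def\<close>)
  also have "pdet m X = pdet ?c X" by (rule pdet_cong) (simp add: m_def)
  finally have "det (mat n n (\<lambda>(i, j). m i j)) = 0" using 0 by (simp add: pdet_eq_det)
  then obtain v where v: "v \<in> carrier_vec n" "v \<noteq> 0\<^sub>v n" "mat n n (\<lambda>(i, j). m i j) *\<^sub>v v = 0\<^sub>v n"
    by (subst (asm) det_0_iff_vec_prod_zero_field[of _ n]) auto
  have row: "(\<Sum>j = 0..<n. m i j * v $ j) = 0" if "i < n" for i
  proof -
    have "(mat n n (\<lambda>(i, j). m i j) *\<^sub>v v) $ i = (\<Sum>j = 0..<n. m i j * v $ j)"
      using that v(1) by (auto simp: scalar_prod_def intro!: sum.cong)
    then show ?thesis using v(3) that by simp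
  qed
  have out: "v $ i = 0" if "i < n" "i \<notin> X" for i
  proof -
    have "(\<Sum>j = 0..<n. m i j * v $ j) = (\<Sum>j\<in>{i}. m i j * v $ j)"
      using that by (intro sum.mono_neutral_right) (auto simp: m_def)
    then show ?thesis using row[of i] that by (simp add: m_def)
  qed
  have "in": "t * v $ i + (\<Sum>j\<in>X. b i j * v $ j) = 0" if "i \<in> X" for i
  proof -
    have "(\<Sum>j = 0..<n. m i j * v $ j) = (\<Sum>j\<in>X. m i j * v $ j)"
      using n out by (intro sum.mono_neutral_right) auto
    also have "\<dots> = (\<Sum>j\<in>X. (if i = j then t * v $ j else 0) + b i j * v $ j)"
      using that by (intro sum.cong) (auto simp: m_def algebra_simps)
    also have "\<dots> = t * v $ i + (\<Sum>j\<in>X. b i j * v $ j)"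
      using that X by (simp add: sum.distrib)
    finally show ?thesis using row[of i] n that by auto
  qed
  \<comment> \<open>The quadratic form of the skew part; swapping the order of summation shows that
    it equals its negative.\<close>
  let ?q = "\<Sum>i\<in>X. \<Sum>j\<in>X. b i j * v $ i * v $ j"
  have "?q = (\<Sum>j\<in>X. \<Sum>i\<in>X. b i j * v $ i * v $ j)" by (rule sum.swap)
  also have "\<dots> = (\<Sum>j\<in>X. \<Sum>i\<in>X. - (b j i * v $ j * v $ i))"
  proof (intro sum.cong refl)
    fix i j show "b i j * v $ i * v $ j = - (b j i * v $ j * v $ i)" using skew[of i j] by simp
  qed
  also have "\<dots> = - ?q" by (simp add: sum_negf)
  finally have q: "?q = 0" by simp
  have "0 = (\<Sum>i\<in>X. v $ i * (t * v $ i + (\<Sum>j\<in>X. b i j * v $ j)))" using "in" by simp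
  also have "\<dots> = t * (\<Sum>i\<in>X. (v $ i)\<^sup>2) + ?q"
    by (simp add: sum.distrib algebra_simps sum_distrib_left power2_eq_square)
  finally have "(\<Sum>i\<in>X. (v $ i)\<^sup>2) = 0" using q t by simp
  then have "v $ i = 0" if "i \<in> X" for i using that X by (simp add: sum_nonneg_eq_0_iff)
  with out have "v = 0\<^sub>v n" using v(1) by (intro eq_vecI) auto
  with v(2) show False by simp
qed

text \<open>The determinants of \<open>(1 - s) I + s A\<close>, \<open>0 \<le> s \<le> 1\<close>, join \<open>1\<close> to \<open>det A\<close> without vanishing
  for \<open>s < 1\<close>.\<close>

lemma pdet_skew_nonneg:
  fixes a :: "nat \<Rightarrow> nat \<Rightarrow> int"
  assumes X: "finite X" and skew: "\<And>i j. a j i = - a i j"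
  shows "pdet a X \<ge> 0"
proof (rule ccontr)
  assume neg: "\<not> pdet a X \<ge> 0"
  define f where "f = (\<lambda>s::real. pdet (\<lambda>i j. (if i = j then 1 - s else 0) + s * of_int (a i j)) X)"
  have f1: "f 1 = of_int (pdet a X)"
    unfolding f_def of_int_pdet by (intro pdet_cong) auto
  have f0: "f 0 = 1"
    unfolding f_def using X by (subst pdet_restrict[where Y = "{}"]) auto
  have "continuous_on {0..1} f"
    unfolding f_def pdet_def
  proof (intro continuous_intros)
    fix p :: "nat \<Rightarrow> nat" and i
    show "continuous_on {0..1} (\<lambda>s::real. if i = p i then 1 - s else 0)"
      by (cases "i = p i") (auto intro!: continuous_intros)
  qed
  then obtain s where s: "0 \<le> s" "s \<le> 1" "f s = 0"
    using IVT2'[of f 1 0 0] f0 f1 neg by auto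
  then have "s < 1" using f1 neg by (cases "s = 1") auto
  then show False
    using pdet_skew_plus_diag_nz[of X "\<lambda>i j. s * of_int (a i j)" "1 - s"] X s(3)
    by (metis (no_types, lifting) f_def diff_gt_0_iff_gt mult_minus_right of_int_minus skew)
qed

text \<open>The summands cancel modulo 2 within the two-element orbits \<open>{x, f x}\<close>,
  which the induction removes one at a time.\<close>

lemma even_sum_involution:
  fixes t :: "'a \<Rightarrow> int"
  assumes "finite S" "\<And>x. x \<in> S \<Longrightarrow> f x \<in> S \<and> f x \<noteq> x \<and> f (f x) = x \<and> t (f x) = t x"
  shows "even (sum t S)"
  using assms
proof (induction "card S" arbitrary: S rule: less_induct)
  case less
  show ?case
  proof (cases "S = {}")
    case False
    then obtain x where x: "x \<in> S" by auto
    let ?S = "S - {x, f x}"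
    have S: "S = insert x (insert (f x) ?S)" using x less.prems by auto
    have "?S \<subset> S" using x by auto
    then have c: "card ?S < card S" by (rule psubset_card_mono[OF less.prems(1)])
    have "f y \<in> ?S \<and> f y \<noteq> y \<and> f (f y) = y \<and> t (f y) = t y" if "y \<in> ?S" for y
      using that less.prems(2)[of y] less.prems(2)[of x] x by auto
    then have "even (sum t ?S)" using less.hyps[OF c] less.prems(1) by auto
    moreover have "sum t S = t x + (t (f x) + sum t ?S)"
    proof -
      have "sum t S = sum t (insert x (insert (f x) ?S))" using S by (rule arg_cong)
      also have "\<dots> = t x + sum t (insert (f x) ?S)"
        using less.prems(1) less.prems(2)[OF x] by (intro sum.insert) auto
      also have "sum t (insert (f x) ?S) = t (f x) + sum t ?S"
        using less.prems(1) by (intro sum.insert) auto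
      finally show ?thesis .
    qed
    ultimately show ?thesis using less.prems(2)[OF x] by simp
  qed simp
qed

text \<open>A permutation and its inverse contribute equally, so modulo 2 only involutions count.\<close>

lemma pdet_odd_if_unique_involution:
  fixes a :: "nat \<Rightarrow> nat \<Rightarrow> int"
  assumes X: "finite X" "even (card X)" and skew: "\<And>i j. a j i = - a i j"
    and p: "p permutes X" "\<And>i. i \<in> X \<Longrightarrow> p (p i) = i" "\<And>i. i \<in> X \<Longrightarrow> odd (a i (p i))"
    and unique: "\<And>q. q permutes X \<Longrightarrow> (\<And>i. i \<in> X \<Longrightarrow> q (q i) = i) \<Longrightarrow> (\<And>i. i \<in> X \<Longrightarrow> a i (q i) \<noteq> 0) \<Longrightarrow> q = p"
  shows "odd (pdet a X)"
proof -
  let ?f = "\<lambda>p. sign p * (\<Prod>i\<in>X. a i (p i))"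
  let ?P = "{p. p permutes X}"
  let ?N = "{q \<in> ?P. inv_into UNIV q \<noteq> q}"
  have fin: "finite ?P" using X by (simp add: finite_permutations)
  have inv: "?f (inv_into UNIV q) = ?f q" if "q permutes X" for q
  proof -
    have "(\<Prod>i\<in>X. a i (inv_into UNIV q i)) = (\<Prod>i\<in>X. a (q i) (inv_into UNIV q (q i)))"
      using prod.reindex_bij_betw[OF permutes_imp_bij[OF that], of "\<lambda>i. a i (inv_into UNIV q i)"]
      by (rule sym)
    also have "\<dots> = (\<Prod>i\<in>X. - a i (q i))"
    proof (intro prod.cong refl)
      fix i
      show "a (q i) (inv_into UNIV q (q i)) = - a i (q i)"
        using skew[of i "q i"] that by (simp add: permutes_inverses)
    qed
    \<comment> \<open>Transposing negates every factor, and there are evenly many of them.\<close>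
    also have "\<dots> = (\<Prod>i\<in>X. a i (q i))" using X(2) by (simp add: prod_uminus)
    finally show ?thesis using that X(1) by (simp add: sign_inverse permutes_imp_permutation)
  qed
  have "even (sum ?f ?N)"
  proof (rule even_sum_involution[where f = "inv_into UNIV"])
    show "finite ?N" using fin by auto
    fix q assume "q \<in> ?N"
    then show "inv_into UNIV q \<in> ?N \<and> inv_into UNIV q \<noteq> q \<and> inv_into UNIV (inv_into UNIV q) = q \<and> ?f (inv_into UNIV q) = ?f q"
      using inv by (auto simp: permutes_inv permutes_inv_inv)
  qed
  moreover have inv_p: "inv_into UNIV p = p"
    using p(1,2) by (intro ext) (metis permutes_inv_eq permutes_not_in)
  have "sum ?f (?P - ?N) = ?f p"
  proof -
    have "sum ?f (?P - ?N) = sum ?f {p}"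
    proof (rule sum.mono_neutral_right)
      show "finite (?P - ?N)" using fin by auto
      show "{p} \<subseteq> ?P - ?N" using p(1) inv_p by auto
      show "\<forall>q\<in>?P - ?N - {p}. ?f q = 0"
      proof (rule ballI, rule ccontr)
        fix q assume q: "q \<in> ?P - ?N - {p}" and "?f q \<noteq> 0"
        then have "a i (q i) \<noteq> 0" if "i \<in> X" for i
          using that X by (metis mult_zero_right prod_zero)
        moreover have "q (q i) = i" for i using q by (metis (mono_tags, lifting) DiffD1 DiffD2 mem_Collect_eq permutes_inverses(1))
        ultimately have "q = p" using q by (intro unique) auto
        then show False using q by simp
      qed
    qed
    then show ?thesis by simp
  qed
  moreover have "pdet a X = sum ?f ?N + sum ?f (?P - ?N)"
    unfolding pdet_def of_int_eq_id id_apply using fin by (subst sum.subset_diff[of ?N ?P]) auto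
  moreover have "odd (?f p)"
  proof -
    have "odd (\<Prod>i\<in>X. a i (p i))" using p(3) X(1) by (simp add: even_prod_iff)
    moreover have "odd (sign p)" by (simp add: sign_def)
    ultimately show ?thesis by simp
  qed
  ultimately show ?thesis by simp
qed

text \<open>Expand every factor of the Leibniz product of \<open>x I - a\<close> as a sum of two
  terms: \<open>X\<close> collects the rows that contribute \<open>- a i j\<close>. The remaining
  rows are diagonal, so they contribute \<open>x\<close> each and confine the permutation to
  \<open>X\<close>.\<close>

lemma char_poly_eq_sum_pdet:
  "char_poly (mat n n (\<lambda>(i, j). a i j)) =
     (\<Sum>X\<in>Pow {0..<n}. monom (pdet (\<lambda>i j. - a i j) X) (n - card X))"
proof -
  let ?V = "{0..<n}"
  let ?x = "[:0, 1:] :: 'a poly"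
  have cp: "char_poly_matrix (mat n n (\<lambda>(i, j). a i j)) =
      mat n n (\<lambda>(i, j). (if i = j then ?x else 0) + [:- a i j:])"
    unfolding char_poly_matrix_def by (intro eq_matI) (auto)
  have "char_poly (mat n n (\<lambda>(i, j). a i j)) = pdet (\<lambda>i j. (if i = j then ?x else 0) + [:- a i j:]) ?V"
    unfolding char_poly_def cp pdet_eq_det by simp
  also have "\<dots> = (\<Sum>p | p permutes ?V. \<Sum>X\<in>Pow ?V. of_int (sign p) * 
      ((\<Prod>i\<in>?V - X. if i = p i then ?x else 0) * (\<Prod>i\<in>X. [:- a i (p i):])))"
  proof -
    have "(\<Prod>i\<in>?V. (if i = p i then ?x else 0) + [:- a i (p i):]) =
      (\<Sum>X\<in>Pow ?V. (\<Prod>i\<in>?V - X. if i = p i then ?x else 0) * (\<Prod>i\<in>X. [:- a i (p i):]))" for p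
      by (subst add.commute, subst prod_add) (auto intro: sum.cong simp: mult.commute)
    then show ?thesis unfolding pdet_def by (simp add: sum_distrib_left)
  qed
  also have "\<dots> = (\<Sum>X\<in>Pow ?V. \<Sum>p | p permutes ?V. of_int (sign p) * 
      ((\<Prod>i\<in>?V - X. if i = p i then ?x else 0) * (\<Prod>i\<in>X. [:- a i (p i):])))"
    by (rule sum.swap)
  also have "\<dots> = (\<Sum>X\<in>Pow ?V. monom (pdet (\<lambda>i j. - a i j) X) (n - card X))"
  proof (intro sum.cong refl)
    fix X assume "X \<in> Pow ?V"
    then have X: "X \<subseteq> ?V" by simp
    let ?c = "\<lambda>i j. if i \<in> X then [:- a i j:] else if i = j then ?x else 0"
    have "(\<Sum>p | p permutes ?V. of_int (sign p) * 
      ((\<Prod>i\<in>?V - X. if i = p i then ?x else 0) * (\<Prod>i\<in>X. [:- a i (p i):]))) = pdet ?c ?V"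
      unfolding pdet_def
    proof (intro sum.cong refl)
      fix p :: "nat \<Rightarrow> nat"
      have "(\<Prod>i\<in>?V. ?c i (p i)) = (\<Prod>i\<in>?V - X. ?c i (p i)) * (\<Prod>i\<in>X. ?c i (p i))"
        using X by (intro prod.subset_diff) auto
      then show "of_int (sign p) * ((\<Prod>i\<in>?V - X. if i = p i then ?x else 0) * (\<Prod>i\<in>X. [:- a i (p i):]))
        = of_int (sign p) * (\<Prod>i\<in>?V. ?c i (p i))" by simp
    qed
    also have "\<dots> = (\<Prod>i\<in>?V - X. ?c i i) * pdet ?c X"
      by (rule pdet_restrict) (use X in auto)
    also have "(\<Prod>i\<in>?V - X. ?c i i) = ?x ^ (n - card X)"
      using X by (simp add: card_Diff_subset finite_subset)
    also have "pdet ?c X = pdet (\<lambda>i j. [:- a i j:]) X" by (rule pdet_cong) simp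
    also have "\<dots> = [:pdet (\<lambda>i j. - a i j) X:]"
    proof -
      have "of_int k * (\<Prod>i\<in>X. [:f i:]) = [:of_int k * (\<Prod>i\<in>X. f i):]" for k and f :: "nat \<Rightarrow> 'a"
      proof -
        have 1: "(\<Prod>i\<in>X. [:f i:]) = [:\<Prod>i\<in>X. f i:]"
          by (induction X rule: infinite_finite_induct) (auto simp: one_pCons)
        show ?thesis unfolding 1 by (simp add: of_int_poly)
      qed
      moreover have "(\<Sum>p\<in>S. [:g p:]) = [:\<Sum>p\<in>S. g p:]" for S and g :: "(nat \<Rightarrow> nat) \<Rightarrow> 'a"
        by (induction S rule: infinite_finite_induct) auto
      ultimately show ?thesis unfolding pdet_def by simp
    qed
    also have "?x ^ (n - card X) * [:pdet (\<lambda>i j. - a i j) X:] = monom (pdet (\<lambda>i j. - a i j) X) (n - card X)"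
      by (simp add: monom_altdef)
    finally show "(\<Sum>p | p permutes ?V. of_int (sign p) * 
      ((\<Prod>i\<in>?V - X. if i = p i then ?x else 0) * (\<Prod>i\<in>X. [:- a i (p i):]))) = 
      monom (pdet (\<lambda>i j. - a i j) X) (n - card X)" .
  qed
  finally show ?thesis .
qed

text \<open>In even order the sign of \<open>- a\<close> disappears from the minors.\<close>

lemma coeff_char_poly_eq_sum_pdet:
  fixes a :: "nat \<Rightarrow> nat \<Rightarrow> int"
  assumes "k \<le> n" "even k"
  shows "coeff (char_poly (mat n n (\<lambda>(i, j). a i j))) (n - k) =
     (\<Sum>X | X \<subseteq> {0..<n} \<and> card X = k. pdet a X)"
proof -
  have neg: "pdet (\<lambda>i j. - a i j) X = pdet a X" if "card X = k" for X
    using that assms(2) by (simp add: pdet_def prod_uminus)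
  have "coeff (char_poly (mat n n (\<lambda>(i, j). a i j))) (n - k)
    = (\<Sum>X\<in>Pow {0..<n}. if n - card X = n - k then pdet (\<lambda>i j. - a i j) X else 0)"
    by (simp add: char_poly_eq_sum_pdet coeff_sum)
  also have "\<dots> = (\<Sum>X\<in>Pow {0..<n} \<inter> {X. n - card X = n - k}. pdet (\<lambda>i j. - a i j) X)"
    by (simp add: sum.inter_restrict)
  \<comment> \<open>Truncated subtraction from \<open>n\<close> is injective here, because
    \<open>card X\<close> is at most \<open>n\<close>.\<close>
  also have "Pow {0..<n} \<inter> {X. n - card X = n - k} = {X. X \<subseteq> {0..<n} \<and> card X = k}"
  proof -
    have "card X \<le> n" if "X \<subseteq> {0..<n}" for X
      using card_mono[OF _ that] by simp
    then show ?thesis using assms(1) by auto (metis diff_diff_cancel)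
  qed
  finally show ?thesis using neg by simp
qed

section \<open>Weighted matchings of paths\<close>

text \<open>
  The edges of a path are numbered \<open>0, 1, \<dots>\<close>, so that its matchings are the sparse sets. The last
  argument of \<open>scount\<close> is the number of further edges, off the path, that are already chosen.
\<close>

definition sparse :: "nat set \<Rightarrow> bool" where
  "sparse S \<longleftrightarrow> (\<forall>x\<in>S. Suc x \<notin> S)"

definition scount :: "(nat \<Rightarrow> nat) \<Rightarrow> nat \<Rightarrow> nat set \<Rightarrow> nat \<Rightarrow> nat" where
  "scount w i E c = (\<Sum>S | S \<subseteq> E \<and> sparse S \<and> card S + c = i. \<Prod>k\<in>S. w k)"

abbreviation tcount :: "nat \<Rightarrow> nat set \<Rightarrow> nat \<Rightarrow> nat" where
  "tcount \<equiv> scount (\<lambda>_. 1)"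

lemma tcount_card: "tcount i E c = card {S. S \<subseteq> E \<and> sparse S \<and> card S + c = i}"
  by (simp add: scount_def)

lemma scount_cong: "(\<And>k. k \<in> E \<Longrightarrow> w k = w' k) \<Longrightarrow> scount w i E c = scount w' i E c"
  unfolding scount_def by (intro sum.cong refl prod.cong) auto

text \<open>The matching recursion: either edge \<open>a\<close> is avoided, or it is used and its
  neighbours are lost. A used edge moves to the last argument, so \<open>i\<close> stays fixed. For
  \<open>a = 0\<close> the truncated \<open>a - 1\<close> is \<open>a\<close> itself, which is
  harmless.\<close>

lemma scount_remove:
  assumes E: "finite E" and a: "a \<in> E"
  shows "scount w i E c = scount w i (E - {a}) c + w a * scount w i (E - {a - 1, a, Suc a}) (Suc c)"
proof -
  let ?F = "\<lambda>E c. {S. S \<subseteq> E \<and> sparse S \<and> card S + c = i}"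
  let ?E = "E - {a - 1, a, Suc a}"
  have fin: "finite (?F E c)" for c using E by auto
  have fin': "finite (?F ?E (Suc c))" using E by auto
  have split: "?F E c = ?F (E - {a}) c \<union> insert a ` ?F ?E (Suc c)"
  proof (intro equalityI subsetI)
    fix S assume S: "S \<in> ?F E c"
    show "S \<in> ?F (E - {a}) c \<union> insert a ` ?F ?E (Suc c)"
    proof (cases "a \<in> S")
      case True
      then have "Suc a \<notin> S" using S by (simp add: sparse_def)
      moreover have "a - 1 \<notin> S - {a}"
      proof
        assume "a - 1 \<in> S - {a}"
        moreover from this have "Suc (a - 1) = a" by (cases a) auto
        ultimately show False using S True by (auto simp: sparse_def)
      qed
      moreover have "card S = Suc (card (S - {a}))"
        using True S E by (metis (no_types, lifting) card_Suc_Diff1 finite_subset mem_Collect_eq)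
      ultimately have "S - {a} \<in> ?F ?E (Suc c)"
        using S by (auto simp: sparse_def)
      moreover have "S = insert a (S - {a})" using True by auto
      ultimately show ?thesis by blast
    qed (use S in auto)
  next
    fix S assume "S \<in> ?F (E - {a}) c \<union> insert a ` ?F ?E (Suc c)"
    then consider "S \<in> ?F (E - {a}) c" | T where "T \<in> ?F ?E (Suc c)" "S = insert a T" by auto
    then show "S \<in> ?F E c"
    proof cases
      case 2
      then have "a \<notin> T" "finite T" using E by (auto dest: finite_subset)
      then have "card S + c = i" using 2 by auto
      moreover have "Suc x \<noteq> a" "x \<noteq> Suc a" if "x \<in> T" for x using 2 that by auto
      then have "sparse S"
        using 2 \<open>a \<notin> T\<close> unfolding sparse_def by auto
      ultimately show ?thesis using 2 a by auto
    qed auto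
  qed
  have inj: "inj_on (insert a) (?F ?E (Suc c))"
  proof (rule inj_onI)
    fix S T assume "S \<in> ?F ?E (Suc c)" "T \<in> ?F ?E (Suc c)" "insert a S = insert a T"
    moreover from this have "a \<notin> S" "a \<notin> T" by auto
    ultimately show "S = T" by (simp add: insert_ident)
  qed
  have "scount w i E c = (\<Sum>S\<in>?F (E - {a}) c. \<Prod>k\<in>S. w k) + (\<Sum>S\<in>insert a ` ?F ?E (Suc c). \<Prod>k\<in>S. w k)"
    unfolding scount_def split using E by (intro sum.union_disjoint) auto
  also have "(\<Sum>S\<in>insert a ` ?F ?E (Suc c). \<Prod>k\<in>S. w k) = (\<Sum>S\<in>?F ?E (Suc c). w a * (\<Prod>k\<in>S. w k))"
    unfolding sum.reindex[OF inj] comp_def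
    by (intro sum.cong refl prod.insert) (use E in \<open>auto dest: finite_subset\<close>)
  finally show ?thesis by (simp add: scount_def sum_distrib_left)
qed

lemma scount_lessThan_Suc:
  "scount w i {..<Suc e} c = scount w i {..<e} c + w e * scount w i {..<e - 1} (Suc c)"
proof -
  have "{..<Suc e} - {e} = {..<e}" "{..<Suc e} - {e - 1, e, Suc e} = {..<e - 1}" by auto
  then show ?thesis using scount_remove[of "{..<Suc e}" e w i c] by simp
qed

text \<open>A shift whose amount never decreases keeps or widens every gap, so it maps sparse sets
  injectively to sparse sets of the same size. Pieces of a path are compared below by jumping over
  deleted edges in this way.\<close>

lemma tcount_shift:
  assumes "finite E'" "\<And>x. x \<in> E \<Longrightarrow> x + g x \<in> E'"
    "\<And>x y. x < y \<Longrightarrow> g x \<le> (g y :: nat)"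
  shows "tcount i E c \<le> tcount i E' c"
  unfolding tcount_card
proof (rule card_inj_on_le[where f = "image (\<lambda>x. x + g x)"])
  let ?f = "\<lambda>x. x + g x"
  have less: "?f x < ?f y" if "x < y" for x y using assms(3)[OF that] that by linarith
  have inj: "inj ?f" by (rule injI) (metis less less_irrefl nat_neq_iff)
  show "inj_on ((`) ?f) {S. S \<subseteq> E \<and> sparse S \<and> card S + c = i}"
    using inj by (meson inj_image_eq_iff inj_onI)
  show "(`) ?f ` {S. S \<subseteq> E \<and> sparse S \<and> card S + c = i} \<subseteq> {S. S \<subseteq> E' \<and> sparse S \<and> card S + c = i}"
  proof (rule image_subsetI)
    fix S assume S: "S \<in> {S. S \<subseteq> E \<and> sparse S \<and> card S + c = i}"
    have "sparse (?f ` S)" unfolding sparse_def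
    proof (intro ballI notI)
      fix x assume "x \<in> ?f ` S" "Suc x \<in> ?f ` S"
      then obtain u v where uv: "u \<in> S" "v \<in> S" "?f v = Suc (?f u)" by auto
      then have "u < v" using less[of v u] by (cases u v rule: linorder_cases) auto
      then have "v = Suc u" using uv(3) assms(3)[of u v] by linarith
      then show False using S uv by (auto simp: sparse_def)
    qed
    moreover have "card (?f ` S) = card S" using inj by (simp add: card_image inj_on_subset)
    ultimately show "?f ` S \<in> {S. S \<subseteq> E' \<and> sparse S \<and> card S + c = i}"
      using S assms(2) by auto
  qed
qed (use assms(1) in auto)

lemma tcount_mono: "finite E' \<Longrightarrow> E \<subseteq> E' \<Longrightarrow> tcount i E c \<le> tcount i E' c"
  by (rule tcount_shift[where g = "\<lambda>_. 0"]) auto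

lemma tcount_delete_edge: "tcount i {..<d - 1} c \<le> tcount i ({..<d} - {h}) c"
  by (rule tcount_shift[where g = "\<lambda>x. if x < h then 0 :: nat else 1"])
    auto

text \<open>Path vertex \<open>j\<close> meets the edges \<open>j - 1\<close> and \<open>j\<close>,
  and the shift jumps over both. At \<open>j = 0\<close> the truncated \<open>j - 1\<close> is
  \<open>0\<close>, and a single edge is lost.\<close>

lemma tcount_delete_vertex: "tcount i {..<d - 2} c \<le> tcount i ({..<d} - {j - 1, j}) c"
  by (rule tcount_shift[where g = "\<lambda>x. if x < j - 1 then 0 else 2"])
    auto

lemma tcount_delete_two_vertices:
  assumes "j \<noteq> l"
  shows "tcount i {..<d - 4} c \<le> tcount i ({..<d} - {j - 1, j, l - 1, l}) c"
proof -
  \<comment> \<open>Two jumps by 2: the condition \<open>x + 3 < l\<close> says that the image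
    \<open>x + 2\<close> still lies before the second gap, which starts at
    \<open>l - 1\<close>.\<close>
  have *: "tcount i {..<d - 4} c \<le> tcount i ({..<d} - {j - 1, j, l - 1, l}) c" if "j < l" for j l
    by (rule tcount_shift[where g = "\<lambda>x. if x < j - 1 then 0 else if x + 3 < l then 0 + 2 else 4"])
      (use that in auto)
  have "{j - 1, j, l - 1, l} = {l - 1, l, j - 1, j}" by auto
  then show ?thesis using *[of j l] *[of l j] assms by (metis nat_neq_iff)
qed

text \<open>
  If a vertex off the path is joined to the path vertices \<open>j\<close> and \<open>j + 2\<close>, the two sets on the right are
  the path edges that can accompany the edge to \<open>j + 2\<close>, respectively the one to \<open>j\<close>, without
  completing a perfect matching of the 4-cycle.
\<close>

lemma tcount_heavy:
  assumes "j + 2 \<le> d"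
  shows "tcount i {..<d - 2} c + tcount i {..<d - 4} c \<le>
    tcount i ({..<d} - {j, j + 1, j + 2}) c + tcount i ({..<d} - {j - 1, j, j + 1}) c"
proof (cases "j < d - 2")
  case True
  let ?E2 = "{..<d} - {j - 1, j, j + 1}"
  \<comment> \<open>Sets avoiding edge \<open>j\<close> fit into the first set on the right. Sets
    using it become sets of \<open>?E2\<close> that use edge \<open>j + 2\<close>, and the sets of
    \<open>?E2\<close> avoiding \<open>j + 2\<close> have room for a path with \<open>d - 4\<close>
    edges.\<close>
  have "tcount i {..<d - 2} c = tcount i ({..<d - 2} - {j}) c
      + tcount i ({..<d - 2} - {j - 1, j, Suc j}) (Suc c)"
    using True by (subst scount_remove[where a = j]) auto
  moreover have "tcount i ({..<d - 2} - {j}) c \<le> tcount i ({..<d} - {j, j + 1, j + 2}) c"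
    by (rule tcount_shift[where g = "\<lambda>x. if x < j then 0 else 2"])
      auto
  moreover have "tcount i ({..<d - 2} - {j - 1, j, Suc j}) (Suc c)
      \<le> tcount i (?E2 - {j + 2 - 1, j + 2, Suc (j + 2)}) (Suc c)"
    by (rule tcount_shift[where g = "\<lambda>x. if x < j then 0 else 2"])
      auto
  moreover have "tcount i {..<d - 4} c \<le> tcount i (?E2 - {j + 2}) c"
    by (rule tcount_shift[where g = "\<lambda>x. if x < j - 1 then 0 else 4"])
      auto
  moreover have "tcount i ?E2 c = tcount i (?E2 - {j + 2}) c
      + tcount i (?E2 - {j + 2 - 1, j + 2, Suc (j + 2)}) (Suc c)"
    using True by (subst scount_remove[where a = "j + 2"]) auto
  ultimately show ?thesis by linarith
next
  case False
  have "tcount i {..<d - 2} c \<le> tcount i ({..<d} - {j, j + 1, j + 2}) c"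
    by (rule tcount_mono) (use False in auto)
  moreover have "tcount i {..<d - 4} c \<le> tcount i ({..<d} - {j - 1, j, j + 1}) c"
    by (rule tcount_mono) (use assms False in auto)
  ultimately show ?thesis by linarith
qed

text \<open>If \<open>k\<close> is next to the 4-cycle, the deleted edges overlap and one of the two
  sets already has room for \<open>d - 4\<close> edges; otherwise the two are combined as in
  \<open>tcount_heavy\<close>. Vertex \<open>k\<close> is the one occupied by another off-path
  edge.\<close>

lemma tcount_heavy_delete_vertex:
  assumes k: "k \<notin> {j, j + 1, j + 2}" and j: "j + 2 \<le> d"
  shows "tcount i {..<d - 4} c \<le> tcount i ({..<d} - {k - 1, k, j, j + 1, j + 2}) c
    + tcount i ({..<d} - {k - 1, k, j - 1, j, j + 1}) c"
proof -
  let ?E1 = "{..<d} - {k - 1, k, j, j + 1, j + 2}" and ?E2 = "{..<d} - {k - 1, k, j - 1, j, j + 1}"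
  \<comment> \<open>\<open>l\<close> is the edge of the short path that the shift sends to
    \<open>j + 2\<close>. Sets avoiding \<open>l\<close> go to \<open>?E1\<close>, sets using
    \<open>l\<close> to those sets of \<open>?E2\<close> that use \<open>j + 2\<close>.\<close>
  have split: "tcount i {..<d - 4} c \<le> tcount i ?E1 c + tcount i ?E2 c"
    if 1: "tcount i ({..<d - 4} - {l}) c \<le> tcount i ?E1 c"
      and 2: "tcount i ({..<d - 4} - {l - 1, l, Suc l}) (Suc c) \<le>
        tcount i (?E2 - {j + 2 - 1, j + 2, Suc (j + 2)}) (Suc c)"
      and 3: "l < d - 4 \<Longrightarrow> j + 2 \<in> ?E2" for l
  proof (cases "l < d - 4")
    case True
    have "tcount i {..<d - 4} c = tcount i ({..<d - 4} - {l}) c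
        + tcount i ({..<d - 4} - {l - 1, l, Suc l}) (Suc c)"
      using True by (subst scount_remove[where a = l]) auto
    moreover have "tcount i ?E2 c = tcount i (?E2 - {j + 2}) c
        + tcount i (?E2 - {j + 2 - 1, j + 2, Suc (j + 2)}) (Suc c)"
      using 3[OF True] by (subst scount_remove[where a = "j + 2"]) auto
    ultimately show ?thesis using 1 2 by linarith
  next
    case False
    then have "{..<d - 4} - {l} = {..<d - 4}" by auto
    then show ?thesis using 1 by simp
  qed
  consider "Suc k = j" | "k + 2 \<le> j" | "k = j + 3" | "j + 4 \<le> k" using k by force
  then show ?thesis
  proof cases
    case 1
    have "tcount i {..<d - 4} c \<le> tcount i ?E2 c"
      by (rule tcount_shift[where g = "\<lambda>x. if x < k - 1 then 0 else 4"])
        (use 1 in auto)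
    then show ?thesis by linarith
  next
    case 2
    let ?f = "\<lambda>x. if x < k - 1 then 0 else if x + 2 < j then 0 + 2 else 4"
    show ?thesis
    proof (rule split[of "j - 2"])
      show "tcount i ({..<d - 4} - {j - 2}) c \<le> tcount i ?E1 c"
        by (rule tcount_shift[where g = ?f])
          (use 2 in auto)
      show "tcount i ({..<d - 4} - {j - 2 - 1, j - 2, Suc (j - 2)}) (Suc c) \<le>
        tcount i (?E2 - {j + 2 - 1, j + 2, Suc (j + 2)}) (Suc c)"
        by (rule tcount_shift[where g = ?f])
          (use 2 in auto)
    qed (use 2 in auto)
  next
    case 3
    have "tcount i {..<d - 4} c \<le> tcount i ?E1 c"
      by (rule tcount_shift[where g = "\<lambda>x. if x < j then 0 else 4"])
        (use 3 in auto)
    then show ?thesis by linarith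
  next
    case 4
    let ?f = "\<lambda>x. if x < j then 0 else if x + 3 < k then 0 + 2 else 4"
    show ?thesis
    proof (rule split[of j])
      show "tcount i ({..<d - 4} - {j}) c \<le> tcount i ?E1 c"
        by (rule tcount_shift[where g = ?f])
          (use 4 in auto)
      show "tcount i ({..<d - 4} - {j - 1, j, Suc j}) (Suc c) \<le>
        tcount i (?E2 - {j + 2 - 1, j + 2, Suc (j + 2)}) (Suc c)"
        by (rule tcount_shift[where g = ?f])
          (use 4 in auto)
    qed (use 4 in auto)
  qed
qed

text \<open>All three follow by unfolding the path recursion. They measure the reserve that is left
  when an off-path edge blocks fewer path edges than in the worst case.\<close>

lemma tcount_surplus:
  assumes "3 \<le> d"
  shows "tcount i {..<d - 2} c + 2 * tcount i {..<d - 4} (Suc c) \<le> tcount i {..<d} c"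
    and "tcount i {..<d - 2} c + tcount i {..<d - 4} (Suc c) \<le> tcount i {..<d - 1} c"
    and "tcount i {..<d - 4} c + tcount i {..<d - 4} (Suc c) \<le> tcount i {..<d - 2} c"
proof -
  define e where "e = d - 3"
  have e: "d = Suc (Suc (Suc e))" using assms unfolding e_def by linarith
  have m: "tcount i {..<a} c \<le> tcount i {..<b} c" if "a \<le> b" for a b c
    by (rule tcount_mono) (use that in auto)
  have r: "tcount i {..<Suc e} c = tcount i {..<e} c + tcount i {..<e - 1} (Suc c)" for e c
    using scount_lessThan_Suc[of "\<lambda>_. 1" i e c] by simp
  show "tcount i {..<d - 2} c + 2 * tcount i {..<d - 4} (Suc c) \<le> tcount i {..<d} c"
    using r[of "Suc (Suc e)" c] r[of "Suc e" c] m[of "e - 1" e "Suc c"] m[of e "Suc e" "Suc c"]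
    by (simp add: e)
  show "tcount i {..<d - 2} c + tcount i {..<d - 4} (Suc c) \<le> tcount i {..<d - 1} c"
    using r[of "Suc e" c] m[of "e - 1" e "Suc c"] by (simp add: e)
  show "tcount i {..<d - 4} c + tcount i {..<d - 4} (Suc c) \<le> tcount i {..<d - 2} c"
    using r[of e c] m[of "e - 1" e c] by (simp add: e)
qed

text \<open>Split the last three weights as \<open>1 + 2\<close>, \<open>1 + 2\<close> and
  \<open>1 + m\<close>. The excess \<open>m\<close> of the last edge leaves \<open>d - 2\<close>
  edges ending in one of weight 3, which gives the factor of \<open>m\<close>; the two excesses 2
  combine by the path recursion into the last summand.\<close>

lemma scount_weighted_path:
  assumes "3 \<le> d"
  shows "scount (\<lambda>k. if k < d - 3 then 1 else if k < d - 1 then 3 else Suc m) i {..<d} 0 =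
    tcount i {..<d} 0 + m * (tcount i {..<d - 2} 1 + 2 * tcount i {..<d - 4} 2)
      + 2 * (tcount i {..<d - 2} 1 + tcount i {..<d - 4} 1)"
proof -
  define e where "e = d - 3"
  have e: "d = Suc (Suc (Suc e))" using assms unfolding e_def by linarith
  let ?w = "\<lambda>k. if k < e then 1 else if k < Suc (Suc e) then 3 else Suc m"
  have r: "tcount i {..<Suc e} c = tcount i {..<e} c + tcount i {..<e - 1} (Suc c)" for e c
    using scount_lessThan_Suc[of "\<lambda>_. 1" i e c] by simp
  have w: "scount ?w i {..<k} c = tcount i {..<k} c" if "k \<le> e" for k c
    by (rule scount_cong) (use that in auto)
  have w1: "scount ?w i {..<Suc e} c = tcount i {..<e} c + 3 * tcount i {..<e - 1} (Suc c)" for c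
    unfolding scount_lessThan_Suc w[OF order_refl] w[OF diff_le_self] by simp
  have w2: "scount ?w i {..<Suc (Suc e)} c = tcount i {..<e} c + 3 * tcount i {..<e - 1} (Suc c)
      + 3 * tcount i {..<e} (Suc c)" for c
    unfolding scount_lessThan_Suc[of _ _ "Suc e"] w1 by (simp add: w)
  have "scount ?w i {..<Suc (Suc (Suc e))} 0 = scount ?w i {..<Suc (Suc e)} 0
      + Suc m * scount ?w i {..<Suc e} 1"
    unfolding scount_lessThan_Suc[of _ _ "Suc (Suc e)"] by simp
  moreover have "(\<lambda>k. if k < d - 3 then 1 else if k < d - 1 then 3 else Suc m) = ?w"
    unfolding e by (intro ext) simp
  ultimately show ?thesis
    using w1[of 1, unfolded Suc_1] w2[of 0] r[of "Suc (Suc e)" 0] r[of "Suc e" 0] r[of e 0]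
      r[of e 1, unfolded Suc_1]
    by (simp add: e distrib_left distrib_right)
qed

section \<open>Even edge sets\<close>

definition symdiff :: "'a set \<Rightarrow> 'a set \<Rightarrow> 'a set" where
  "symdiff A B = (A - B) \<union> (B - A)"

text \<open>The boundary map of a graph over the field with two elements: edge sets are the vectors,
  \<open>symdiff\<close> is the addition, and \<open>even_sets\<close> is the kernel, that is, the
  cycle space.\<close>

definition odd_verts :: "'a set set \<Rightarrow> 'a set" where
  "odd_verts F = {v. odd (card {e \<in> F. v \<in> e})}"

definition even_sets :: "'a set set \<Rightarrow> 'a set set set" where
  "even_sets H = {F. F \<subseteq> H \<and> odd_verts F = {}}"

lemma symdiff_cancel [simp]: "symdiff A (symdiff A B) = B" "symdiff A {} = A" "symdiff {} A = A"
  by (auto simp: symdiff_def)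

lemma symdiff_self_iff: "symdiff A B = {} \<longleftrightarrow> A = B"
  by (auto simp: symdiff_def)

lemma card_symdiff:
  assumes "finite A" "finite B"
  shows "card (symdiff A B) + 2 * card (A \<inter> B) = card A + card B"
proof -
  have "card (symdiff A B) = card (A - B) + card (B - A)"
    unfolding symdiff_def using assms by (intro card_Un_disjoint) auto
  moreover have "card X = card (X - Y) + card (X \<inter> Y)" if "finite X" for X Y :: "'a set"
  proof -
    have "card ((X - Y) \<union> (X \<inter> Y)) = card (X - Y) + card (X \<inter> Y)"
      using that by (intro card_Un_disjoint) auto
    then show ?thesis by (simp add: Un_Diff_Int)
  qed
  from this[OF assms(1), of B] this[OF assms(2), of A]
  have "card A = card (A - B) + card (A \<inter> B)" "card B = card (B - A) + card (A \<inter> B)"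
    by (simp_all add: Int_commute)
  ultimately show ?thesis by simp
qed

lemma odd_verts_symdiff:
  assumes "finite F" "finite F'"
  shows "odd_verts (symdiff F F') = symdiff (odd_verts F) (odd_verts F')"
proof -
  have "odd (card {e \<in> symdiff F F'. v \<in> e}) \<longleftrightarrow> odd (card {e \<in> F. v \<in> e}) \<noteq> odd (card {e \<in> F'. v \<in> e})" for v
  proof -
    have "{e \<in> symdiff F F'. v \<in> e} = symdiff {e \<in> F. v \<in> e} {e \<in> F'. v \<in> e}"
      by (auto simp: symdiff_def)
    then have "card {e \<in> symdiff F F'. v \<in> e} + 2 * card ({e \<in> F. v \<in> e} \<inter> {e \<in> F'. v \<in> e})
        = card {e \<in> F. v \<in> e} + card {e \<in> F'. v \<in> e}"
      using card_symdiff[of "{e \<in> F. v \<in> e}" "{e \<in> F'. v \<in> e}"] assms by simp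
    then show ?thesis by presburger
  qed
  then show ?thesis by (auto simp: odd_verts_def symdiff_def)
qed

lemma odd_verts_empty [simp]: "odd_verts {} = {}"
  by (simp add: odd_verts_def)

lemma odd_verts_singleton: "odd_verts {e} = e"
proof -
  have "{f \<in> {e}. v \<in> f} = (if v \<in> e then {e} else {})" for v by auto
  then show ?thesis by (simp add: odd_verts_def)
qed

lemma odd_verts_insert:
  assumes "finite F" "e \<notin> F"
  shows "odd_verts (insert e F) = symdiff e (odd_verts F)"
proof -
  have "insert e F = symdiff {e} F" using assms by (auto simp: symdiff_def)
  then show ?thesis using odd_verts_symdiff[of "{e}" F] assms by (simp add: odd_verts_singleton)
qed

lemma odd_verts_subset: "odd_verts F \<subseteq> \<Union>F"
proof
  fix v assume "v \<in> odd_verts F"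
  then have "{e \<in> F. v \<in> e} \<noteq> {}" unfolding odd_verts_def by (metis card.empty even_zero mem_Collect_eq)
  then show "v \<in> \<Union>F" by auto
qed

text \<open>Each edge toggles the parity of two vertices: the handshake lemma.\<close>

lemma even_card_odd_verts:
  assumes "finite F" "\<And>e. e \<in> F \<Longrightarrow> card e = 2"
  shows "finite (odd_verts F) \<and> even (card (odd_verts F))"
  using assms
proof (induction F)
  case (insert e F)
  then have IH: "finite (odd_verts F)" "even (card (odd_verts F))" and e: "card e = 2" by auto
  then have "finite e" by (metis card.infinite zero_neq_numeral)
  then have "card (symdiff e (odd_verts F)) + 2 * card (e \<inter> odd_verts F) = 2 + card (odd_verts F)"
    using card_symdiff[of e "odd_verts F"] IH e by simp
  then have "even (card (symdiff e (odd_verts F)))" using IH by presburger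
  moreover have "finite (symdiff e (odd_verts F))" using IH \<open>finite e\<close> by (simp add: symdiff_def)
  ultimately show ?case using insert by (simp add: odd_verts_insert)
qed simp

text \<open>Rank plus nullity, written with cardinalities: every fibre of \<open>odd_verts\<close>
  is a coset of \<open>even_sets H\<close>.\<close>

lemma card_Pow_odd_verts:
  assumes "finite H"
  shows "2 ^ card H = card (odd_verts ` Pow H) * card (even_sets H)"
proof -
  have fibre: "card {F \<in> Pow H. odd_verts F = b} = card (even_sets H)" if "b \<in> odd_verts ` Pow H" for b
  proof -
    from that have "\<exists>F0. F0 \<subseteq> H \<and> odd_verts F0 = b" by (auto simp: image_iff)
    then obtain F0 where F0: "F0 \<subseteq> H" "odd_verts F0 = b" by blast
    have fin: "finite F" if "F \<subseteq> H" for F using that assms by (rule finite_subset)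
    have "bij_betw (symdiff F0) {F \<in> Pow H. odd_verts F = b} (even_sets H)"
    proof (rule bij_betw_byWitness[where f' = "symdiff F0"])
      show "symdiff F0 ` {F \<in> Pow H. odd_verts F = b} \<subseteq> even_sets H"
        using F0 fin by (auto simp: even_sets_def odd_verts_symdiff symdiff_self_iff) (auto simp: symdiff_def)
      show "symdiff F0 ` even_sets H \<subseteq> {F \<in> Pow H. odd_verts F = b}"
        using F0 fin by (auto simp: even_sets_def odd_verts_symdiff) (auto simp: symdiff_def)
    qed auto
    then show ?thesis by (rule bij_betw_same_card)
  qed
  have "2 ^ card H = (\<Sum>F\<in>Pow H. 1 :: nat)" using assms by (simp add: card_Pow)
  also have "\<dots> = (\<Sum>b\<in>odd_verts ` Pow H. \<Sum>F\<in>{F \<in> Pow H. odd_verts F = b}. 1)"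
    by (rule sum.image_gen) (use assms in auto)
  also have "\<dots> = (\<Sum>b\<in>odd_verts ` Pow H. card (even_sets H))"
    using fibre by (intro sum.cong) auto
  finally show ?thesis by simp
qed

lemma card_even_subsets:
  assumes "finite Y" "y \<in> Y"
  shows "card {Z. Z \<subseteq> Y \<and> even (card Z)} = 2 ^ (card Y - 1)"
proof -
  let ?f = "\<lambda>Z. Z - {y}" and ?g = "\<lambda>Z. if even (card Z) then Z else insert y Z"
  have "bij_betw ?f {Z. Z \<subseteq> Y \<and> even (card Z)} (Pow (Y - {y}))"
  proof (rule bij_betw_byWitness[where f' = ?g])
    show "\<forall>Z\<in>{Z. Z \<subseteq> Y \<and> even (card Z)}. ?g (?f Z) = Z"
    proof
      fix Z assume "Z \<in> {Z. Z \<subseteq> Y \<and> even (card Z)}"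
      then have Z: "finite Z" "even (card Z)" using assms finite_subset by auto
      show "?g (?f Z) = Z"
      proof (cases "y \<in> Z")
        case True
        then have "card Z = Suc (card (Z - {y}))" using Z by (metis card_Suc_Diff1)
        then show ?thesis using Z True by auto
      qed (use Z in auto)
    qed
    show "\<forall>Z\<in>Pow (Y - {y}). ?f (?g Z) = Z" by auto
    show "?f ` {Z. Z \<subseteq> Y \<and> even (card Z)} \<subseteq> Pow (Y - {y})" by auto
    show "?g ` Pow (Y - {y}) \<subseteq> {Z. Z \<subseteq> Y \<and> even (card Z)}"
    proof (rule image_subsetI)
      fix Z assume Z: "Z \<in> Pow (Y - {y})"
      then have "finite Z" "y \<notin> Z" using assms finite_subset by auto
      then show "?g Z \<in> {Z. Z \<subseteq> Y \<and> even (card Z)}" using Z assms by auto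
    qed
  qed
  then have "card {Z. Z \<subseteq> Y \<and> even (card Z)} = card (Pow (Y - {y}))" by (rule bij_betw_same_card)
  then show ?thesis using assms by (simp add: card_Pow)
qed

text \<open>Boundaries are even subsets of \<open>Y\<close>, so the rank is at most
  \<open>card Y - 1\<close>.\<close>

lemma card_even_sets_ge:
  assumes "finite H" "\<And>e. e \<in> H \<Longrightarrow> card e = 2" "\<Union>H \<subseteq> Y" "finite Y" "Y \<noteq> {}"
  shows "2 ^ card H \<le> 2 ^ (card Y - 1) * card (even_sets H)"
proof -
  obtain y where y: "y \<in> Y" using assms by auto
  have "odd_verts ` Pow H \<subseteq> {Z. Z \<subseteq> Y \<and> even (card Z)}"
  proof (rule image_subsetI)
    fix F assume "F \<in> Pow H"
    then have "F \<subseteq> H" "finite F" using assms by (auto intro: finite_subset)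
    then have "odd_verts F \<subseteq> Y" "even (card (odd_verts F))"
      using odd_verts_subset[of F] even_card_odd_verts[of F] assms(2,3) by blast+
    then show "odd_verts F \<in> {Z. Z \<subseteq> Y \<and> even (card Z)}" by simp
  qed
  then have "card (odd_verts ` Pow H) \<le> 2 ^ (card Y - 1)"
    using card_mono[of "{Z. Z \<subseteq> Y \<and> even (card Z)}"] assms card_even_subsets[OF assms(4) y] by fastforce
  then show ?thesis by (simp add: card_Pow_odd_verts[OF assms(1)] mult_right_mono)
qed

text \<open>Connectedness makes every even vertex set a boundary, by pairing up its vertices and
  joining them by paths; so the rank is at least \<open>card V - 1\<close>.\<close>

lemma card_even_sets_connected_le:
  assumes E: "finite E" and V: "finite V" "V \<noteq> {}"
    and conn: "\<And>u v. u \<in> V \<Longrightarrow> v \<in> V \<Longrightarrow> (u, v) \<in> {(x, y). {x, y} \<in> E \<and> x \<noteq> y}\<^sup>*"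
  shows "2 ^ (card V - 1) * card (even_sets E) \<le> 2 ^ card E"
proof -
  have fin: "finite F" if "F \<subseteq> E" for F using that E by (rule finite_subset)
  \<comment> \<open>\<open>symdiff {u} {v}\<close> instead of \<open>{u, v}\<close> covers the
    trivial path with \<open>u = v\<close>.\<close>
  have pair: "\<exists>F\<subseteq>E. odd_verts F = symdiff {u} {v}" if "(u, v) \<in> {(x, y). {x, y} \<in> E \<and> x \<noteq> y}\<^sup>*" for u v
    using that
  proof induction
    case base
    show ?case by (rule exI[of _ "{}"]) (auto simp: symdiff_def)
  next
    case (step y z)
    then obtain F where F: "F \<subseteq> E" "odd_verts F = symdiff {u} {y}" by auto
    have "odd_verts (symdiff F {{y, z}}) = symdiff (symdiff {u} {y}) {y, z}"
      using odd_verts_symdiff[of F "{{y, z}}"] F fin by (simp add: odd_verts_singleton)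
    also have "\<dots> = symdiff {u} {z}" using step by (auto simp: symdiff_def)
    finally show ?case using F step by (intro exI[of _ "symdiff F {{y, z}}"]) (auto simp: symdiff_def)
  qed
  have "\<exists>F\<subseteq>E. odd_verts F = Z" if "Z \<subseteq> V" "even (card Z)" for Z
    using that
  proof (induction "card Z" arbitrary: Z rule: less_induct)
    case less
    have Z: "finite Z" using less.prems(1) V(1) by (rule finite_subset)
    show ?case
    proof (cases "Z = {}")
      case False
      then obtain u where u: "u \<in> Z" by auto
      have "Z \<noteq> {u}" using less.prems(2) by auto
      then obtain v where v: "v \<in> Z" "v \<noteq> u" using u by blast
      have "card (Z - {u, v}) = card Z - 2" using u v Z by (simp add: card_Diff_subset)
      moreover have "card Z \<ge> 2" using u v Z card_mono[of Z "{u, v}"] by simp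
      ultimately obtain F where F: "F \<subseteq> E" "odd_verts F = Z - {u, v}"
        using less.hyps[of "Z - {u, v}"] less.prems by auto
      obtain F' where F': "F' \<subseteq> E" "odd_verts F' = symdiff {u} {v}"
        using pair[OF conn[of u v]] u v less.prems by auto
      have "odd_verts (symdiff F F') = symdiff (Z - {u, v}) (symdiff {u} {v})"
        using odd_verts_symdiff[of F F'] F F' fin by simp
      also have "\<dots> = Z" using u v by (auto simp: symdiff_def)
      finally show ?thesis using F F' by (intro exI[of _ "symdiff F F'"]) (auto simp: symdiff_def)
    qed (rule exI[of _ "{}"], simp)
  qed
  then have "{Z. Z \<subseteq> V \<and> even (card Z)} \<subseteq> odd_verts ` Pow E" by blast
  then have "card {Z. Z \<subseteq> V \<and> even (card Z)} \<le> card (odd_verts ` Pow E)"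
    using E by (intro card_mono) auto
  moreover obtain y where "y \<in> V" using V by auto
  ultimately show ?thesis
    by (simp add: card_even_subsets[OF V(1)] card_Pow_odd_verts[OF E] mult_right_mono)
qed

section \<open>Connected graphs with two disjoint cycles and cyclomatic number two\<close>

locale two_cycles =
  fixes V :: "'a set" and E C1 C2 :: "'a set set"
  assumes fin_V: "finite V"
    and edgeD: "\<And>e. e \<in> E \<Longrightarrow> e \<subseteq> V \<and> card e = 2"
    and conn: "\<And>u v. u \<in> V \<Longrightarrow> v \<in> V \<Longrightarrow> (u, v) \<in> {(x, y). {x, y} \<in> E \<and> x \<noteq> y}\<^sup>*"
    and card_E: "card E = card V + 1"
    and C1: "C1 \<subseteq> E" "C1 \<noteq> {}" "\<And>v. v \<in> \<Union>C1 \<Longrightarrow> card {e \<in> C1. v \<in> e} = 2"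
    and C2: "C2 \<subseteq> E" "C2 \<noteq> {}" "\<And>v. v \<in> \<Union>C2 \<Longrightarrow> card {e \<in> C2. v \<in> e} = 2"
    and disj: "\<Union>C1 \<inter> \<Union>C2 = {}"
begin

text \<open>The assumptions are symmetric, so facts are proved for \<open>C1\<close> and reused for
  \<open>C2\<close> through the interpretation \<open>sw\<close>.\<close>

lemma swap: "two_cycles V E C2 C1"
  by unfold_locales (use fin_V edgeD conn card_E C1 C2 disj in \<open>auto simp: Int_commute\<close>)

lemma fin_E: "finite E"
  using card_E by (metis Suc_eq_plus1 card.infinite nat.distinct(1))

lemma edge_pair:
  assumes "e \<in> E" obtains x y where "e = {x, y}" "x \<noteq> y" "x \<in> V" "y \<in> V"
  using edgeD[OF assms] that by (auto simp: card_2_iff)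

lemma edges_nonempty: "e \<in> E \<Longrightarrow> e \<noteq> {}"
  using edgeD by force

lemma C_disj: "C1 \<inter> C2 = {}"
proof (rule ccontr)
  assume "C1 \<inter> C2 \<noteq> {}"
  then obtain e where "e \<in> C1" "e \<in> C2" by auto
  moreover from this have "e \<noteq> {}" using C1 edges_nonempty by auto
  ultimately show False using disj by auto
qed

lemma odd_verts_C1: "odd_verts C1 = {}"
proof -
  have "even (card {e \<in> C1. v \<in> e})" for v
  proof (cases "v \<in> \<Union>C1")
    case False
    then have "{e \<in> C1. v \<in> e} = {}" by auto
    then show ?thesis by (metis card.empty even_zero)
  qed (simp add: C1(3))
  then show ?thesis by (simp add: odd_verts_def)
qed

text \<open>The cyclomatic number is two, so there are at most four even sets, and the four listed
  ones are distinct.\<close>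

lemma even_sets_E: "even_sets E = {{}, C1, C2, C1 \<union> C2}"
proof (rule sym, rule card_seteq)
  interpret sw: two_cycles V E C2 C1 by (rule swap)
  show "finite (even_sets E)" using fin_E by (simp add: even_sets_def)
  have "symdiff C1 C2 = C1 \<union> C2" using C_disj by (auto simp: symdiff_def)
  then have "odd_verts (C1 \<union> C2) = {}"
    using odd_verts_symdiff[of C1 C2] odd_verts_C1 sw.odd_verts_C1 finite_subset[OF _ fin_E] C1(1) C2(1)
    by simp
  then show "{{}, C1, C2, C1 \<union> C2} \<subseteq> even_sets E"
    using odd_verts_C1 sw.odd_verts_C1 C1 C2 by (auto simp: even_sets_def)
  have "C1 \<noteq> C2" "C1 \<noteq> C1 \<union> C2" "C2 \<noteq> C1 \<union> C2" using C1(2) C2(2) C_disj by auto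
  then have "card {{}, C1, C2, C1 \<union> C2} = 4" using C1(2) C2(2) by auto
  moreover obtain v where v: "v \<in> V" using C1(1,2) edge_pair by (metis subset_empty subset_iff all_not_in_conv)
  then have "2 ^ (card V - 1) * card (even_sets E) \<le> 2 ^ card E"
    using card_even_sets_connected_le[OF fin_E fin_V _ conn] by auto
  then have "2 ^ (card V - 1) * card (even_sets E) \<le> 2 ^ (card V - 1) * 4"
  proof -
    have "card V \<ge> 1" using v fin_V by (metis One_nat_def Suc_leI card_gt_0_iff empty_iff)
    then have "card E = (card V - 1) + 2" using card_E by simp
    then show ?thesis using \<open>2 ^ (card V - 1) * card (even_sets E) \<le> 2 ^ card E\<close>
      by (simp add: power_add)
  qed
  ultimately show "card (even_sets E) \<le> card {{}, C1, C2, C1 \<union> C2}" by simp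
qed

lemma even_set_cases:
  assumes "F \<subseteq> E" "odd_verts F = {}"
  shows "F = {} \<or> F = C1 \<or> F = C2 \<or> F = C1 \<union> C2"
  using assms even_sets_E by (auto simp: even_sets_def)

text \<open>Without all of \<open>C2\<close>, only \<open>{}\<close> and \<open>C1\<close> can be
  even subsets of \<open>H\<close>, so the nullity is at most one. This bound controls how cycles
  and further edges can be attached to the path.\<close>

lemma card_edges_le:
  assumes H: "H \<subseteq> E" "\<not> C2 \<subseteq> H" "\<Union>H \<subseteq> Y" "finite Y" "Y \<noteq> {}"
  shows "card H \<le> card Y"
proof -
  have "even_sets H \<subseteq> {{}, C1}"
  proof
    fix F assume "F \<in> even_sets H"
    then have "F \<subseteq> H" "odd_verts F = {}" by (auto simp: even_sets_def)
    then show "F \<in> {{}, C1}" using even_set_cases[of F] H(1,2) by blast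
  qed
  then have "card (even_sets H) \<le> card {{}, C1}" by (intro card_mono) auto
  also have "\<dots> \<le> 2" by (simp add: card_insert_if)
  finally have "2 ^ card H \<le> (2::nat) ^ (card Y - 1) * 2"
    using card_even_sets_ge[of H Y] H edgeD finite_subset[OF H(1) fin_E]
    by (metis (no_types, lifting) mult_le_mono2 order_trans subsetD)
  also have "\<dots> = 2 ^ card Y" using H(4,5) by (metis card_gt_0_iff power_minus_mult)
  finally show ?thesis by simp
qed

text \<open>For a matching \<open>M\<close> the last two conjuncts say that no perfect matching of \<open>C1\<close> or \<open>C2\<close> is contained in \<open>M\<close>.\<close>

definition good :: "'a set set \<Rightarrow> bool" where
  "good M \<longleftrightarrow> M \<subseteq> E \<and> pairwise disjnt M
    \<and> (\<exists>x\<in>\<Union>C1. x \<notin> \<Union>(M \<inter> C1)) \<and> (\<exists>x\<in>\<Union>C2. x \<notin> \<Union>(M \<inter> C2))"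

lemma odd_verts_matching:
  assumes "pairwise disjnt M"
  shows "odd_verts M = \<Union>M"
proof -
  have "odd (card {e \<in> M. v \<in> e}) \<longleftrightarrow> v \<in> \<Union>M" for v
  proof (cases "v \<in> \<Union>M")
    case True
    then obtain e where e: "e \<in> M" "v \<in> e" by auto
    then have "{e \<in> M. v \<in> e} = {e}"
      using assms by (auto simp: pairwise_def disjnt_def)
    then show ?thesis using True by simp
  next
    case False
    then have "{e \<in> M. v \<in> e} = {}" by auto
    then show ?thesis using False by (metis card.empty even_zero)
  qed
  then show ?thesis by (auto simp: odd_verts_def)
qed

text \<open>Both \<open>C1\<close>-edges at \<open>x\<close> avoid \<open>M\<close>, so they would
  have to lie in the matching \<open>M'\<close>, where two edges cannot share
  \<open>x\<close>.\<close>

lemma C1_not_in_symdiff: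
  assumes "pairwise disjnt M'" "x \<in> \<Union>C1" "x \<notin> \<Union>(M \<inter> C1)"
  shows "\<not> C1 \<subseteq> symdiff M M'"
proof
  assume sub: "C1 \<subseteq> symdiff M M'"
  obtain e f where ef: "{e \<in> C1. x \<in> e} = {e, f}" "e \<noteq> f"
    using C1(3)[OF assms(2)] by (auto simp: card_2_iff)
  then have "e \<in> C1" "f \<in> C1" "x \<in> e" "x \<in> f" by auto
  then have "e \<in> M'" "f \<in> M'" using sub assms(3) by (auto simp: symdiff_def)
  then show False using assms(1) ef \<open>x \<in> e\<close> \<open>x \<in> f\<close> by (auto simp: pairwise_def disjnt_def)
qed

text \<open>\<open>symdiff M M'\<close> is an even set, hence empty or a superset of a cycle. Such a
  cycle would alternate between the two matchings, which its uncovered vertex rules out.\<close>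

lemma good_unique:
  assumes M: "good M" and M': "M' \<subseteq> E" "pairwise disjnt M'" "\<Union>M' = \<Union>M"
  shows "M' = M"
proof -
  interpret sw: two_cycles V E C2 C1 by (rule swap)
  have fin: "finite M" "finite M'" using M M' fin_E finite_subset by (auto simp: good_def)
  have "odd_verts (symdiff M M') = {}"
    using M M' fin by (simp add: odd_verts_symdiff odd_verts_matching good_def symdiff_self_iff)
  moreover have "symdiff M M' \<subseteq> E" using M M' by (auto simp: good_def symdiff_def)
  moreover have "\<not> C1 \<subseteq> symdiff M M'" "\<not> C2 \<subseteq> symdiff M M'"
    using C1_not_in_symdiff sw.C1_not_in_symdiff M M' unfolding good_def by metis+
  ultimately have "symdiff M M' = {}" using even_set_cases[of "symdiff M M'"] by auto
  then show ?thesis by (simp add: symdiff_self_iff)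
qed

lemma good_swap: "two_cycles.good E C2 C1 = good"
  by (intro ext) (auto simp: good_def two_cycles.good_def[OF swap])

lemma card_C1: "card C1 = card (\<Union>C1)"
proof -
  have fin: "finite C1" using C1(1) fin_E by (rule finite_subset)
  have "\<Union>C1 \<subseteq> V" using C1(1) edgeD by blast
  then have "finite (\<Union>C1)" using fin_V by (rule finite_subset)
  note fin = fin this
  have "(\<Sum>v\<in>\<Union>C1. card {e \<in> C1. v \<in> e}) = (\<Sum>e\<in>C1. card {v \<in> \<Union>C1. v \<in> e})"
    using sum_multicount_gen[of "\<Union>C1" C1 "\<lambda>v e. v \<in> e" "\<lambda>e. card {v \<in> \<Union>C1. v \<in> e}"] fin by simp
  also have "\<dots> = (\<Sum>e\<in>C1. 2)"
  proof (intro sum.cong refl)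
    fix e assume "e \<in> C1"
    then have "{v \<in> \<Union>C1. v \<in> e} = e" by auto
    then show "card {v \<in> \<Union>C1. v \<in> e} = 2" using edgeD C1(1) \<open>e \<in> C1\<close> by auto
  qed
  finally show ?thesis using C1(3) by simp
qed

end

section \<open>Matchings along a geodesic\<close>

text \<open>
  The path \<open>p 0, \<dots>, p d\<close> is a geodesic because \<open>\<delta>\<close>, the distance from \<open>p 0\<close>, changes by at most one
  along an edge.
\<close>

locale two_cycles_geodesic = two_cycles V E C1 C2
  for V :: "'a set" and E C1 C2 :: "'a set set" +
  fixes p :: "nat \<Rightarrow> 'a" and d :: nat and \<delta> :: "'a \<Rightarrow> nat"
  assumes d: "3 \<le> d"
    and path_edge: "\<And>k. k < d \<Longrightarrow> {p k, p (Suc k)} \<in> E"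
    and level_edge: "\<And>x y. {x, y} \<in> E \<Longrightarrow> \<delta> x \<le> \<delta> y + 1"
    and level_path: "\<And>k. k \<le> d \<Longrightarrow> \<delta> (p k) = k"
begin

lemma swap_geodesic: "two_cycles_geodesic V E C2 C1 p d \<delta>"
  unfolding two_cycles_geodesic_def two_cycles_geodesic_axioms_def
  using swap d path_edge level_edge level_path by blast

definition P :: "'a set" where "P = p ` {..d}"
definition pe :: "nat \<Rightarrow> 'a set" where "pe k = {p k, p (Suc k)}"
definition off :: "'a set set" where "off = E - pe ` {..<d}"
definition nb :: "'a set \<Rightarrow> nat set" where "nb e = {k. k < d \<and> (p k \<in> e \<or> p (Suc k) \<in> e)}"

lemma p_eq_iff: "j \<le> d \<Longrightarrow> k \<le> d \<Longrightarrow> p j = p k \<longleftrightarrow> j = k"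
  using level_path by metis

lemma p_in_P: "j \<le> d \<Longrightarrow> p j \<in> P"
  by (simp add: P_def)

lemma pe_in_E: "k < d \<Longrightarrow> pe k \<in> E"
  using path_edge by (simp add: pe_def)

lemma pe_subset_P: "k < d \<Longrightarrow> pe k \<subseteq> P"
  by (simp add: pe_def p_in_P)

lemma p_in_pe_iff: "k < d \<Longrightarrow> j \<le> d \<Longrightarrow> p j \<in> pe k \<longleftrightarrow> j = k \<or> j = Suc k"
  by (auto simp: pe_def p_eq_iff)

lemma inj_pe: "inj_on pe {..<d}"
proof (rule inj_onI)
  fix j k assume "j \<in> {..<d}" "k \<in> {..<d}" "pe j = pe k"
  then show "j = k" using p_in_pe_iff[of j j] p_in_pe_iff[of k j] p_in_pe_iff[of j k] p_in_pe_iff[of k k]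
    by auto
qed

text \<open>A chord between non-consecutive path vertices would skip a level of
  \<open>\<delta>\<close>.\<close>

lemma induced: "{p j, p k} \<in> E \<Longrightarrow> j \<le> d \<Longrightarrow> k \<le> d \<Longrightarrow> {p j, p k} \<in> pe ` {..<d}"
proof (induction j k rule: linorder_wlog)
  case (le j k)
  have "card {p j, p k} = 2" using le edgeD by blast
  then have "j \<noteq> k" by auto
  moreover have "k \<le> j + 1"
    using level_edge[of "p k" "p j"] le level_path by (simp add: insert_commute)
  ultimately have "k = Suc j" using le by simp
  then show ?case using le by (auto simp: pe_def)
next
  case (sym j k)
  then show ?case by (simp add: insert_commute)
qed

lemma edge_in_P: "e \<in> E \<Longrightarrow> e \<subseteq> P \<Longrightarrow> e \<in> pe ` {..<d}"
proof -
  assume e: "e \<in> E" "e \<subseteq> P"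
  obtain x y where xy: "e = {x, y}" using e(1) edge_pair by metis
  then obtain j k where "x = p j" "y = p k" "j \<le> d" "k \<le> d" using e(2) by (auto simp: P_def)
  then show ?thesis using induced[of j k] e(1) xy by simp
qed

text \<open>Forces a cycle with a single vertex off the path to be a triangle or a 4-cycle.\<close>

lemma common_nbr:
  assumes "{w, p j} \<in> E" "{w, p k} \<in> E" "j \<le> d" "k \<le> d"
  shows "k \<le> j + 2"
  using level_edge[of w "p j"] level_edge[of "p k" w] assms level_path by (simp add: insert_commute)

lemma off_cases:
  assumes "e \<in> off"
  obtains "e \<inter> P = {}" | w j where "e = {w, p j}" "w \<notin> P" "j \<le> d"
proof -
  have e: "e \<in> E" "e \<notin> pe ` {..<d}" using assms by (auto simp: off_def)
  obtain x y where xy: "e = {x, y}" using e(1) edge_pair by metis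
  have "\<not> e \<subseteq> P" using edge_in_P e by auto
  show ?thesis
  proof (cases "e \<inter> P = {}")
    case False
    then obtain j where "j \<le> d" "p j \<in> e" by (auto simp: P_def)
    then have "\<exists>w. e = {w, p j} \<and> w \<notin> P"
      using xy \<open>\<not> e \<subseteq> P\<close> p_in_P by (auto simp: insert_commute)
    then show ?thesis using that(2) \<open>j \<le> d\<close> by auto
  qed (use that(1) in auto)
qed

lemma nb_pair: "w \<notin> P \<Longrightarrow> j \<le> d \<Longrightarrow> nb {w, p j} \<subseteq> {j - 1, j}"
  using p_in_P by (auto simp: nb_def p_eq_iff)

lemma nb_empty: "e \<inter> P = {} \<Longrightarrow> nb e = {}"
  using p_in_P by (auto simp: nb_def)

lemma fin_off: "finite off"
  using fin_E by (simp add: off_def)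

lemma tcount_nb:
  assumes "e \<in> off"
  shows "tcount i {..<d - 2} c \<le> tcount i ({..<d} - nb e) c"
  using assms
proof (cases e rule: off_cases)
  case 1
  then show ?thesis by (intro tcount_mono) (auto simp: nb_empty)
next
  case (2 w j)
  have "tcount i {..<d - 2} c \<le> tcount i ({..<d} - {j - 1, j}) c" by (rule tcount_delete_vertex)
  also have "\<dots> \<le> tcount i ({..<d} - nb e) c"
    using nb_pair[of w j] 2 by (intro tcount_mono) auto
  finally show ?thesis .
qed

lemma tcount_nb2:
  assumes "e \<in> off" "f \<in> off" "e \<inter> f = {}"
  shows "tcount i {..<d - 4} c \<le> tcount i ({..<d} - (nb e \<union> nb f)) c"
proof -
  have mono: "tcount i {..<d - 4} c \<le> tcount i {..<d - 2} c" by (rule tcount_mono) auto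
  show ?thesis using assms(1)
  proof (cases e rule: off_cases)
    case 1
    then show ?thesis using tcount_nb[OF assms(2), of i c] mono by (simp add: nb_empty)
  next
    case e: (2 w j)
    show ?thesis using assms(2)
    proof (cases f rule: off_cases)
      case 1
      then show ?thesis using tcount_nb[OF assms(1), of i c] mono by (simp add: nb_empty)
    next
      case f: (2 u l)
      have "j \<noteq> l" using e f assms(3) by auto
      then have "tcount i {..<d - 4} c \<le> tcount i ({..<d} - {j - 1, j, l - 1, l}) c"
        by (rule tcount_delete_two_vertices)
      also have "\<dots> \<le> tcount i ({..<d} - (nb e \<union> nb f)) c"
        using nb_pair[of w j] nb_pair[of u l] e f by (intro tcount_mono) auto
      finally show ?thesis .
    qed
  qed
qed

text \<open>The first vertex met by a nonempty set of path edges lies on exactly one of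
  them.\<close>

lemma no_even_set_in_path:
  assumes F: "F \<subseteq> pe ` {..<d}" "odd_verts F = {}"
  shows "F = {}"
proof (rule ccontr)
  assume "F \<noteq> {}"
  then have ex: "\<exists>k. k < d \<and> pe k \<in> F" using F by auto
  define k where "k = (LEAST k. k < d \<and> pe k \<in> F)"
  have k: "k < d" "pe k \<in> F" using LeastI_ex[OF ex] by (auto simp: k_def)
  have least: "k \<le> j" if "j < d" "pe j \<in> F" for j
    unfolding k_def by (rule Least_le) (use that in auto)
  have eq: "e = pe k" if e: "e \<in> F" "p k \<in> e" for e
  proof -
    obtain j where j: "j < d" "e = pe j" using e F by auto
    then have "k = j \<or> k = Suc j" using e k p_in_pe_iff by auto
    then show ?thesis using least[of j] j e by auto
  qed
  have "p k \<in> pe k" by (simp add: pe_def)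
  then have "{e \<in> F. p k \<in> e} = {pe k}" using k(2) eq by blast
  then have "p k \<in> odd_verts F" by (simp add: odd_verts_def)
  then show False using F by simp
qed

lemma C1_not_in_path: "\<not> C1 \<subseteq> pe ` {..<d}"
  using no_even_set_in_path odd_verts_C1 C1(2) by blast

lemma ex_off_vertex: "\<exists>w\<in>\<Union>C1. w \<notin> P"
proof (rule ccontr)
  assume "\<not> (\<exists>w\<in>\<Union>C1. w \<notin> P)"
  then have "C1 \<subseteq> pe ` {..<d}" using C1(1) edge_in_P by blast
  then show False using C1_not_in_path by simp
qed

lemma two_edges_at:
  assumes "v \<in> \<Union>C1"
  obtains e f where "e \<noteq> f" "{e \<in> C1. v \<in> e} = {e, f}"
  using C1(3)[OF assms] by (auto simp: card_2_iff)

section \<open>The part of a cycle off the path\<close>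

definition A :: "'a set set" where "A = C1 \<inter> off"

lemma fin_A: "finite A" and A_subset: "A \<subseteq> C1" "A \<subseteq> off"
  using fin_off by (auto simp: A_def)

lemma off_vertex_edge: "e \<in> C1 \<Longrightarrow> w \<in> e \<Longrightarrow> w \<notin> P \<Longrightarrow> e \<in> A"
  using C1(1) pe_subset_P by (auto simp: A_def off_def)

lemma edge_avoiding:
  assumes "w \<in> \<Union>C1" "w \<notin> P" "x \<noteq> w"
  obtains e where "e \<in> A" "w \<in> e" "x \<notin> e"
proof -
  obtain e f where ef: "e \<noteq> f" "{e \<in> C1. w \<in> e} = {e, f}" using two_edges_at[OF assms(1)] .
  then have C: "e \<in> C1" "f \<in> C1" "w \<in> e" "w \<in> f" by auto
  have g: "g = {w, x}" if "g \<in> C1" "w \<in> g" "x \<in> g" for g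
  proof -
    have "g \<in> E" using that C1 by auto
    then show ?thesis using that assms(3) by (elim edge_pair) auto
  qed
  have "x \<notin> e \<or> x \<notin> f"
  proof (rule ccontr)
    assume "\<not> (x \<notin> e \<or> x \<notin> f)"
    then have "e = {w, x}" "f = {w, x}" using g[OF C(1,3)] g[OF C(2,4)] by blast+
    then show False using ef(1) by simp
  qed
  then show ?thesis using that C off_vertex_edge assms(2) by blast
qed

abbreviation "W \<equiv> \<Union>C1 - P"

lemma fin_W: "finite W"
proof -
  have "\<Union>C1 \<subseteq> V" using C1(1) edgeD by blast
  then show ?thesis using fin_V finite_subset by blast
qed

lemma card_path_Un_C1: "card (pe ` {..<d} \<union> C1) = d + card A"
proof -
  have "pe ` {..<d} \<union> C1 = pe ` {..<d} \<union> A" using C1(1) by (auto simp: A_def off_def)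
  moreover have "card (pe ` {..<d} \<union> A) = card (pe ` {..<d}) + card A"
    using fin_A by (intro card_Un_disjoint) (auto simp: A_def off_def)
  ultimately show ?thesis using inj_pe by (simp add: card_image)
qed

lemma card_P_Un_C1: "card (P \<union> \<Union>C1) = d + 1 + card W"
proof -
  have "card (P \<union> W) = card P + card W"
    using fin_W by (intro card_Un_disjoint) (auto simp: P_def)
  moreover have "card P = d + 1"
  proof -
    have "inj_on p {..d}" by (rule inj_onI) (auto simp: p_eq_iff)
    then show ?thesis by (simp add: P_def card_image)
  qed
  ultimately show ?thesis by simp
qed

lemma C2_not_in_path_Un_C1: "\<not> C2 \<subseteq> pe ` {..<d} \<union> C1"
proof -
  interpret sw: two_cycles_geodesic V E C2 C1 p d \<delta> by (rule swap_geodesic)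
  show ?thesis using sw.C1_not_in_path C_disj by auto
qed

text \<open>The path together with \<open>C1\<close> has \<open>d + card A\<close> edges on
  \<open>d + 1 + card W\<close> vertices and does not contain \<open>C2\<close>, so
  \<open>card_edges_le\<close> applies.\<close>

lemma card_A_le: "card A \<le> card W + 1"
proof -
  have "card (pe ` {..<d} \<union> C1) \<le> card (P \<union> \<Union>C1)"
  proof (rule card_edges_le)
    show "pe ` {..<d} \<union> C1 \<subseteq> E" using C1(1) pe_in_E by auto
    show "\<Union>(pe ` {..<d} \<union> C1) \<subseteq> P \<union> \<Union>C1" using pe_subset_P by auto
    show "finite (P \<union> \<Union>C1)" using card_P_Un_C1 by (metis card.infinite add_is_0 zero_neq_one)
    show "P \<union> \<Union>C1 \<noteq> {}" by (auto simp: P_def)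
  qed (rule C2_not_in_path_Un_C1)
  then show ?thesis by (simp add: card_path_Un_C1 card_P_Un_C1)
qed

abbreviation "A0 \<equiv> {e \<in> A. e \<inter> P = {}}"
abbreviation "A1 \<equiv> {e \<in> A. e \<inter> P \<noteq> {}}"

lemma card_A: "card A = card A0 + card A1"
  using fin_A by (subst card_Un_disjoint[symmetric]) (auto intro: arg_cong[where f = card])

text \<open>Count incidences between \<open>W\<close> and \<open>A\<close>: a vertex of
  \<open>W\<close> has both its cycle edges in \<open>A\<close>, while an edge of \<open>A0\<close>
  has two ends in \<open>W\<close> and an edge of \<open>A1\<close> has one.\<close>

lemma double_count_W: "2 * card W = 2 * card A0 + card A1"
proof -
  have "(\<Sum>w\<in>W. card {e \<in> A. w \<in> e}) = (\<Sum>e\<in>A. card {w \<in> W. w \<in> e})"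
    using sum_multicount_gen[of W A "\<lambda>v e. v \<in> e" "\<lambda>e. card {w \<in> W. w \<in> e}"] fin_W fin_A by simp
  moreover have "(\<Sum>w\<in>W. card {e \<in> A. w \<in> e}) = (\<Sum>w\<in>W. 2)"
  proof (intro sum.cong refl)
    fix w assume w: "w \<in> W"
    then have "{e \<in> A. w \<in> e} = {e \<in> C1. w \<in> e}" using off_vertex_edge A_subset by auto
    then show "card {e \<in> A. w \<in> e} = 2" using C1(3) w by simp
  qed
  moreover have "(\<Sum>e\<in>A. card {w \<in> W. w \<in> e}) = (\<Sum>e\<in>A0. card {w \<in> W. w \<in> e}) + (\<Sum>e\<in>A1. card {w \<in> W. w \<in> e})"
    using fin_A by (subst sum.union_disjoint[symmetric]) (auto intro: sum.cong)
  moreover have "(\<Sum>e\<in>A0. card {w \<in> W. w \<in> e}) = (\<Sum>e\<in>A0. 2)"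
  proof (intro sum.cong refl)
    fix e assume e: "e \<in> A0"
    then have "{w \<in> W. w \<in> e} = e" using A_subset by auto
    then show "card {w \<in> W. w \<in> e} = 2" using e A_subset C1(1) edgeD by auto
  qed
  moreover have "(\<Sum>e\<in>A1. card {w \<in> W. w \<in> e}) = (\<Sum>e\<in>A1. 1)"
  proof (intro sum.cong refl)
    fix e assume e: "e \<in> A1"
    then have "e \<in> off" "e \<in> C1" using A_subset by auto
    then obtain w j where "e = {w, p j}" "w \<notin> P" "j \<le> d"
      using e by (elim off_cases) auto
    then have "{w \<in> W. w \<in> e} = {w}" using \<open>e \<in> C1\<close> p_in_P by auto
    then show "card {w \<in> W. w \<in> e} = 1" by simp
  qed
  ultimately show ?thesis by simp
qed

text \<open>The incidence count and \<open>card_A_le\<close> combine: a cycle leaves the path and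
  returns to it at most once.\<close>

lemma card_A1_le: "card A1 \<le> 2"
  using card_A double_count_W card_A_le by linarith

lemma card_A_ge: "2 \<le> card A"
proof -
  obtain w where w: "w \<in> \<Union>C1" "w \<notin> P" using ex_off_vertex by auto
  then have "{e \<in> C1. w \<in> e} \<subseteq> A" using off_vertex_edge by auto
  then show ?thesis using C1(3)[OF w(1)] card_mono[OF fin_A] by metis
qed

text \<open>Good \<open>i\<close>-matchings are classified by their off-path part \<open>U\<close>;
  the path part is stored as a sparse index set.\<close>

definition cnt :: "nat \<Rightarrow> 'a set set \<Rightarrow> nat" where
  "cnt i U = card {S. S \<subseteq> {..<d} \<and> sparse S \<and> card S + card U = i \<and> good (U \<union> pe ` S)}"

text \<open>\<open>U\<close> is recovered from a matching as its off-path part, and \<open>S\<close>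
  through the injectivity of \<open>pe\<close>, so nothing is counted twice.\<close>

lemma sum_cnt_le:
  assumes "finite \<O>" "\<And>U. U \<in> \<O> \<Longrightarrow> U \<subseteq> off"
  shows "(\<Sum>U\<in>\<O>. cnt i U) \<le> card {M. good M \<and> card M = i}"
proof -
  let ?S = "\<lambda>U. {S. S \<subseteq> {..<d} \<and> sparse S \<and> card S + card U = i \<and> good (U \<union> pe ` S)}"
  let ?f = "\<lambda>(U, S). U \<union> pe ` S"
  have fin: "finite (?S U)" for U by (rule finite_subset[of _ "Pow {..<d}"]) auto
  have "(\<Sum>U\<in>\<O>. cnt i U) = card (SIGMA U:\<O>. ?S U)"
    unfolding cnt_def using assms(1) fin by simp
  also have "\<dots> \<le> card {M. good M \<and> card M = i}"
  proof (rule card_inj_on_le[where f = ?f])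
    show "inj_on ?f (SIGMA U:\<O>. ?S U)"
    proof (rule inj_onI)
      fix x y assume xy: "x \<in> (SIGMA U:\<O>. ?S U)" "y \<in> (SIGMA U:\<O>. ?S U)" "?f x = ?f y"
      obtain U S U' S' where U: "x = (U, S)" "y = (U', S')" by (metis surj_pair)
      then have sub: "U \<subseteq> off" "U' \<subseteq> off" "S \<subseteq> {..<d}" "S' \<subseteq> {..<d}" using xy assms(2) by auto
      have eq: "U \<union> pe ` S = U' \<union> pe ` S'" using xy U by simp
      have "U = (U \<union> pe ` S) \<inter> off" "U' = (U' \<union> pe ` S') \<inter> off" using sub by (auto simp: off_def)
      then have 1: "U = U'" using eq by simp
      have "pe ` S = (U \<union> pe ` S) - off" "pe ` S' = (U' \<union> pe ` S') - off"
        using sub by (auto simp: off_def)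
      then have "pe ` S = pe ` S'" using eq by simp
      then have "S = S'" using inj_on_image_eq_iff[OF inj_pe] sub by blast
      then show "x = y" using 1 U by simp
    qed
    show "?f ` (SIGMA U:\<O>. ?S U) \<subseteq> {M. good M \<and> card M = i}"
    proof (rule image_subsetI)
      fix x assume x: "x \<in> (SIGMA U:\<O>. ?S U)"
      obtain U S where US: "x = (U, S)" by (metis surj_pair)
      then have U: "U \<in> \<O>" and S: "S \<subseteq> {..<d}" "sparse S" "good (U \<union> pe ` S)" "card S + card U = i"
        using x by auto
      have "card (U \<union> pe ` S) = card U + card (pe ` S)"
        using assms(2)[OF U] S(1) finite_subset[OF assms(2)[OF U] fin_off]
        by (intro card_Un_disjoint) (auto simp: off_def dest: finite_subset)
      also have "card (pe ` S) = card S" using inj_pe S(1) by (meson card_image inj_on_subset)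
      finally show "?f x \<in> {M. good M \<and> card M = i}" using S(3,4) US by simp
    qed
    show "finite {M. good M \<and> card M = i}"
      by (rule finite_subset[of _ "Pow E"]) (use fin_E in \<open>auto simp: good_def\<close>)
  qed
  finally show ?thesis .
qed

text \<open>The last conjuncts of \<open>good\<close>, for one cycle at a time. Only edges of
  \<open>C\<close> count as covering, so a vertex of \<open>C\<close> matched by an edge outside
  \<open>C\<close> is uncovered.\<close>

definition uncov :: "'a set set \<Rightarrow> 'a set set \<Rightarrow> nat set \<Rightarrow> bool" where
  "uncov C U S \<longleftrightarrow> (\<exists>x\<in>\<Union>C. x \<notin> \<Union>((U \<union> pe ` S) \<inter> C))"

text \<open>Any sparse subset of \<open>E'\<close> extends \<open>U\<close> to a good matching:
  \<open>E'\<close> avoids the path edges that meet \<open>U\<close>, and possibly more in order to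
  keep a vertex of each cycle uncovered.\<close>

lemma cnt_ge:
  assumes U: "U \<subseteq> off" "pairwise disjnt U" and E': "E' \<subseteq> {..<d}" "\<And>e. e \<in> U \<Longrightarrow> E' \<inter> nb e = {}"
    and unc: "\<And>S. S \<subseteq> E' \<Longrightarrow> uncov C1 U S \<and> uncov C2 U S"
  shows "tcount i E' (card U) \<le> cnt i U"
  unfolding tcount_card cnt_def
proof (rule card_mono)
  show "finite {S. S \<subseteq> {..<d} \<and> sparse S \<and> card S + card U = i \<and> good (U \<union> pe ` S)}"
    by (rule finite_subset[of _ "Pow {..<d}"]) auto
  have "good (U \<union> pe ` S)" if S: "S \<subseteq> E'" "sparse S" for S
  proof -
    have "U \<union> pe ` S \<subseteq> E" using U(1) S(1) E'(1) pe_in_E by (auto simp: off_def)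
    moreover have 1: "disjnt e (pe k)" if "e \<in> U" "k \<in> S" for e k
    proof -
      have "k \<notin> nb e" "k < d" using that E' S(1) by auto
      then show ?thesis by (auto simp: nb_def disjnt_def pe_def)
    qed
    have 2: "disjnt (pe j) (pe k)" if "j \<in> S" "k \<in> S" "pe j \<noteq> pe k" for j k
    proof -
      have "j < d" "k < d" using that E' S(1) by auto
      moreover have "j \<noteq> k" "Suc j \<noteq> k" "Suc k \<noteq> j" using that S(2) by (auto simp: sparse_def)
      ultimately show ?thesis by (auto simp: disjnt_def pe_def p_eq_iff)
    qed
    have "pairwise disjnt (U \<union> pe ` S)"
    proof (rule pairwiseI)
      fix e f assume "e \<in> U \<union> pe ` S" "f \<in> U \<union> pe ` S" "e \<noteq> f"
      then show "disjnt e f"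
        using 1 2 pairwiseD[OF U(2)] disjnt_sym[OF 1] by (elim UnE imageE) blast+
    qed
    moreover have "(\<exists>x\<in>\<Union>C1. x \<notin> \<Union>((U \<union> pe ` S) \<inter> C1)) \<and> (\<exists>x\<in>\<Union>C2. x \<notin> \<Union>((U \<union> pe ` S) \<inter> C2))"
      using unc[OF S(1)] by (simp add: uncov_def)
    ultimately show ?thesis by (simp add: good_def)
  qed
  then show "{S. S \<subseteq> E' \<and> sparse S \<and> card S + card U = i}
      \<subseteq> {S. S \<subseteq> {..<d} \<and> sparse S \<and> card S + card U = i \<and> good (U \<union> pe ` S)}"
    using E'(1) by auto
qed

lemma uncovI:
  assumes "x \<in> \<Union>C1" "x \<notin> \<Union>(U \<inter> C1)" "\<And>k. k \<in> S \<Longrightarrow> pe k \<in> C1 \<Longrightarrow> x \<notin> pe k"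
  shows "uncov C1 U S"
  using assms by (auto simp: uncov_def)

lemma uncov_offI:
  assumes "x \<in> W" "x \<notin> \<Union>(U \<inter> C1)" "S \<subseteq> {..<d}"
  shows "uncov C1 U S"
  by (rule uncovI[of x]) (use assms pe_subset_P in auto)

text \<open>\<open>C1\<close> has a vertex off the path, which path edges never cover.\<close>

lemma uncov_disjoint:
  assumes "U \<inter> C1 = {}" "S \<subseteq> {..<d}"
  shows "uncov C1 U S"
  using ex_off_vertex assms uncov_offI[of _ U S] by auto


section \<open>Matchings with one edge off the path\<close>

lemma odd_verts_path:
  assumes "j \<le> k" "k \<le> d"
  shows "odd_verts (pe ` {j..<k}) = symdiff {p j} {p k}"
  using assms
proof (induction k rule: dec_induct)
  case base
  then show ?case by (auto simp: symdiff_def)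
next
  case (step k)
  have "pe k \<notin> pe ` {j..<k}"
  proof
    assume "pe k \<in> pe ` {j..<k}"
    then obtain l where "l < k" "pe k = pe l" by auto
    then show False using inj_onD[OF inj_pe, of k l] step by simp
  qed
  moreover have "p k \<noteq> p (Suc k)" using step p_eq_iff[of k "Suc k"] by simp
  ultimately have "odd_verts (insert (pe k) (pe ` {j..<k})) = symdiff (pe k) (symdiff {p j} {p k})"
    using step by (subst odd_verts_insert) auto
  also have "\<dots> = symdiff {p j} {p (Suc k)}"
    using \<open>p k \<noteq> p (Suc k)\<close> by (auto simp: symdiff_def pe_def)
  also have "insert (pe k) (pe ` {j..<k}) = pe ` {j..<Suc k}"
    using step by (simp add: atLeastLessThanSuc)
  finally show ?case .
qed

text \<open>The two edges at \<open>w\<close> and the path segment between their feet form an even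
  set inside the path and \<open>C1\<close>. As \<open>C2\<close> does not fit there, the list of
  even sets leaves only \<open>C1\<close>.\<close>

lemma cycle_through_one_off_vertex:
  assumes w: "w \<notin> P" and jk: "j < k" "k \<le> d" and C: "{w, p j} \<in> C1" "{w, p k} \<in> C1"
  shows "C1 = {{w, p j}, {w, p k}} \<union> pe ` {j..<k}"
proof -
  have ne: "p j \<noteq> p k" "w \<noteq> p j" "w \<noteq> p k" using w jk p_in_P p_eq_iff by auto
  have out: "{w, x} \<notin> pe ` {j..<k}" for x
  proof
    assume "{w, x} \<in> pe ` {j..<k}"
    then obtain l where "l < k" "{w, x} = pe l" by auto
    then show False using w pe_subset_P[of l] jk by auto
  qed
  let ?F = "insert {w, p j} (insert {w, p k} (pe ` {j..<k}))"
  have "odd_verts ?F = symdiff {w, p j} (odd_verts (insert {w, p k} (pe ` {j..<k})))"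
    by (rule odd_verts_insert) (use out ne in \<open>simp_all add: doubleton_eq_iff\<close>)
  also have "odd_verts (insert {w, p k} (pe ` {j..<k})) = symdiff {w, p k} (odd_verts (pe ` {j..<k}))"
    by (rule odd_verts_insert) (use out in simp_all)
  also have "odd_verts (pe ` {j..<k}) = symdiff {p j} {p k}"
    using jk by (simp add: odd_verts_path)
  also have "symdiff {w, p j} (symdiff {w, p k} (symdiff {p j} {p k})) = {}"
    using ne by (auto simp: symdiff_def)
  finally have "odd_verts ?F = {}" .
  moreover have F: "?F \<subseteq> pe ` {..<d} \<union> C1" using C jk by auto
  moreover have "pe ` {..<d} \<union> C1 \<subseteq> E" using C1(1) pe_in_E by auto
  ultimately have "?F = {} \<or> ?F = C1 \<or> ?F = C2 \<or> ?F = C1 \<union> C2"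
    by (intro even_set_cases) (rule subset_trans)
  moreover have "\<not> C2 \<subseteq> ?F" using C2_not_in_path_Un_C1 subset_trans[OF _ F] by metis
  then have "?F \<noteq> C2" "?F \<noteq> C1 \<union> C2" by (metis order_refl, metis Un_upper2)
  ultimately have "?F = C1" by (metis insert_not_empty)
  then show ?thesis by simp
qed

lemma single_off_vertex:
  assumes "card W = 1"
  obtains w j k where "w \<notin> P" "j < k" "k \<le> j + 2" "k \<le> d" "A = {{w, p j}, {w, p k}}"
    "C1 = {{w, p j}, {w, p k}} \<union> pe ` {j..<k}" "{w, p j} \<noteq> {w, p k}"
proof -
  note result = that
  obtain w where w: "W = {w}" using assms by (metis One_nat_def card_1_singletonE)
  have form: "\<exists>j\<le>d. e = {w, p j}" if "e \<in> A" for e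
  proof -
    have e: "e \<in> off" "e \<in> C1" using that A_subset by auto
    show ?thesis using e(1)
    proof (cases e rule: off_cases)
      case 1
      then have "e \<subseteq> {w}" using e(2) w by auto
      then have "card e \<le> 1" using card_mono[of "{w}" e] by simp
      then show ?thesis using edgeD[of e] e(2) C1(1) by auto
    next
      case (2 u j)
      then have "u \<in> W" using e(2) by auto
      then show ?thesis using 2 w by auto
    qed
  qed
  have wC: "w \<in> \<Union>C1" "w \<notin> P" using w by auto
  obtain e f where ef: "e \<noteq> f" "{e \<in> C1. w \<in> e} = {e, f}" using two_edges_at[OF wC(1)] .
  have "A = {e \<in> C1. w \<in> e}"
  proof (intro equalityI subsetI)
    fix g assume "g \<in> A"
    then show "g \<in> {e \<in> C1. w \<in> e}" using form[of g] A_subset(1) by auto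
  next
    fix g assume "g \<in> {e \<in> C1. w \<in> e}"
    then show "g \<in> A" using off_vertex_edge[of g w] wC(2) by simp
  qed
  then have Aef: "A = {e, f}" using ef by simp
  have main: thesis if "A = {{w, p j}, {w, p k}}" "j < k" "k \<le> d" for j k
  proof -
    have C: "{w, p j} \<in> C1" "{w, p k} \<in> C1" using that(1) A_subset(1) by auto
    have "k \<le> j + 2" using common_nbr[of w j k] C C1(1) that(2,3) by auto
    moreover have "{w, p j} \<noteq> {w, p k}" using p_eq_iff[of j k] that(2,3) by (auto simp: doubleton_eq_iff)
    ultimately show thesis
      using result[OF wC(2) that(2) _ that(3,1) cycle_through_one_off_vertex[OF wC(2) that(2,3) C]] by simp
  qed
  obtain j k where jk: "e = {w, p j}" "f = {w, p k}" "j \<le> d" "k \<le> d"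
    using form[of e] form[of f] Aef by auto
  then have "j \<noteq> k" using ef(1) by auto
  then consider "j < k" | "k < j" by linarith
  then show ?thesis
  proof cases
    case 1
    then show ?thesis using main[of j k] jk Aef by simp
  next
    case 2
    then show ?thesis using main[of k j] jk Aef by (simp add: insert_commute)
  qed
qed

lemma cnt_ge_C1:
  assumes U: "U \<subseteq> off" "pairwise disjnt U" "U \<inter> C2 = {}"
    and E': "E' \<subseteq> {..<d}" "\<And>e. e \<in> U \<Longrightarrow> E' \<inter> nb e = {}"
    and unc: "\<And>S. S \<subseteq> E' \<Longrightarrow> uncov C1 U S"
  shows "tcount i E' (card U) \<le> cnt i U"
proof (rule cnt_ge[OF U(1,2) E'])
  interpret sw: two_cycles_geodesic V E C2 C1 p d \<delta> by (rule swap_geodesic)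
  show "uncov C1 U S \<and> uncov C2 U S" if "S \<subseteq> E'" for S
    using unc[OF that] sw.uncov_disjoint[OF U(3), of S] that E'(1) by auto
qed

lemma cnt_single_ge:
  assumes e: "e \<in> A" and E': "E' \<subseteq> {..<d} - nb e" and unc: "\<And>S. S \<subseteq> E' \<Longrightarrow> uncov C1 {e} S"
  shows "tcount i E' 1 \<le> cnt i {e}"
proof -
  have "e \<in> off" "e \<notin> C2" "E' \<subseteq> {..<d}" "E' \<inter> nb e = {}" using e E' A_subset C_disj by blast+
  then show ?thesis using cnt_ge_C1[of "{e}" E' i] unc by simp
qed

text \<open>The edge \<open>{w, p j}\<close> already blocks \<open>pe j\<close>, so
  \<open>p (Suc j)\<close> stays uncovered at no extra cost, and symmetrically for the other
  edge.\<close>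

lemma cnt_single_triangle:
  assumes "w \<notin> P" "j < d" "C1 = {{w, p j}, {w, p (Suc j)}, pe j}" "A = {{w, p j}, {w, p (Suc j)}}"
  shows "tcount i {..<d - 2} 1 \<le> cnt i {{w, p j}}" "tcount i {..<d - 2} 1 \<le> cnt i {{w, p (Suc j)}}"
proof -
  have ne: "p j \<noteq> p (Suc j)" "w \<noteq> p j" "w \<noteq> p (Suc j)" using assms p_in_P p_eq_iff by auto
  have "uncov C1 {{w, p j}} S" if "S \<subseteq> {..<d} - nb {w, p j}" for S
  proof (rule uncovI[of "p (Suc j)"])
    fix k assume k: "k \<in> S" "pe k \<in> C1"
    then have "k < d" "k \<notin> nb {w, p j}" using that by auto
    then have "pe k \<noteq> pe j" using inj_onD[OF inj_pe, of k j] assms(2) by (auto simp: nb_def)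
    moreover have "pe k \<noteq> {w, x}" for x using pe_subset_P[OF \<open>k < d\<close>] assms(1) by auto
    ultimately show "p (Suc j) \<notin> pe k" using k(2) assms(3) by auto
  qed (use assms ne in \<open>auto simp: pe_def\<close>)
  then have "tcount i ({..<d} - nb {w, p j}) 1 \<le> cnt i {{w, p j}}"
    by (intro cnt_single_ge) (use assms(4) in auto)
  moreover have "tcount i {..<d - 2} 1 \<le> tcount i ({..<d} - nb {w, p j}) 1"
    by (rule tcount_nb) (use assms(4) A_subset in auto)
  ultimately show "tcount i {..<d - 2} 1 \<le> cnt i {{w, p j}}" by linarith
  have "uncov C1 {{w, p (Suc j)}} S" if "S \<subseteq> {..<d} - nb {w, p (Suc j)}" for S
  proof (rule uncovI[of "p j"])
    fix k assume k: "k \<in> S" "pe k \<in> C1"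
    then have "k < d" "k \<notin> nb {w, p (Suc j)}" using that by auto
    then have "pe k \<noteq> pe j" using inj_onD[OF inj_pe, of k j] assms(2) by (auto simp: nb_def)
    moreover have "pe k \<noteq> {w, x}" for x using pe_subset_P[OF \<open>k < d\<close>] assms(1) by auto
    ultimately show "p j \<notin> pe k" using k(2) assms(3) by auto
  qed (use assms ne in \<open>auto simp: pe_def\<close>)
  then have "tcount i ({..<d} - nb {w, p (Suc j)}) 1 \<le> cnt i {{w, p (Suc j)}}"
    by (intro cnt_single_ge) (use assms(4) in auto)
  moreover have "tcount i {..<d - 2} 1 \<le> tcount i ({..<d} - nb {w, p (Suc j)}) 1"
    by (rule tcount_nb) (use assms(4) A_subset in auto)
  ultimately show "tcount i {..<d - 2} 1 \<le> cnt i {{w, p (Suc j)}}" by linarith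
qed

text \<open>In a 4-cycle \<open>w, p j, p (j+1), p (j+2)\<close> the vertex \<open>p j\<close> is left uncovered by
  \<open>{w, p (j+2)}\<close> together with path edges other than \<open>pe j\<close>, and symmetrically.\<close>

lemma uncov_heavy:
  assumes w: "w \<notin> P" and j: "j + 2 \<le> d"
    and C: "C1 = {{w, p j}, {w, p (j + 2)}, pe j, pe (j + 1)}"
    and U: "{w, p j} \<notin> U \<or> {w, p (j + 2)} \<notin> U" "U \<inter> C1 \<subseteq> {{w, p j}, {w, p (j + 2)}}"
    and S: "S \<subseteq> {..<d}" "{w, p j} \<notin> U \<Longrightarrow> j \<notin> S" "{w, p (j + 2)} \<notin> U \<Longrightarrow> j + 1 \<notin> S"
  shows "uncov C1 U S"
proof -
  have ne: "p j \<noteq> p (j + 2)" "w \<noteq> p j" "w \<noteq> p (j + 2)" using w j p_in_P p_eq_iff by auto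
  have nw: "pe k \<noteq> {w, x}" if "k < d" for k x using pe_subset_P[OF that] w by auto
  have pe_eq: "pe k = pe l \<longleftrightarrow> k = l" if "k < d" "l < d" for k l
    using inj_onD[OF inj_pe, of k l] that by auto
  consider "{w, p j} \<notin> U" | "{w, p (j + 2)} \<notin> U" using U(1) by auto
  then show ?thesis
  proof cases
    case 1
    show ?thesis
    proof (rule uncovI[of "p j"])
      show "p j \<notin> \<Union>(U \<inter> C1)" using 1 U(2) ne by auto
      fix k assume k: "k \<in> S" "pe k \<in> C1"
      then have kd: "k < d" "k \<noteq> j" using S 1 by auto
      have "pe k = pe (j + 1)" using k(2) kd nw C pe_eq[of k j] j by auto
      then have "k = j + 1" using pe_eq[of k "j + 1"] kd j by auto
      then show "p j \<notin> pe k" using p_in_pe_iff[of k j] kd j by auto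
    qed (use C in auto)
  next
    case 2
    show ?thesis
    proof (rule uncovI[of "p (j + 2)"])
      show "p (j + 2) \<notin> \<Union>(U \<inter> C1)" using 2 U(2) ne by auto
      fix k assume k: "k \<in> S" "pe k \<in> C1"
      then have kd: "k < d" "k \<noteq> j + 1" using S 2 by auto
      have "pe k = pe j" using k(2) kd nw C pe_eq[of k "j + 1"] j by auto
      then have "k = j" using pe_eq[of k j] kd j by auto
      then show "p (j + 2) \<notin> pe k" using p_in_pe_iff[of k "j + 2"] kd j by auto
    qed (use C in auto)
  qed
qed

text \<open>Besides the path edges that meet the chosen edge, one more cycle edge is given up:
  \<open>pe j\<close> with \<open>{w, p (j + 2)}\<close>, and \<open>pe (j + 1)\<close> with
  \<open>{w, p j}\<close>. The two choices compensate each other in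
  \<open>tcount_heavy\<close>.\<close>

lemma cnt_heavy:
  assumes w: "w \<notin> P" and j: "j + 2 \<le> d"
    and C: "C1 = {{w, p j}, {w, p (j + 2)}, pe j, pe (j + 1)}" and A: "A = {{w, p j}, {w, p (j + 2)}}"
  shows "tcount i {..<d - 2} 1 + tcount i {..<d - 4} 1 \<le> cnt i {{w, p j}} + cnt i {{w, p (j + 2)}}"
proof -
  have ne: "p j \<noteq> p (j + 2)" "w \<noteq> p j" "w \<noteq> p (j + 2)" using w j p_in_P p_eq_iff by auto
  have ed: "{w, p j} \<noteq> {w, p (j + 2)}" using ne by (auto simp: doubleton_eq_iff)
  have "tcount i ({..<d} - {j, j + 1, j + 2}) 1 \<le> cnt i {{w, p (j + 2)}}"
  proof (rule cnt_single_ge)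
    show "{..<d} - {j, j + 1, j + 2} \<subseteq> {..<d} - nb {w, p (j + 2)}"
      using nb_pair[of w "j + 2"] w j by auto
    show "uncov C1 {{w, p (j + 2)}} S" if "S \<subseteq> {..<d} - {j, j + 1, j + 2}" for S
      by (rule uncov_heavy[OF w j C]) (use that ed in auto)
  qed (use A in auto)
  moreover have "tcount i ({..<d} - {j - 1, j, j + 1}) 1 \<le> cnt i {{w, p j}}"
  proof (rule cnt_single_ge)
    show "{..<d} - {j - 1, j, j + 1} \<subseteq> {..<d} - nb {w, p j}"
      using nb_pair[of w j] w j by auto
    show "uncov C1 {{w, p j}} S" if "S \<subseteq> {..<d} - {j - 1, j, j + 1}" for S
      by (rule uncov_heavy[OF w j C]) (use that ed in auto)
  qed (use A in auto)
  ultimately show ?thesis using tcount_heavy[OF j, of i 1] by linarith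
qed

text \<open>An off-path vertex of \<open>C1\<close> missed by \<open>e\<close> stays uncovered
  whatever path edges are used. Only when \<open>W\<close> is exactly \<open>e\<close> must a path
  vertex serve instead, at the cost of at most one path edge.\<close>

lemma cnt_light:
  assumes W: "2 \<le> card W" and e: "e \<in> A"
  shows "tcount i {..<d - 2} 1 \<le> cnt i {e}"
    and "e \<inter> P = {} \<Longrightarrow> tcount i {..<d - 1} 1 \<le> cnt i {e}"
    and "e \<inter> P = {} \<Longrightarrow> 3 \<le> card W \<Longrightarrow> tcount i {..<d} 1 \<le> cnt i {e}"
proof -
  have eE: "e \<in> E" "e \<in> C1" "e \<in> off" using e A_subset C1(1) by auto
  have big: "tcount i {..<d} 1 \<le> cnt i {e}" if "e \<inter> P = {}" "3 \<le> card W"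
  proof (rule cnt_single_ge[OF e])
    have "\<not> W \<subseteq> e"
    proof
      assume "W \<subseteq> e"
      moreover have "finite e" using eE edgeD fin_V finite_subset by metis
      ultimately have "card W \<le> card e" by (intro card_mono)
      then show False using that edgeD[OF eE(1)] by simp
    qed
    then show "uncov C1 {e} S" if "S \<subseteq> {..<d}" for S using that uncov_offI[of _ "{e}" S] by auto
  qed (use that nb_empty in auto)
  have one: "tcount i {..<d - 1} 1 \<le> cnt i {e}" if eP: "e \<inter> P = {}"
  proof (cases "3 \<le> card W")
    case True
    have "tcount i {..<d - 1} 1 \<le> tcount i {..<d} 1" by (rule tcount_mono) auto
    then show ?thesis using big[OF eP True] by linarith
  next
    case False
    then have W2: "card W = 2" using W by simp
    obtain w w' where ww: "e = {w, w'}" "w \<noteq> w'" using eE(1) edge_pair by metis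
    have "e \<subseteq> W" using eP eE by auto
    then have We: "W = e" using card_subset_eq[OF fin_W, of e] W2 edgeD[OF eE(1)] by simp
    have wW: "w \<in> \<Union>C1" "w \<notin> P" using We ww by auto
    \<comment> \<open>The witness will be the path vertex \<open>p l\<close> at which
      \<open>C1\<close> continues from \<open>w\<close>. Of the two cycle edges there,
      \<open>f\<close> is off the path and not chosen; giving up the other one, \<open>g\<close>, if
      it is a path edge, leaves \<open>p l\<close> uncovered.\<close>
    obtain f where f: "f \<in> A" "w \<in> f" "w' \<notin> f" using edge_avoiding[OF wW] ww by metis
    have "f \<in> off" "f \<in> C1" "f \<in> E" using f A_subset C1(1) by auto
    from \<open>f \<in> off\<close> obtain l where l: "f = {w, p l}" "l \<le> d"
    proof (cases f rule: off_cases)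
      case 1
      then have "f \<subseteq> {w, w'}" using We ww \<open>f \<in> C1\<close> by auto
      then have "f \<subseteq> {w}" using f by auto
      then have "card f \<le> 1" using card_mono[of "{w}" f] by simp
      then show ?thesis using edgeD[OF \<open>f \<in> E\<close>] by simp
    next
      case (2 u j)
      then have "u = w" using f wW p_in_P by auto
      then show ?thesis using 2 that by auto
    qed
    have "p l \<in> \<Union>C1" using l \<open>f \<in> C1\<close> by auto
    then obtain f1 f2 where f12: "f1 \<noteq> f2" "{e \<in> C1. p l \<in> e} = {f1, f2}" by (rule two_edges_at)
    moreover have "f \<in> {e \<in> C1. p l \<in> e}" using l \<open>f \<in> C1\<close> by simp
    ultimately have "{e \<in> C1. p l \<in> e} = {f, f1} \<or> {e \<in> C1. p l \<in> e} = {f, f2}" by auto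
    then obtain g where g: "{e \<in> C1. p l \<in> e} = {f, g}" by blast
    have ple: "p l \<notin> e" using eP l p_in_P by auto
    have "\<exists>h. \<forall>S\<subseteq>{..<d} - {h}. uncov C1 {e} S"
    proof (cases "g \<in> pe ` {..<d}")
      case True
      then obtain h where h: "h < d" "g = pe h" by auto
      have "uncov C1 {e} S" if S: "S \<subseteq> {..<d} - {h}" for S
      proof (rule uncovI[of "p l"])
        fix k assume k: "k \<in> S" "pe k \<in> C1"
        then have "k < d" "k \<noteq> h" using S by auto
        then have "pe k \<noteq> g" using h inj_onD[OF inj_pe, of k h] by auto
        moreover have "pe k \<noteq> f" using pe_subset_P[OF \<open>k < d\<close>] f wW by auto
        ultimately show "p l \<notin> pe k" using g k(2) by auto
      qed (use \<open>p l \<in> \<Union>C1\<close> ple in auto)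
      then show ?thesis by auto
    next
      case False
      have "uncov C1 {e} S" if S: "S \<subseteq> {..<d}" for S
      proof (rule uncovI[of "p l"])
        fix k assume k: "k \<in> S" "pe k \<in> C1"
        then have "k < d" using S by auto
        then have "pe k \<noteq> g" using False by auto
        moreover have "pe k \<noteq> f" using pe_subset_P[OF \<open>k < d\<close>] f wW by auto
        ultimately show "p l \<notin> pe k" using g k(2) by auto
      qed (use \<open>p l \<in> \<Union>C1\<close> ple in auto)
      then show ?thesis by blast
    qed
    then obtain h where "\<And>S. S \<subseteq> {..<d} - {h} \<Longrightarrow> uncov C1 {e} S" by auto
    then have "tcount i ({..<d} - {h}) 1 \<le> cnt i {e}"
      by (intro cnt_single_ge[OF e]) (use nb_empty[OF eP] in auto)
    then show ?thesis using tcount_delete_edge[of i d 1 h] by linarith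
  qed
  have "tcount i ({..<d} - nb e) 1 \<le> cnt i {e}" if "e \<inter> P \<noteq> {}"
  proof (rule cnt_single_ge[OF e order_refl])
    fix S assume S: "S \<subseteq> {..<d} - nb e"
    obtain w j where wj: "e = {w, p j}" "w \<notin> P" "j \<le> d" using eE(3) \<open>e \<inter> P \<noteq> {}\<close> by (elim off_cases) auto
    have "\<not> W \<subseteq> {w}" using W card_mono[of "{w}" W] by auto
    then obtain x where "x \<in> W" "x \<noteq> w" by auto
    then show "uncov C1 {e} S" using S wj p_in_P by (intro uncov_offI[of x]) auto
  qed
  moreover have "tcount i {..<d - 2} 1 \<le> tcount i {..<d - 1} 1" by (rule tcount_mono) auto
  ultimately show "tcount i {..<d - 2} 1 \<le> cnt i {e}"
    using one tcount_nb[OF eE(3), of i 1] by (cases "e \<inter> P = {}") auto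
  show "e \<inter> P = {} \<Longrightarrow> tcount i {..<d - 1} 1 \<le> cnt i {e}" by (rule one)
  show "e \<inter> P = {} \<Longrightarrow> 3 \<le> card W \<Longrightarrow> tcount i {..<d} 1 \<le> cnt i {e}" by (rule big)
qed

lemma card_W_pos: "1 \<le> card W"
proof -
  have "W \<noteq> {}" using ex_off_vertex by auto
  then show ?thesis using fin_W by (metis One_nat_def Suc_leI card_gt_0_iff)
qed

text \<open>If \<open>card W = 1\<close>, then \<open>A\<close> has two edges and the triangle and
  4-cycle bounds apply. If \<open>card W\<close> is at least 3, the edges of \<open>A0\<close>, at
  least \<open>card A - 2\<close> many, leave the whole path free. If \<open>card W = 2\<close>,
  then \<open>A\<close> has at most three edges; an edge charged \<open>?a + 2 * ?b\<close> falls
  short by one \<open>?b\<close>, which the other two edges repay.\<close>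

lemma sum_cnt_cycle:
  "(card A - 2) * (tcount i {..<d - 2} 1 + 2 * tcount i {..<d - 4} 2) + tcount i {..<d - 2} 1 + tcount i {..<d - 4} 1
    \<le> (\<Sum>e\<in>A. cnt i {e})"
proof (cases "card W = 1")
  case True
  then obtain w j k where wjk: "w \<notin> P" "j < k" "k \<le> j + 2" "k \<le> d" "A = {{w, p j}, {w, p k}}"
    "C1 = {{w, p j}, {w, p k}} \<union> pe ` {j..<k}" "{w, p j} \<noteq> {w, p k}"
    by (rule single_off_vertex)
  then have sum: "(\<Sum>e\<in>A. cnt i {e}) = cnt i {{w, p j}} + cnt i {{w, p k}}" and cA: "card A = 2" by auto
  consider "k = Suc j" | "k = j + 2" using wjk by linarith
  then have "tcount i {..<d - 2} 1 + tcount i {..<d - 4} 1 \<le> cnt i {{w, p j}} + cnt i {{w, p k}}"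
  proof cases
    case 1
    then have "C1 = {{w, p j}, {w, p (Suc j)}, pe j}" using wjk(6) by auto
    moreover have "tcount i {..<d - 4} 1 \<le> tcount i {..<d - 2} 1" by (rule tcount_mono) auto
    ultimately show ?thesis using cnt_single_triangle[of w j i] wjk 1 by simp
  next
    case 2
    have "{j..<j + 2} = {j, j + 1}" by auto
    then have "C1 = {{w, p j}, {w, p (j + 2)}, pe j, pe (j + 1)}" using wjk(6) 2 by auto
    then show ?thesis using cnt_heavy[of w j i] wjk 2 by simp
  qed
  then show ?thesis using sum cA by simp
next
  case False
  then have W: "2 \<le> card W" using card_W_pos by linarith
  let ?a = "tcount i {..<d - 2} 1" and ?b = "tcount i {..<d - 4} 2" and ?c = "tcount i {..<d - 4} 1"
  have split: "(\<Sum>e\<in>A. cnt i {e}) = (\<Sum>e\<in>A0. cnt i {e}) + (\<Sum>e\<in>A1. cnt i {e})"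
    using fin_A by (subst sum.union_disjoint[symmetric]) (auto intro: sum.cong)
  have s1: "card A1 * ?a \<le> (\<Sum>e\<in>A1. cnt i {e})"
    using sum_bounded_below[of A1 ?a "\<lambda>e. cnt i {e}"] cnt_light(1)[OF W] by simp
  note c = tcount_surplus[OF d, of i 1, unfolded Suc_1]
  obtain m where m: "card A = m + 2" using card_A_ge by (metis add.commute le_Suc_ex)
  have A0: "m \<le> card A0" using card_A card_A1_le m by linarith
  show ?thesis
  proof (cases "3 \<le> card W")
    case True
    have "card A0 * (?a + 2 * ?b) \<le> (\<Sum>e\<in>A0. cnt i {e})"
      using sum_bounded_below[of A0 "?a + 2 * ?b" "\<lambda>e. cnt i {e}"] cnt_light(3)[OF W _ _ True] c(1) order_trans
      by fastforce
    then have "card A0 * (?a + 2 * ?b) + card A1 * ?a \<le> (\<Sum>e\<in>A. cnt i {e})" using split s1 by linarith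
    moreover have "card A0 * (?a + 2 * ?b) + card A1 * ?a = card A * ?a + card A0 * (2 * ?b)"
      by (simp add: card_A algebra_simps)
    moreover have "m * (2 * ?b) \<le> card A0 * (2 * ?b)" using A0 by (rule mult_right_mono) simp
    moreover have "card A * ?a = m * ?a + 2 * ?a" by (simp add: m algebra_simps)
    moreover have "?c \<le> ?a" using c(3) by linarith
    moreover have "(card A - 2) * (?a + 2 * ?b) = m * ?a + m * (2 * ?b)" by (simp add: m algebra_simps)
    ultimately show ?thesis by linarith
  next
    case False
    then have m1: "m \<le> 1" using card_A_le m by linarith
    have "card A0 * (?a + ?b) \<le> (\<Sum>e\<in>A0. cnt i {e})"
      using sum_bounded_below[of A0 "?a + ?b" "\<lambda>e. cnt i {e}"] cnt_light(2)[OF W] c(2) order_trans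
      by fastforce
    then have "card A0 * (?a + ?b) + card A1 * ?a \<le> (\<Sum>e\<in>A. cnt i {e})" using split s1 by linarith
    moreover have "card A0 * (?a + ?b) + card A1 * ?a = card A * ?a + card A0 * ?b"
      by (simp add: card_A algebra_simps)
    moreover have "m * ?b \<le> card A0 * ?b" using A0 by (rule mult_right_mono) simp
    moreover have "card A * ?a = m * ?a + 2 * ?a" by (simp add: m algebra_simps)
    moreover have "m * ?b \<le> ?b" using m1 mult_right_mono[of m 1 ?b] by simp
    moreover have "(card A - 2) * (?a + 2 * ?b) = m * ?a + 2 * (m * ?b)" by (simp add: m algebra_simps)
    ultimately show ?thesis using c(3) by linarith
  qed
qed


section \<open>Matchings with two edges off the path\<close>

lemma cnt_pair_ge:
  assumes g: "g \<in> off" "g \<notin> C1" "g \<notin> C2" and e: "e \<in> A" "e \<inter> g = {}"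
    and E': "E' \<subseteq> {..<d} - (nb g \<union> nb e)" and unc: "\<And>S. S \<subseteq> E' \<Longrightarrow> uncov C1 {g, e} S"
  shows "tcount i E' 2 \<le> cnt i {g, e}"
proof -
  have "g \<noteq> e" using g e A_subset by auto
  then have "card {g, e} = 2" by simp
  moreover have "tcount i E' (card {g, e}) \<le> cnt i {g, e}"
  proof (rule cnt_ge_C1)
    show "pairwise disjnt {g, e}" using e by (auto simp: pairwise_def disjnt_def)
    show "{g, e} \<inter> C2 = {}" using g e A_subset C_disj by auto
  qed (use g e A_subset E' unc in auto)
  ultimately show ?thesis by simp
qed

lemma sum_cnt_pairs_if_one:
  assumes g: "g \<in> off" "g \<notin> C1" "g \<notin> C2" and e: "e \<in> A" "e \<inter> g = {}"
    and unc: "\<And>S. S \<subseteq> {..<d} - (nb g \<union> nb e) \<Longrightarrow> uncov C1 {g, e} S"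
  shows "tcount i {..<d - 4} 2 \<le> (\<Sum>e | e \<in> A \<and> e \<inter> g = {}. cnt i {g, e})"
proof -
  have "tcount i {..<d - 4} 2 \<le> tcount i ({..<d} - (nb g \<union> nb e)) 2"
    by (rule tcount_nb2) (use g e A_subset in auto)
  also have "\<dots> \<le> cnt i {g, e}" by (rule cnt_pair_ge[OF g e order_refl unc])
  also have "\<dots> \<le> (\<Sum>e | e \<in> A \<and> e \<inter> g = {}. cnt i {g, e})"
    using member_le_sum[of e "{e \<in> A. e \<inter> g = {}}" "\<lambda>e. cnt i {g, e}"] e fin_A by simp
  finally show ?thesis .
qed

text \<open>\<open>C1\<close> with a chord would have more edges than vertices without containing
  \<open>C2\<close>.\<close>

lemma not_chord:
  assumes g: "g \<in> E" "g \<notin> C1" "g \<notin> C2" and "g \<subseteq> \<Union>C1"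
  shows False
proof -
  have fin: "finite C1" "finite (\<Union>C1)"
  proof -
    show "finite C1" using C1(1) fin_E by (rule finite_subset)
    have "\<Union>C1 \<subseteq> V" using C1(1) edgeD by blast
    then show "finite (\<Union>C1)" using fin_V by (rule finite_subset)
  qed
  have "card (insert g C1) \<le> card (\<Union>C1)"
  proof (rule card_edges_le)
    show "\<not> C2 \<subseteq> insert g C1" using C2(2) g(3) C_disj by blast
    show "\<Union>C1 \<noteq> {}" using ex_off_vertex by auto
  qed (use assms C1 fin in auto)
  then show False using card_C1 fin g(2) by simp
qed

text \<open>A third edge from \<open>w\<close> to the path would give the path and \<open>C1\<close>
  together more edges than vertices, again without \<open>C2\<close>.\<close>

lemma single_off_vertex_no_further_nbr:
  assumes "card W = 1" "w \<in> W" "k \<le> d" and g: "{w, p k} \<in> E" "{w, p k} \<notin> C1" "{w, p k} \<in> off"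
  shows False
proof -
  let ?g = "{w, p k}"
  have fin: "finite (pe ` {..<d} \<union> C1)" using C1(1) fin_E finite_subset by auto
  have "card (insert ?g (pe ` {..<d} \<union> C1)) \<le> card (P \<union> \<Union>C1)"
  proof (rule card_edges_le)
    interpret sw: two_cycles_geodesic V E C2 C1 p d \<delta> by (rule swap_geodesic)
    show "insert ?g (pe ` {..<d} \<union> C1) \<subseteq> E" using g(1) C1(1) pe_in_E by auto
    show "\<not> C2 \<subseteq> insert ?g (pe ` {..<d} \<union> C1)"
    proof
      assume sub: "C2 \<subseteq> insert ?g (pe ` {..<d} \<union> C1)"
      have "w \<notin> \<Union>C2" using assms(2) disj by auto
      then have "?g \<notin> C2" by auto
      then have "C2 \<subseteq> pe ` {..<d} \<union> C1" using sub by auto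
      then show False using C2_not_in_path_Un_C1 by simp
    qed
    show "\<Union>(insert ?g (pe ` {..<d} \<union> C1)) \<subseteq> P \<union> \<Union>C1"
      using pe_subset_P p_in_P assms(2,3) by auto
    show "finite (P \<union> \<Union>C1)" using card_P_Un_C1 by (metis card.infinite add_is_0 zero_neq_one)
    show "P \<union> \<Union>C1 \<noteq> {}" by (auto simp: P_def)
  qed
  moreover have "?g \<notin> pe ` {..<d} \<union> C1" using g by (auto simp: off_def)
  ultimately have "Suc (d + card A) \<le> d + 1 + card W"
    using fin by (simp add: card_path_Un_C1 card_P_Un_C1)
  then show False using card_A_ge assms(1) by simp
qed

text \<open>Used alone, an edge outside the cycles that touches the path may block two path edges
  and secures only \<alpha>. The missing \<beta> for each cycle comes from pairing it with edges of
  that cycle.\<close>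

lemma sum_cnt_pairs:
  assumes g: "g \<in> off" "g \<notin> C1" "g \<notin> C2" "g \<inter> P \<noteq> {}"
  shows "tcount i {..<d - 4} 2 \<le> (\<Sum>e | e \<in> A \<and> e \<inter> g = {}. cnt i {g, e})"
proof -
  obtain u k where uk: "g = {u, p k}" "u \<notin> P" "k \<le> d" using g(1,4) by (elim off_cases) auto
  have gE: "g \<in> E" using g by (auto simp: off_def)
  \<comment> \<open>Both ends of \<open>g\<close> in \<open>C1\<close> would make a chord. If one
    end is in \<open>C1\<close>, it serves as the uncovered vertex, because \<open>g\<close> covers
    it without being a cycle edge.\<close>
  consider "u \<in> \<Union>C1" "p k \<notin> \<Union>C1" | "u \<notin> \<Union>C1" "p k \<in> \<Union>C1" | "u \<notin> \<Union>C1" "p k \<notin> \<Union>C1"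
    using not_chord[OF gE g(2,3)] uk by auto
  then show ?thesis
  proof cases
    case 1
    have "card W \<noteq> 1" using single_off_vertex_no_further_nbr[of u k] 1 uk g gE by auto
    moreover have "u \<in> W" using 1 uk by auto
    ultimately have "W \<noteq> {u}" by auto
    then obtain w where w: "w \<in> W" "w \<noteq> u" using \<open>u \<in> W\<close> by blast
    then obtain e where e: "e \<in> A" "w \<in> e" "u \<notin> e" using edge_avoiding[of w u] by auto
    have disj': "e \<inter> g = {}" using e uk 1 A_subset by auto
    show ?thesis
    proof (rule sum_cnt_pairs_if_one[OF g(1,2,3) e(1) disj'])
      show "uncov C1 {g, e} S" if "S \<subseteq> {..<d} - (nb g \<union> nb e)" for S
        using that \<open>u \<in> W\<close> g e by (intro uncov_offI[of u]) auto
    qed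
  next
    case 2
    obtain w where w: "w \<in> W" using ex_off_vertex by auto
    then have "p k \<noteq> w" using uk p_in_P by auto
    then obtain e where e: "e \<in> A" "w \<in> e" "p k \<notin> e" using edge_avoiding[of w "p k"] w by auto
    have disj': "e \<inter> g = {}" using e uk 2 A_subset by auto
    show ?thesis
    proof (rule sum_cnt_pairs_if_one[OF g(1,2,3) e(1) disj'])
      show "uncov C1 {g, e} S" if S: "S \<subseteq> {..<d} - (nb g \<union> nb e)" for S
      proof (rule uncovI[of "p k"])
        fix l assume "l \<in> S"
        then have "l < d" "l \<notin> nb g" using S by auto
        then show "p k \<notin> pe l" using uk by (auto simp: nb_def pe_def)
      qed (use 2 g e in auto)
    qed
  next
    case 3
    then have gC: "g \<inter> \<Union>C1 = {}" using uk by auto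
    show ?thesis
    proof (cases "card W = 1")
      case False
      then have "2 \<le> card W" using card_W_pos by linarith
      obtain x where x: "x \<in> W" using ex_off_vertex by auto
      have "W \<noteq> {x}" using False by auto
      then obtain w where w: "w \<in> W" "w \<noteq> x" using x by blast
      then obtain e where e: "e \<in> A" "w \<in> e" "x \<notin> e" using edge_avoiding[of w x] by auto
      have disj': "e \<inter> g = {}" using e gC A_subset by auto
      show ?thesis
      proof (rule sum_cnt_pairs_if_one[OF g(1,2,3) e(1) disj'])
        show "uncov C1 {g, e} S" if "S \<subseteq> {..<d} - (nb g \<union> nb e)" for S
          using that x g e by (intro uncov_offI[of x]) auto
      qed
    next
      case True
      then obtain w j l where w: "w \<notin> P" "j < l" "l \<le> j + 2" "l \<le> d" "A = {{w, p j}, {w, p l}}"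
        "C1 = {{w, p j}, {w, p l}} \<union> pe ` {j..<l}" "{w, p j} \<noteq> {w, p l}"
        by (rule single_off_vertex)
      consider "l = Suc j" | "l = j + 2" using w by linarith
      then show ?thesis
      proof cases
        case l: 1
        then have C: "C1 = {{w, p j}, {w, p (Suc j)}, pe j}" using w(6) by auto
        have ne: "p j \<noteq> p (Suc j)" "w \<noteq> p j" "w \<noteq> p (Suc j)" using w l p_in_P p_eq_iff by auto
        have e: "{w, p j} \<in> A" "{w, p j} \<inter> g = {}" using w gC by auto
        show ?thesis
        proof (rule sum_cnt_pairs_if_one[OF g(1,2,3) e])
          show "uncov C1 {g, {w, p j}} S" if S: "S \<subseteq> {..<d} - (nb g \<union> nb {w, p j})" for S
          proof (rule uncovI[of "p (Suc j)"])
            fix k assume k: "k \<in> S" "pe k \<in> C1"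
            then have "k < d" "k \<notin> nb {w, p j}" using S by auto
            then have "pe k \<noteq> pe j" using inj_onD[OF inj_pe, of k j] w(4) l by (auto simp: nb_def)
            moreover have "pe k \<noteq> {w, x}" for x using pe_subset_P[OF \<open>k < d\<close>] w(1) by auto
            ultimately show "p (Suc j) \<notin> pe k" using k(2) C by auto
          qed (use C ne g in auto)
        qed
      next
        case l: 2
        have "{j..<j + 2} = {j, j + 1}" by auto
        then have C: "C1 = {{w, p j}, {w, p (j + 2)}, pe j, pe (j + 1)}" using w(6) l by auto
        have jd: "j + 2 \<le> d" using w l by simp
        \<comment> \<open>\<open>g\<close> is disjoint from \<open>C1\<close>, so its foot avoids
          the three path vertices of the 4-cycle, as \<open>tcount_heavy_delete_vertex\<close>
          demands.\<close>
        have k: "k \<notin> {j, j + 1, j + 2}"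
        proof
          assume "k \<in> {j, j + 1, j + 2}"
          then have "p k \<in> {w, p j} \<union> {w, p (j + 2)} \<union> pe j" by (auto simp: pe_def)
          then show False using 3(2) C by auto
        qed
        have dj: "{w, p j} \<inter> g = {}" "{w, p (j + 2)} \<inter> g = {}" using gC C by auto
        have nbg: "nb g \<subseteq> {k - 1, k}" using nb_pair uk by auto
        have ne: "g \<noteq> {w, p j}" "g \<noteq> {w, p (j + 2)}" "{w, p j} \<noteq> {w, p (j + 2)}"
          using g(2) C w(7) l by auto
        have "tcount i ({..<d} - {k - 1, k, j, j + 1, j + 2}) 2 \<le> cnt i {g, {w, p (j + 2)}}"
        proof (rule cnt_pair_ge[OF g(1,2,3) _ dj(2)])
          show "{..<d} - {k - 1, k, j, j + 1, j + 2} \<subseteq> {..<d} - (nb g \<union> nb {w, p (j + 2)})"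
            using nbg nb_pair[of w "j + 2"] w(1) jd by auto
          show "uncov C1 {g, {w, p (j + 2)}} S" if "S \<subseteq> {..<d} - {k - 1, k, j, j + 1, j + 2}" for S
            by (rule uncov_heavy[OF w(1) jd C]) (use that ne g(2) in auto)
        qed (use w l in auto)
        moreover have "tcount i ({..<d} - {k - 1, k, j - 1, j, j + 1}) 2 \<le> cnt i {g, {w, p j}}"
        proof (rule cnt_pair_ge[OF g(1,2,3) _ dj(1)])
          show "{..<d} - {k - 1, k, j - 1, j, j + 1} \<subseteq> {..<d} - (nb g \<union> nb {w, p j})"
            using nbg nb_pair[of w j] w(1) jd by auto
          show "uncov C1 {g, {w, p j}} S" if "S \<subseteq> {..<d} - {k - 1, k, j - 1, j, j + 1}" for S
            by (rule uncov_heavy[OF w(1) jd C]) (use that ne g(2) in auto)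
        qed (use w in auto)
        moreover have "{e. e \<in> A \<and> e \<inter> g = {}} = {{w, p j}, {w, p (j + 2)}}"
          using w(5) l dj by auto
        then have "(\<Sum>e | e \<in> A \<and> e \<inter> g = {}. cnt i {g, e}) = cnt i {g, {w, p j}} + cnt i {g, {w, p (j + 2)}}"
          using ne by simp
        ultimately show ?thesis using tcount_heavy_delete_vertex[OF k jd, of i 2] by linarith
      qed
    qed
  qed
qed

lemma edge_misses_vertex:
  assumes "e \<in> C1" shows "\<exists>x\<in>\<Union>C1. x \<notin> e"
proof (rule ccontr)
  assume "\<not> ?thesis"
  then have all: "\<Union>C1 \<subseteq> e" by auto
  have ce: "card e = 2" "finite e" using assms C1(1) edgeD fin_V finite_subset by (blast, metis subsetD)
  have eq: "f = e" if "f \<in> C1" for f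
    using card_subset_eq[of e f] that all ce C1(1) edgeD by (metis Sup_upper subset_trans subsetD)
  obtain v where "v \<in> e" using ce by fastforce
  then have "{f \<in> C1. v \<in> f} = {e}" using assms eq by blast
  then show False using C1(3)[of v] \<open>v \<in> e\<close> assms by auto
qed

lemma cnt_empty_ge: "tcount i {..<d} 0 \<le> cnt i {}"
  using cnt_ge_C1[of "{}" "{..<d}" i] uncov_disjoint[of "{}"] by simp

lemma cnt_other_ge:
  assumes "g \<in> off" "g \<notin> C1" "g \<notin> C2"
  shows "tcount i ({..<d} - nb g) 1 \<le> cnt i {g}"
  using cnt_ge_C1[of "{g}" "{..<d} - nb g" i] uncov_disjoint[of "{g}"] assms by auto

text \<open>Of the \<open>card V + 1 - d\<close> off-path edges, two in each cycle are set aside,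
  and the other \<open>card V - d - 3\<close> are charged \<alpha> + 2 \<beta>: surplus cycle edges
  through \<open>sum_cnt_cycle\<close>, edges of \<open>R0\<close> because they leave the path free,
  and edges of \<open>R1\<close> with \<alpha> alone and 2 \<beta> from pairs with an edge of either
  cycle.\<close>

theorem card_good_ge:
  "tcount i {..<d} 0 + (card V - d - 3) * (tcount i {..<d - 2} 1 + 2 * tcount i {..<d - 4} 2)
     + 2 * (tcount i {..<d - 2} 1 + tcount i {..<d - 4} 1) + (if i = 2 then 1 else 0)
   \<le> card {M. good M \<and> card M = i}"
proof -
  \<comment> \<open>The closing estimate is linear in the block sums; stating it over variables
    keeps the large terms out of the arithmetic.\<close>
  have arith: "t + X + 2 * y + z \<le> N"
    if "s \<le> N" "s = c0 + o1 + o2 + o3" "o1 = u" "n \<le> o2" "z \<le> o3" "u = sa + sb + s0 + s1"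
      "m0 \<le> s0" "m1 \<le> s1" "X = xa + xb + m0 + (m1 + n)" "xa + y \<le> sa" "xb + y \<le> sb" "t \<le> c0"
    for t X y z N s c0 o1 o2 o3 u n sa sb s0 s1 m0 m1 xa xb :: nat
    using that by linarith
  interpret sw: two_cycles_geodesic V E C2 C1 p d \<delta> by (rule swap_geodesic)
  have cnt_sw: "sw.cnt = cnt"
    by (intro ext) (simp add: sw.cnt_def cnt_def good_swap)
  let ?\<alpha> = "tcount i {..<d - 2} 1" and ?\<beta> = "tcount i {..<d - 4} 2" and ?\<gamma> = "tcount i {..<d - 4} 1"
  define R where "R = off - C1 - C2"
  define R0 where "R0 = {g \<in> R. g \<inter> P = {}}"
  define R1 where "R1 = {g \<in> R. g \<inter> P \<noteq> {}}"
  note surplus = tcount_surplus[OF d, of i 1, unfolded Suc_1]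
  have fin: "finite R" "finite R0" "finite R1" using fin_off by (auto simp: R_def R0_def R1_def)
  have R: "R = R0 \<union> R1" "R0 \<inter> R1 = {}" by (auto simp: R0_def R1_def)
  have AA: "A \<inter> sw.A = {}" using C_disj by (auto simp: A_def sw.A_def)
  have off: "off = (A \<union> sw.A) \<union> R" "(A \<union> sw.A) \<inter> R = {}" by (auto simp: A_def sw.A_def R_def)
  have sum_off: "(\<Sum>e\<in>off. f e) = (\<Sum>e\<in>A. f e) + (\<Sum>e\<in>sw.A. f e) + (\<Sum>e\<in>R0. f e) + (\<Sum>e\<in>R1. f e)"
    for f :: "'a set \<Rightarrow> nat"
    unfolding off(1) using fin_A sw.fin_A fin off(2) AA R
    by (simp add: sum.union_disjoint)
  have card_off: "card off = card V + 1 - d"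
  proof -
    have "card (E - pe ` {..<d}) = card E - card (pe ` {..<d})"
      using pe_in_E by (intro card_Diff_subset) auto
    then show ?thesis using card_E inj_pe by (simp add: off_def card_image)
  qed
  have parts: "card off = card A + card sw.A + card R0 + card R1"
    using sum_off[of "\<lambda>_. 1"] by simp
  \<comment> \<open>Disjoint families of off-path parts: single edges, pairs of an \<open>R1\<close>
    edge with a disjoint cycle edge, and for \<open>i = 2\<close> one pair across the two
    cycles.\<close>
  define O1 where "O1 = (\<lambda>e. {e}) ` off"
  define I where "I = (SIGMA g:R1. {e. e \<in> A \<and> e \<inter> g = {}} \<union> {e. e \<in> sw.A \<and> e \<inter> g = {}})"
  define O2 where "O2 = (\<lambda>(g, e). {g, e}) ` I"
  obtain e1 e2 where e12: "e1 \<in> A" "e2 \<in> sw.A"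
    using card_A_ge sw.card_A_ge by (metis all_not_in_conv card.empty not_numeral_le_zero)
  \<comment> \<open>Neither edge of this pair is in \<open>R1\<close>, so the pair is not in
    \<open>O2\<close>. With empty path part it is a good 2-matching, and it is what makes the final
    comparison strict.\<close>
  define O3 where "O3 = (if i = 2 then {{e1, e2}} else {})"
  have finI: "finite I" using fin fin_A sw.fin_A by (auto simp: I_def)
  have I: "g \<in> R1 \<and> e \<in> A \<union> sw.A" if "(g, e) \<in> I" for g e using that by (auto simp: I_def)
  have R1A: "g \<notin> A \<union> sw.A" if "g \<in> R1" for g using that off(2) R by auto
  have fO: "finite O1" "finite O2" "finite O3" using fin_off finI by (auto simp: O1_def O2_def O3_def)
  have d12: "{{}} \<inter> O1 = {}" "({{}} \<union> O1) \<inter> O2 = {}"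
    using I R1A by (auto simp: O1_def O2_def doubleton_eq_iff)
  have ne12: "e1 \<noteq> e2" using e12 AA by auto
  have d3: "({{}} \<union> O1 \<union> O2) \<inter> O3 = {}"
  proof -
    have "{e1, e2} \<notin> O2"
    proof
      assume "{e1, e2} \<in> O2"
      then obtain g e where "(g, e) \<in> I" "{e1, e2} = {g, e}" by (auto simp: O2_def)
      then have "g \<in> R1" "g = e1 \<or> g = e2" using I by (auto simp: doubleton_eq_iff)
      then show False using R1A e12 by auto
    qed
    then show ?thesis using ne12 by (auto simp: O3_def O1_def)
  qed
  have sub: "U \<subseteq> off" if "U \<in> {{}} \<union> O1 \<union> O2 \<union> O3" for U
    using that I e12 A_subset sw.A_subset
    by (auto simp: O1_def O2_def O3_def R1_def R_def split: if_splits dest!: I)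
  have "(\<Sum>U\<in>{{}} \<union> O1 \<union> O2 \<union> O3. cnt i U) \<le> card {M. good M \<and> card M = i}"
    by (rule sum_cnt_le) (use fO sub in auto)
  moreover have "(\<Sum>U\<in>{{}} \<union> O1 \<union> O2 \<union> O3. cnt i U) =
      cnt i {} + (\<Sum>U\<in>O1. cnt i U) + (\<Sum>U\<in>O2. cnt i U) + (\<Sum>U\<in>O3. cnt i U)"
    using fO d12 d3 by (simp add: sum.union_disjoint)
  moreover have "(\<Sum>U\<in>O1. cnt i U) = (\<Sum>e\<in>off. cnt i {e})"
    unfolding O1_def by (subst sum.reindex) (auto simp: inj_on_def)
  moreover have "card R1 * (2 * ?\<beta>) \<le> (\<Sum>U\<in>O2. cnt i U)"
  proof -
    have "inj_on (\<lambda>(g, e). {g, e}) I"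
    proof (rule inj_onI, clarify)
      fix g e g' e' assume "(g, e) \<in> I" "(g', e') \<in> I" "{g, e} = {g', e'}"
      moreover from this have "g \<noteq> e'" "g' \<noteq> e" using I[of g e] I[of g' e'] R1A by auto
      ultimately show "g = g' \<and> e = e'" by (auto simp: doubleton_eq_iff)
    qed
    then have "(\<Sum>U\<in>O2. cnt i U) = (\<Sum>(g, e)\<in>I. cnt i {g, e})"
      unfolding O2_def by (subst sum.reindex) (auto intro!: sum.cong)
    also have "\<dots> = (\<Sum>g\<in>R1. \<Sum>e\<in>{e. e \<in> A \<and> e \<inter> g = {}} \<union> {e. e \<in> sw.A \<and> e \<inter> g = {}}. cnt i {g, e})"
      unfolding I_def using fin fin_A sw.fin_A by (subst sum.Sigma) auto
    also have "\<dots> \<ge> (\<Sum>g\<in>R1. 2 * ?\<beta>)"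
    proof (rule sum_mono)
      fix g assume "g \<in> R1"
      then have g: "g \<in> off" "g \<notin> C1" "g \<notin> C2" "g \<inter> P \<noteq> {}" by (auto simp: R1_def R_def)
      have "(\<Sum>e\<in>{e. e \<in> A \<and> e \<inter> g = {}} \<union> {e. e \<in> sw.A \<and> e \<inter> g = {}}. cnt i {g, e}) =
        (\<Sum>e | e \<in> A \<and> e \<inter> g = {}. cnt i {g, e}) + (\<Sum>e | e \<in> sw.A \<and> e \<inter> g = {}. cnt i {g, e})"
        using fin_A sw.fin_A AA by (intro sum.union_disjoint) auto
      then show "2 * ?\<beta> \<le> (\<Sum>e\<in>{e. e \<in> A \<and> e \<inter> g = {}} \<union> {e. e \<in> sw.A \<and> e \<inter> g = {}}. cnt i {g, e})"
        using sum_cnt_pairs[OF g, of i] sw.sum_cnt_pairs[OF g(1,3,2,4), of i] unfolding cnt_sw by linarith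
    qed
    finally show ?thesis by simp
  qed
  moreover have "(if i = 2 then 1 else 0) \<le> (\<Sum>U\<in>O3. cnt i U)"
  proof (cases "i = 2")
    case True
    have C: "e1 \<in> C1" "e2 \<in> C2" "e1 \<in> off" "e2 \<in> off" using e12 A_subset sw.A_subset by auto
    then have ii: "{e1, e2} \<inter> C1 = {e1}" "{e1, e2} \<inter> C2 = {e2}" using C_disj by auto
    have "tcount i {} (card {e1, e2}) \<le> cnt i {e1, e2}"
    proof (rule cnt_ge)
      have "e1 \<inter> e2 = {}" using C disj by blast
      then show "pairwise disjnt {e1, e2}" by (auto simp: pairwise_def disjnt_def)
      show "uncov C1 {e1, e2} S \<and> uncov C2 {e1, e2} S" if "S \<subseteq> {}" for S
        using that edge_misses_vertex[OF C(1)] sw.edge_misses_vertex[OF C(2)]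
        unfolding uncov_def by (simp add: ii)
    qed (use C in auto)
    moreover have "tcount i {} (card {e1, e2}) = 1"
    proof -
      have S: "{S. S \<subseteq> {} \<and> sparse S \<and> card S + card {e1, e2} = i} = {{}}"
        using True ne12 by (auto simp: sparse_def)
      show ?thesis unfolding tcount_card S by simp
    qed
    ultimately show ?thesis using True by (simp add: O3_def)
  qed simp
  moreover have "(\<Sum>e\<in>off. cnt i {e}) = (\<Sum>e\<in>A. cnt i {e}) + (\<Sum>e\<in>sw.A. cnt i {e})
      + (\<Sum>e\<in>R0. cnt i {e}) + (\<Sum>e\<in>R1. cnt i {e})"
    by (rule sum_off)
  moreover have "card R0 * (?\<alpha> + 2 * ?\<beta>) \<le> (\<Sum>e\<in>R0. cnt i {e})"
  proof -
    have "?\<alpha> + 2 * ?\<beta> \<le> cnt i {e}" if "e \<in> R0" for e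
      using cnt_other_ge[of e i] that surplus(1) by (auto simp: R0_def R_def nb_empty)
    then show ?thesis using sum_bounded_below[of R0 "?\<alpha> + 2 * ?\<beta>" "\<lambda>e. cnt i {e}"] by simp
  qed
  moreover have "card R1 * ?\<alpha> \<le> (\<Sum>e\<in>R1. cnt i {e})"
  proof -
    have "?\<alpha> \<le> cnt i {e}" if "e \<in> R1" for e
      using cnt_other_ge[of e i] that tcount_nb[of e i 1] by (auto simp: R1_def R_def)
    then show ?thesis using sum_bounded_below[of R1 "?\<alpha>" "\<lambda>e. cnt i {e}"] by simp
  qed
  moreover have "(card V - d - 3) * (?\<alpha> + 2 * ?\<beta>) = (card A - 2) * (?\<alpha> + 2 * ?\<beta>)
    + (card sw.A - 2) * (?\<alpha> + 2 * ?\<beta>)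
    + card R0 * (?\<alpha> + 2 * ?\<beta>) + (card R1 * ?\<alpha> + card R1 * (2 * ?\<beta>))"
  proof -
    have "card V - d - 3 = (card A - 2) + (card sw.A - 2) + card R0 + card R1"
      using parts card_off card_A_ge sw.card_A_ge by linarith
    then show ?thesis by (simp only: distrib_right distrib_left)
  qed
  moreover have "(card A - 2) * (?\<alpha> + 2 * ?\<beta>) + (?\<alpha> + ?\<gamma>) \<le> (\<Sum>e\<in>A. cnt i {e})"
    using sum_cnt_cycle[of i] by simp
  moreover have "(card sw.A - 2) * (?\<alpha> + 2 * ?\<beta>) + (?\<alpha> + ?\<gamma>) \<le> (\<Sum>e\<in>sw.A. cnt i {e})"
    using sw.sum_cnt_cycle[of i] unfolding cnt_sw by simp
  moreover note cnt_empty_ge[of i]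
  ultimately show ?thesis by (rule arith)
qed

end

section \<open>Oriented graphs\<close>

definition skew_entry :: "pgraph \<Rightarrow> nat \<Rightarrow> nat \<Rightarrow> int" where
  "skew_entry D i j = (if (i, j) \<in> parcs D then 1 else if (j, i) \<in> parcs D then -1 else 0)"

lemma skew_coeff_eq_sum_pdet:
  assumes "pverts D = {0..<n}" "2 * i \<le> n"
  shows "skew_coeff D (2 * i) = (\<Sum>X | X \<subseteq> {0..<n} \<and> card X = 2 * i. pdet (skew_entry D) X)"
  using coeff_char_poly_eq_sum_pdet[of "2 * i" n "skew_entry D"] assms
  by (simp add: skew_coeff_def skew_adjacency_def skew_entry_def)

lemma in_edges_iff:
  assumes "pair_graph G"
  shows "{u, v} \<in> edges G \<longleftrightarrow> (u, v) \<in> parcs G"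
proof -
  interpret pair_graph G by (rule assms)
  have "(b, a) \<in> parcs G" if "(a, b) \<in> parcs G" for a b
    using that pair_sym_arcs by (auto simp: symmetric_def sym_def)
  then show ?thesis by (auto simp: edges_def doubleton_eq_iff)
qed

lemma edges_card_2:
  assumes "pair_graph G" "e \<in> edges G"
  shows "e \<subseteq> pverts G \<and> card e = 2"
proof -
  interpret pair_graph G by (rule assms)
  obtain u v where "(u, v) \<in> parcs G" "e = {u, v}" using assms(2) by (auto simp: edges_def)
  moreover from this have "u \<noteq> v" using pair_no_loops by fastforce
  ultimately show ?thesis using wellformed' by auto
qed

lemma orientation_skew:
  assumes G: "pair_graph G" and D: "orientation G D"
  shows "skew_entry D j i = - skew_entry D i j"
    and "skew_entry D i j \<noteq> 0 \<longleftrightarrow> {i, j} \<in> edges G"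
    and "{i, j} \<in> edges G \<Longrightarrow> skew_entry D i j * skew_entry D i j = 1"
proof -
  interpret pair_graph G by (rule G)
  have sym: "(b, a) \<in> parcs G" if "(a, b) \<in> parcs G" for a b
    using that pair_sym_arcs by (auto simp: symmetric_def sym_def)
  have D': "parcs D \<subseteq> parcs G" "\<And>u v. (u, v) \<in> parcs G \<Longrightarrow> ((u, v) \<in> parcs D) \<noteq> ((v, u) \<in> parcs D)"
    using D by (auto simp: orientation_def)
  have asym: "(b, a) \<notin> parcs D" if "(a, b) \<in> parcs D" for a b
    using D'(2)[of a b] D'(1) that by auto
  show "skew_entry D j i = - skew_entry D i j"
    using asym[of i j] by (auto simp: skew_entry_def)
  have iff: "(i, j) \<in> parcs D \<or> (j, i) \<in> parcs D \<longleftrightarrow> {i, j} \<in> edges G"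
    unfolding in_edges_iff[OF G] using D'(1) D'(2)[of i j] sym[of j i] by auto
  then show "skew_entry D i j \<noteq> 0 \<longleftrightarrow> {i, j} \<in> edges G" by (auto simp: skew_entry_def)
  show "{i, j} \<in> edges G \<Longrightarrow> skew_entry D i j * skew_entry D i j = 1"
    using iff by (auto simp: skew_entry_def)
qed

text \<open>The matching is a fixed-point-free involution of its vertex set, and conversely
  involutions with nonzero entries are perfect matchings. Uniqueness makes the minor odd, and a
  nonnegative odd integer is at least 1.\<close>

lemma pdet_unique_perfect_matching:
  assumes G: "pair_graph G" and D: "orientation G D"
    and M: "finite M" "M \<subseteq> edges G" "pairwise disjnt M"
    and unique: "\<And>M'. M' \<subseteq> edges G \<Longrightarrow> pairwise disjnt M' \<Longrightarrow> \<Union>M' = \<Union>M \<Longrightarrow> M' = M"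
  shows "card (\<Union>M) = 2 * card M" "pdet (skew_entry D) (\<Union>M) \<ge> 1"
proof -
  let ?a = "skew_entry D" and ?X = "\<Union>M"
  have c2: "card e = 2" if "e \<in> M" for e using that M(2) edges_card_2[OF G] by auto
  then have fe: "finite e" if "e \<in> M" for e using that by (metis card.infinite zero_neq_numeral)
  have "card ?X = (\<Sum>e\<in>M. card e)" by (rule card_Union_disjoint) (use M fe in auto)
  then show cX: "card ?X = 2 * card M" using c2 by simp
  have fX: "finite ?X" using M(1) fe by auto
  have partner: "\<exists>!y. {x, y} \<in> M" if x: "x \<in> ?X" for x
  proof -
    obtain e where e: "e \<in> M" "x \<in> e" using x by auto
    then obtain y where y: "e = {x, y}" using c2[OF e(1)] by (auto simp: card_2_iff)
    have "z = y" if "{x, z} \<in> M" for z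
    proof -
      have "{x, z} = {x, y}"
        using pairwiseD[OF M(3), of "{x, z}" "{x, y}"] that e y by (auto simp: disjnt_def)
      then show ?thesis by (auto simp: doubleton_eq_iff)
    qed
    then show ?thesis using e y by blast
  qed
  define p where "p = (\<lambda>x. if x \<in> ?X then THE y. {x, y} \<in> M else x)"
  have pM: "{x, p x} \<in> M" if "x \<in> ?X" for x
    using theI'[OF partner[OF that]] that by (simp add: p_def)
  have pX: "p x \<in> ?X" if "x \<in> ?X" for x using pM[OF that] by auto
  have p_eq: "p x = y" if "{x, y} \<in> M" for x y
  proof -
    have "x \<in> ?X" using that by auto
    then show ?thesis using partner[of x] pM[of x] that by auto
  qed
  have pp: "p (p x) = x" if "x \<in> ?X" for x
    using pM[OF that] by (intro p_eq) (simp add: insert_commute)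
  have perm: "p permutes ?X"
  proof (rule bij_imp_permutes)
    show "bij_betw p ?X ?X" by (rule bij_betw_byWitness[where f' = p]) (use pp pX in auto)
  qed (auto simp: p_def)
  have "odd (pdet ?a ?X)"
  proof (rule pdet_odd_if_unique_involution[OF fX _ _ perm])
    show "even (card ?X)" using cX by simp
    show "?a j i = - ?a i j" for i j by (rule orientation_skew(1)[OF G D])
    show "p (p i) = i" if "i \<in> ?X" for i using pp[OF that] .
    show "odd (?a i (p i))" if "i \<in> ?X" for i
    proof -
      have "{i, p i} \<in> edges G" using pM[OF that] M(2) by auto
      from orientation_skew(3)[OF G D this] show ?thesis by (metis even_mult_iff odd_one)
    qed
    fix q assume q: "q permutes ?X" "\<And>i. i \<in> ?X \<Longrightarrow> q (q i) = i" "\<And>i. i \<in> ?X \<Longrightarrow> ?a i (q i) \<noteq> 0"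
    let ?M' = "(\<lambda>i. {i, q i}) ` ?X"
    have "?M' \<subseteq> edges G" using q(3) orientation_skew(2)[OF G D] by auto
    moreover have "pairwise disjnt ?M'"
    proof (rule pairwiseI)
      fix e f assume "e \<in> ?M'" "f \<in> ?M'" "e \<noteq> f"
      then obtain i j where ij: "i \<in> ?X" "j \<in> ?X" "e = {i, q i}" "f = {j, q j}" by auto
      have "i \<noteq> j" using ij \<open>e \<noteq> f\<close> by auto
      have "i \<noteq> q j"
      proof
        assume "i = q j"
        then have "q i = j" using q(2)[OF ij(2)] by simp
        then show False using ij \<open>e \<noteq> f\<close> \<open>i = q j\<close> by auto
      qed
      moreover have "j \<noteq> q i"
      proof
        assume "j = q i"
        then have "q j = i" using q(2)[OF ij(1)] by simp
        then show False using ij \<open>e \<noteq> f\<close> \<open>j = q i\<close> by auto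
      qed
      moreover have "q i \<noteq> q j" using q(2)[OF ij(1)] q(2)[OF ij(2)] \<open>i \<noteq> j\<close> by metis
      ultimately show "disjnt e f" using ij \<open>i \<noteq> j\<close> by (simp add: disjnt_def)
    qed
    moreover have "\<Union>?M' = ?X"
      using permutes_in_image[OF q(1)] by blast
    ultimately have M': "?M' = M" by (rule unique)
    show "q = p"
    proof
      fix i show "q i = p i"
      proof (cases "i \<in> ?X")
        case True
        then have "{i, q i} \<in> ?M'" by (rule imageI)
        then show ?thesis using p_eq[of i "q i"] M' by simp
      next
        case False
        then show ?thesis using permutes_not_in[OF q(1)] by (simp add: p_def)
      qed
    qed
  qed
  moreover have "pdet ?a ?X \<ge> 0"
    by (rule pdet_skew_nonneg[OF fX]) (rule orientation_skew(1)[OF G D])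
  ultimately have "pdet ?a ?X \<noteq> 0" "pdet ?a ?X \<ge> 0" by auto
  then show "pdet ?a ?X \<ge> 1" by linarith
qed

text \<open>Uniqueness also makes \<open>Union\<close> injective on the family, so distinct
  matchings sit in distinct principal minors; all other minors are nonnegative.\<close>

lemma skew_coeff_ge_card:
  assumes G: "pair_graph G" "pverts G = {0..<n}" and D: "orientation G D" and i: "2 * i \<le> n"
    and \<M>: "\<And>M. M \<in> \<M> \<Longrightarrow> M \<subseteq> edges G \<and> pairwise disjnt M \<and> card M = i"
    and unique: "\<And>M M'. M \<in> \<M> \<Longrightarrow> M' \<subseteq> edges G \<Longrightarrow> pairwise disjnt M' \<Longrightarrow> \<Union>M' = \<Union>M \<Longrightarrow> M' = M"
  shows "int (card \<M>) \<le> skew_coeff D (2 * i)"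
proof -
  let ?a = "skew_entry D" and ?S = "{X. X \<subseteq> {0..<n} \<and> card X = 2 * i}"
  have finE: "finite (edges G)"
  proof -
    interpret pair_graph G by (rule G(1))
    show ?thesis using pair_finite_arcs by (simp add: edges_def)
  qed
  have finM: "finite M" if "M \<in> \<M>" for M using \<M>[OF that] finE finite_subset by blast
  have pd: "card (\<Union>M) = 2 * card M \<and> pdet ?a (\<Union>M) \<ge> 1" if "M \<in> \<M>" for M
    using pdet_unique_perfect_matching[OF G(1) D finM[OF that], OF _ _ unique[OF that]] \<M>[OF that] by blast
  have inj: "inj_on Union \<M>" using unique \<M> by (intro inj_onI) blast
  have sub: "Union ` \<M> \<subseteq> ?S"
  proof (rule image_subsetI)
    fix M assume M: "M \<in> \<M>"
    have "\<Union>M \<subseteq> {0..<n}" using \<M>[OF M] edges_card_2[OF G(1)] G(2) by blast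
    then show "\<Union>M \<in> ?S" using pd[OF M] \<M>[OF M] by simp
  qed
  have finS: "finite ?S" by simp
  have "int (card \<M>) = (\<Sum>X\<in>Union ` \<M>. 1)" using inj by (simp add: card_image)
  also have "\<dots> \<le> (\<Sum>X\<in>Union ` \<M>. pdet ?a X)" using pd by (intro sum_mono) auto
  also have "\<dots> \<le> (\<Sum>X\<in>?S. pdet ?a X)"
  proof (rule sum_mono2[OF finS sub])
    fix X assume "X \<in> ?S - Union ` \<M>"
    then have "finite X" by (auto intro: finite_subset)
    then show "0 \<le> pdet ?a X" by (rule pdet_skew_nonneg) (rule orientation_skew(1)[OF G(1) D])
  qed
  also have "\<dots> = skew_coeff D (2 * i)"
    using skew_coeff_eq_sum_pdet[of D n i] D G(2) i by (simp add: orientation_def)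
  finally show ?thesis .
qed

text \<open>With at most one vertex per level, a lowest vertex has at most one neighbour in
  \<open>X\<close>, on the next level. Either its row vanishes or \<open>pdet_pendant\<close>
  removes both vertices, with factor 1 by skewness. \<open>M\<close> records the lower levels of the
  removed pairs.\<close>

lemma pdet_levels:
  fixes a :: "nat \<Rightarrow> nat \<Rightarrow> int" and l :: "nat \<Rightarrow> nat"
  assumes X: "finite X" "inj_on l X" "\<And>v. v \<in> X \<Longrightarrow> l v \<le> d"
    and skew: "\<And>i j. a j i = - a i j" and unit: "\<And>i j. a i j \<noteq> 0 \<Longrightarrow> a i j * a i j = 1"
    and adj: "\<And>i j. a i j \<noteq> 0 \<Longrightarrow> l j = Suc (l i) \<or> l i = Suc (l j)"
  shows "pdet a X = 0 \<or> pdet a X = 1 \<and>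
    (\<exists>M. M \<subseteq> {..<d} \<and> sparse M \<and> l ` X = M \<union> Suc ` M \<and> card X = 2 * card M)"
  using X
proof (induction "card X" arbitrary: X rule: less_induct)
  case less
  show ?case
  proof (cases "X = {}")
    case True
    then show ?thesis by (auto intro!: exI[of _ "{}"] simp: sparse_def)
  next
    case False
    then obtain v where v: "v \<in> X" "\<And>w. w \<in> X \<Longrightarrow> l v \<le> l w"
      using arg_min_if_finite[of X l] less.prems(1) by (metis leI)
    show ?thesis
    proof (cases "\<exists>u\<in>X. a v u \<noteq> 0")
      case False
      then have "pdet a X = 0" by (intro pdet_zero_row[OF less.prems(1) v(1)]) auto
      then show ?thesis by simp
    next
      case True
      then obtain u where u: "u \<in> X" "a v u \<noteq> 0" by auto
      then have lu: "l u = Suc (l v)" using adj[OF u(2)] v(2)[OF u(1)] by auto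
      have zero: "a v w = 0" if "w \<in> X" "w \<noteq> u" for w
      proof (rule ccontr)
        assume "a v w \<noteq> 0"
        then have "l w = l u" using adj[of v w] v(2)[OF that(1)] lu by auto
        then show False using inj_onD[OF less.prems(2), of w u] that u(1) by simp
      qed
      have ne: "v \<noteq> u" using lu by auto
      let ?Y = "X - {v, u}"
      have "pdet a X = - (a v u * a u v) * pdet a ?Y"
        using zero skew[of _ v] by (intro pdet_pendant[OF less.prems(1) v(1) u(1) ne]) auto
      also have "- (a v u * a u v) = 1" using skew[of v u] unit[OF u(2)] by simp
      finally have eq: "pdet a X = pdet a ?Y" by simp
      have "?Y \<subset> X" using v(1) by auto
      then have "card ?Y < card X" by (rule psubset_card_mono[OF less.prems(1)])
      then have "pdet a ?Y = 0 \<or> pdet a ?Y = 1 \<and>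
          (\<exists>M. M \<subseteq> {..<d} \<and> sparse M \<and> l ` ?Y = M \<union> Suc ` M \<and> card ?Y = 2 * card M)"
        using less.prems by (intro less.hyps) (auto intro: inj_on_subset)
      then show ?thesis
      proof
        assume "pdet a ?Y = 1 \<and>
          (\<exists>M. M \<subseteq> {..<d} \<and> sparse M \<and> l ` ?Y = M \<union> Suc ` M \<and> card ?Y = 2 * card M)"
        then obtain M where M: "pdet a ?Y = 1" "M \<subseteq> {..<d}" "sparse M" "l ` ?Y = M \<union> Suc ` M" "card ?Y = 2 * card M"
          by auto
        have big: "Suc (l v) < m" if "m \<in> M" for m
        proof -
          have "m \<in> l ` ?Y" using M(4) that by auto
          then obtain w where w: "w \<in> X" "w \<noteq> v" "w \<noteq> u" "m = l w" by auto
          have "l w \<noteq> l v" "l w \<noteq> l u" using inj_onD[OF less.prems(2)] w u(1) v(1) by metis+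
          then show ?thesis using v(2)[OF w(1)] w(4) lu by linarith
        qed
        let ?M = "insert (l v) M"
        have "l v < d" using less.prems(3)[OF u(1)] lu by simp
        then have "?M \<subseteq> {..<d}" using M(2) by simp
        moreover have "sparse ?M" using M(3) big unfolding sparse_def by fastforce
        moreover have "l ` X = ?M \<union> Suc ` ?M"
        proof -
          have "X = insert v (insert u ?Y)" using u(1) v(1) by auto
          then have "l ` X = insert (l v) (insert (l u) (l ` ?Y))" by (metis image_insert)
          then show ?thesis using M(4) lu by auto
        qed
        moreover have "card X = 2 * card ?M"
        proof -
          have "finite M" using M(2) finite_subset by blast
          moreover have "l v \<notin> M" using big by force
          moreover have "card X = card ?Y + 2"
            using card_Diff_subset[of "{v, u}" X] u(1) v(1) ne card_mono[OF less.prems(1), of "{v, u}"] by simp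
          ultimately show ?thesis using M(5) by simp
        qed
        ultimately show ?thesis using eq M(1) by metis
      qed (use eq in simp)
    qed
  qed
qed

text \<open>A transversal is determined by the function that chooses its vertex on each
  level.\<close>

lemma card_transversals_le:
  assumes "finite V" "finite L"
  shows "card {X. X \<subseteq> V \<and> inj_on l X \<and> l ` X = L} \<le> (\<Prod>k\<in>L. card {v \<in> V. l v = k})"
proof -
  let ?f = "\<lambda>X. restrict (inv_into X l) L"
  have "card {X. X \<subseteq> V \<and> inj_on l X \<and> l ` X = L} \<le> card (PiE L (\<lambda>k. {v \<in> V. l v = k}))"
  proof (rule card_inj_on_le[where f = ?f])
    show "inj_on ?f {X. X \<subseteq> V \<and> inj_on l X \<and> l ` X = L}"
    proof (rule inj_onI)
      fix X Y assume X: "X \<in> {X. X \<subseteq> V \<and> inj_on l X \<and> l ` X = L}"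
        and Y: "Y \<in> {X. X \<subseteq> V \<and> inj_on l X \<and> l ` X = L}" and eq: "?f X = ?f Y"
      have "?f Z ` L = Z" if "Z \<in> {X. X \<subseteq> V \<and> inj_on l X \<and> l ` X = L}" for Z
      proof -
        have "?f Z ` L = inv_into Z l ` L" by (intro image_cong) auto
        also have "\<dots> = inv_into Z l ` (l ` Z)"
          using that by (intro arg_cong[where f = "image (inv_into Z l)"]) simp
        also have "\<dots> = Z" using that by (intro inv_into_image_cancel) auto
        finally show ?thesis .
      qed
      from this[OF X] this[OF Y] show "X = Y" using eq by simp
    qed
    show "?f ` {X. X \<subseteq> V \<and> inj_on l X \<and> l ` X = L} \<subseteq> PiE L (\<lambda>k. {v \<in> V. l v = k})"
    proof (rule image_subsetI, rule PiE_I)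
      fix X k assume X: "X \<in> {X. X \<subseteq> V \<and> inj_on l X \<and> l ` X = L}" and k: "k \<in> L"
      then have k': "k \<in> l ` X" by simp
      have "inv_into X l k \<in> V" using inv_into_into[OF k'] X by auto
      then show "?f X k \<in> {v \<in> V. l v = k}" using f_inv_into_f[OF k'] k by simp
    qed simp
    show "finite (PiE L (\<lambda>k. {v \<in> V. l v = k}))" using assms by (intro finite_PiE) auto
  qed
  also have "\<dots> = (\<Prod>k\<in>L. card {v \<in> V. l v = k})" using assms(2) by (rule card_PiE)
  finally show ?thesis .
qed

text \<open>Only transversals have nonzero minors, and a minor equal to 1 occupies pairs of
  consecutive levels given by a sparse \<open>M\<close>. Choosing a vertex on each of these levels
  produces, for path edge \<open>k\<close>, the product of the sizes of levels \<open>k\<close> and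
  \<open>k + 1\<close>.\<close>

lemma sum_pdet_levels_le:
  fixes a :: "nat \<Rightarrow> nat \<Rightarrow> int" and l :: "nat \<Rightarrow> nat"
  assumes V: "finite V" "\<And>v. v \<in> V \<Longrightarrow> l v \<le> d"
    and skew: "\<And>i j. a j i = - a i j" and unit: "\<And>i j. a i j \<noteq> 0 \<Longrightarrow> a i j * a i j = 1"
    and adj: "\<And>i j. a i j \<noteq> 0 \<Longrightarrow> l j = Suc (l i) \<or> l i = Suc (l j)"
    and twins: "\<And>X. X \<subseteq> V \<Longrightarrow> \<not> inj_on l X \<Longrightarrow> pdet a X = 0"
    and w: "\<And>k. k < d \<Longrightarrow> w k = card {v \<in> V. l v = k} * card {v \<in> V. l v = Suc k}"
  shows "(\<Sum>X | X \<subseteq> V \<and> card X = 2 * i. pdet a X) \<le> int (scount w i {..<d} 0)"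
proof -
  let ?S = "{X. X \<subseteq> V \<and> card X = 2 * i}"
  let ?\<M> = "{M. M \<subseteq> {..<d} \<and> sparse M \<and> card M + 0 = i}"
  let ?T = "\<lambda>M. {X. X \<subseteq> V \<and> inj_on l X \<and> l ` X = M \<union> Suc ` M}"
  have finS: "finite ?S" using V(1) by simp
  have fin\<M>: "finite ?\<M>" by (rule finite_subset[of _ "Pow {..<d}"]) auto
  have finT: "finite (?T M)" for M by (rule finite_subset[of _ "Pow V"]) (use V(1) in auto)
  have X: "pdet a X = 0 \<or> pdet a X = 1 \<and> X \<in> (\<Union>M\<in>?\<M>. ?T M)" if "X \<in> ?S" for X
  proof (cases "inj_on l X")
    case True
    have "X \<subseteq> V" "card X = 2 * i" using that by auto
    then have "finite X" using V(1) finite_subset by blast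
    then have "pdet a X = 0 \<or> pdet a X = 1 \<and>
        (\<exists>M. M \<subseteq> {..<d} \<and> sparse M \<and> l ` X = M \<union> Suc ` M \<and> card X = 2 * card M)"
      using \<open>X \<subseteq> V\<close> V(2) by (intro pdet_levels[OF _ True _ skew unit adj]) auto
    then show ?thesis using True \<open>X \<subseteq> V\<close> \<open>card X = 2 * i\<close> by auto
  next
    case False
    then show ?thesis using twins that by auto
  qed
  have "(\<Sum>X\<in>?S. pdet a X) \<le> (\<Sum>X\<in>?S. if X \<in> (\<Union>M\<in>?\<M>. ?T M) then 1 else 0)"
  proof (rule sum_mono)
    fix X assume "X \<in> ?S"
    from X[OF this] show "pdet a X \<le> (if X \<in> (\<Union>M\<in>?\<M>. ?T M) then 1 else 0)"
    proof
      assume "pdet a X = 0"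
      then show ?thesis by (simp only: split: if_split) simp
    next
      assume "pdet a X = 1 \<and> X \<in> (\<Union>M\<in>?\<M>. ?T M)"
      then show ?thesis by (simp only: if_True order_refl)
    qed
  qed
  also have "\<dots> = (\<Sum>X\<in>?S \<inter> (\<Union>M\<in>?\<M>. ?T M). 1)"
    by (rule sum.inter_restrict[OF finS, symmetric])
  also have "\<dots> = int (card (?S \<inter> (\<Union>M\<in>?\<M>. ?T M)))"
    by (simp only: sum_constant mult_1_right)
  also have "\<dots> \<le> int (card (\<Union>M\<in>?\<M>. ?T M))"
    using fin\<M> finT by (intro of_nat_mono card_mono) auto
  also have "\<dots> \<le> int (\<Sum>M\<in>?\<M>. card (?T M))"
    using fin\<M> by (intro of_nat_mono card_UN_le)
  also have "\<dots> \<le> int (\<Sum>M\<in>?\<M>. \<Prod>k\<in>M. w k)"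
  proof (intro of_nat_mono sum_mono)
    fix M assume M: "M \<in> ?\<M>"
    then have finM: "finite M" using finite_subset by auto
    let ?c = "\<lambda>k. card {v \<in> V. l v = k}"
    have "card (?T M) \<le> (\<Prod>k\<in>M \<union> Suc ` M. ?c k)"
      using finM V(1) by (intro card_transversals_le) auto
    \<comment> \<open>Sparseness makes the lower and the upper levels disjoint.\<close>
    also have "\<dots> = (\<Prod>k\<in>M. ?c k) * (\<Prod>k\<in>Suc ` M. ?c k)"
      using finM M by (intro prod.union_disjoint) (auto simp: sparse_def)
    also have "(\<Prod>k\<in>Suc ` M. ?c k) = (\<Prod>k\<in>M. ?c (Suc k))"
      by (simp add: prod.reindex)
    also have "(\<Prod>k\<in>M. ?c k) * (\<Prod>k\<in>M. ?c (Suc k)) = (\<Prod>k\<in>M. w k)"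
      unfolding prod.distrib[symmetric] using M w by (intro prod.cong) auto
    finally show "card (?T M) \<le> (\<Prod>k\<in>M. w k)" .
  qed
  finally show ?thesis by (simp add: scount_def)
qed

section \<open>The graph B as a layered graph\<close>

definition B_level :: "nat \<Rightarrow> nat \<Rightarrow> nat" where
  "B_level d v = (if v \<le> d - 3 then v else if v \<le> d then d - 2 else if v = d + 1 then d - 1 else d)"

definition B_arcs :: "nat \<Rightarrow> nat \<Rightarrow> (nat \<times> nat) set" where
  "B_arcs n d = {(i, i + 1) |i. i < d - 3} \<union> {d - 3} \<times> {d - 2, d - 1, d}
             \<union> {d - 2, d - 1, d} \<times> {d + 1} \<union> {d + 1} \<times> {d + 2..<n}"

lemma B_graph_arcs: "parcs (B_graph n d) = B_arcs n d \<union> (B_arcs n d)\<inverse>" "pverts (B_graph n d) = {0..<n}"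
  unfolding B_graph_def B_arcs_def[symmetric] mk_symmetric_def by auto

lemma B_arcs_level:
  assumes "3 \<le> d" "(u, v) \<in> B_arcs n d"
  shows "B_level d v = Suc (B_level d u)"
  using assms unfolding B_arcs_def B_level_def by auto

lemma B_arcs_less:
  assumes "3 \<le> d" "d + 3 \<le> n" "(u, v) \<in> B_arcs n d"
  shows "u < n \<and> v < n"
  using assms unfolding B_arcs_def by auto

lemma pair_graph_B:
  assumes "3 \<le> d" "d + 3 \<le> n"
  shows "pair_graph (B_graph n d)"
proof
  fix e assume e: "e \<in> parcs (B_graph n d)"
  obtain u v where uv: "e = (u, v)" by force
  have "(u, v) \<in> B_arcs n d \<or> (v, u) \<in> B_arcs n d" using e uv by (simp add: B_graph_arcs)
  then show "fst e \<in> pverts (B_graph n d)" "snd e \<in> pverts (B_graph n d)" "fst e \<noteq> snd e"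
    using B_arcs_less[OF assms, of u v] B_arcs_less[OF assms, of v u]
      B_arcs_level[OF assms(1), of u v n] B_arcs_level[OF assms(1), of v u n] uv
    by (auto simp: B_graph_arcs)
next
  show "finite (pverts (B_graph n d))" by (simp add: B_graph_arcs)
  have "B_arcs n d \<subseteq> {0..<n} \<times> {0..<n}" using B_arcs_less[OF assms] by auto
  then have "finite (B_arcs n d)" by (rule finite_subset) auto
  then show "finite (parcs (B_graph n d))" by (simp add: B_graph_arcs)
  show "symmetric (with_proj (B_graph n d))"
    by (auto simp: symmetric_def sym_def B_graph_arcs)
qed

text \<open>Each arc traversed backwards contributes -1, and among four arcs the numbers of forward
  and backward ones have the same parity.\<close>

lemma B_minus_product:
  assumes d: "3 \<le> d" "d + 3 \<le> n" and D: "B_minus_orientation n d D"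
    and z: "z \<in> {d - 2, d - 1, d}" "z' \<in> {d - 2, d - 1, d}" "z \<noteq> z'"
  shows "skew_entry D (d - 3) z * skew_entry D z (d + 1) * skew_entry D (d + 1) z' * skew_entry D z' (d - 3) = 1"
proof -
  let ?x = "d - 3" and ?y = "d + 1"
  let ?C = "[(?x, z), (z, ?y), (?y, z'), (z', ?x)]"
  have arcs: "set ?C \<subseteq> parcs (B_graph n d)"
    using z by (auto simp: B_graph_arcs B_arcs_def)
  have V: "?x \<in> pverts (B_graph n d)" using d by (simp add: B_graph_arcs)
  have ne: "z \<noteq> ?y" "z \<noteq> ?x" "z' \<noteq> ?y" "z' \<noteq> ?x" "?x \<noteq> ?y" using z d by auto
  have "graph_cycle (B_graph n d) ?C"
    unfolding graph_cycle_def pre_digraph.cycle_def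
    by (intro conjI exI[of _ ?x])
      (use arcs V ne z(3) in \<open>auto simp: pre_digraph.awalk_def cas_with_proj_eq awalk_verts_with_proj_eq\<close>)
  then have "evenly_oriented D ?C" using D by (auto simp: B_minus_orientation_def)
  then have ev: "even (length (filter (\<lambda>a. a \<in> parcs D) ?C))" by (simp add: evenly_oriented_def)
  have or: "orientation (B_graph n d) D" using D by (simp add: B_minus_orientation_def)
  have s: "skew_entry D u v = (if (u, v) \<in> parcs D then 1 else -1)" if "(u, v) \<in> parcs (B_graph n d)" for u v
    using or that unfolding orientation_def skew_entry_def by auto
  have "skew_entry D ?x z = (if (?x, z) \<in> parcs D then 1 else -1)"
    "skew_entry D z ?y = (if (z, ?y) \<in> parcs D then 1 else -1)"
    "skew_entry D ?y z' = (if (?y, z') \<in> parcs D then 1 else -1)"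
    "skew_entry D z' ?x = (if (z', ?x) \<in> parcs D then 1 else -1)"
    by (rule s, use arcs in simp)+
  then show ?thesis using ev by (simp split: if_splits)
qed

lemma B_level_twins:
  assumes d: "3 \<le> d" and uv: "u \<noteq> v" "B_level d u = B_level d v"
  shows "u \<in> {d - 2, d - 1, d} \<and> v \<in> {d - 2, d - 1, d} \<or> d + 2 \<le> u \<and> d + 2 \<le> v"
  using assms unfolding B_level_def by (auto split: if_splits)

text \<open>The levels are the distances from vertex \<open>0\<close>. Products of neighbouring
  sizes in \<open>1, ..., 1, 3, 1, n - d - 2\<close> give the path weights
  \<open>1, ..., 1, 3, 3, n - d - 2\<close>.\<close>

lemma card_B_level:
  assumes "3 \<le> d" "d + 3 \<le> n"
  shows "card {v \<in> {0..<n}. B_level d v = k} =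
    (if k \<le> d - 3 then 1 else if k = d - 2 then 3 else if k = d - 1 then 1 else if k = d then n - d - 2 else 0)"
proof -
  have "{v \<in> {0..<n}. B_level d v = k} =
    (if k \<le> d - 3 then {k} else if k = d - 2 then {d - 2, d - 1, d} else if k = d - 1 then {d + 1}
     else if k = d then {d + 2..<n} else {})"
    using assms unfolding B_level_def by auto
  then show ?thesis using assms by auto
qed

lemma skew_coeff_B_minus_le:
  assumes d: "3 \<le> d" "d + 3 \<le> n" and D: "B_minus_orientation n d D" and i: "2 * i \<le> n"
  shows "skew_coeff D (2 * i) \<le>
    int (scount (\<lambda>k. if k < d - 3 then 1 else if k < d - 1 then 3 else n - d - 2) i {..<d} 0)"
proof -
  let ?a = "skew_entry D" and ?l = "B_level d"
  have or: "orientation (B_graph n d) D" using D by (simp add: B_minus_orientation_def)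
  note G = pair_graph_B[OF d]
  note skew = orientation_skew(1)[OF G or]
  have nz: "?a u v \<noteq> 0 \<longleftrightarrow> (u, v) \<in> B_arcs n d \<or> (v, u) \<in> B_arcs n d" for u v
    unfolding orientation_skew(2)[OF G or] in_edges_iff[OF G] by (simp add: B_graph_arcs)
  have unit: "?a u v * ?a u v = 1" if "?a u v \<noteq> 0" for u v
    using that orientation_skew(2,3)[OF G or] by blast
  have adj: "?l v = Suc (?l u) \<or> ?l u = Suc (?l v)" if "?a u v \<noteq> 0" for u v
    using that B_arcs_level[OF d(1)] unfolding nz by blast
  have twins: "pdet ?a X = 0" if X: "X \<subseteq> {0..<n}" "\<not> inj_on ?l X" for X
  proof -
    have fX: "finite X" using X(1) finite_subset by blast
    obtain u v where uv: "u \<in> X" "v \<in> X" "u \<noteq> v" "?l u = ?l v" using X(2) by (auto simp: inj_on_def)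
    \<comment> \<open>Twins have the same neighbours, so the factor is read off in one common
      column: \<open>?x\<close> for the vertices of degree two, where the even orientation makes it
      valid in column \<open>?y\<close> too, and \<open>?y\<close> for the pendent vertices.\<close>
    have "\<exists>c. c * c = 1 \<and> (\<forall>j. ?a u j = c * ?a v j)"
      using B_level_twins[OF d(1) uv(3,4)]
    proof
      assume z: "u \<in> {d - 2, d - 1, d} \<and> v \<in> {d - 2, d - 1, d}"
      let ?x = "d - 3" and ?y = "d + 1"
      have out: "?a w j = 0" if "w \<in> {d - 2, d - 1, d}" "j \<noteq> ?x" "j \<noteq> ?y" for w j
      proof -
        have "\<not> ((w, j) \<in> B_arcs n d \<or> (j, w) \<in> B_arcs n d)"
          using that d by (auto simp: B_arcs_def)
        then show ?thesis using nz by blast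
      qed
      have "(?x, w) \<in> B_arcs n d \<and> (w, ?y) \<in> B_arcs n d" if "w \<in> {d - 2, d - 1, d}" for w
        using that by (auto simp: B_arcs_def)
      then have ux: "?a w ?x * ?a w ?x = 1" "?a w ?y * ?a w ?y = 1" if "w \<in> {d - 2, d - 1, d}" for w
        using that unit[of w ?x] unit[of w ?y] nz by blast+
      have prod: "?a ?x u * ?a u ?y * ?a ?y v * ?a v ?x = 1"
        using B_minus_product[OF d D] z uv(3) by blast
      have acdb: "?a u ?x * ?a u ?y * ?a v ?y * ?a v ?x = 1"
        using prod skew[of u ?x] skew[of ?y v] by simp
      have sq: "?a u ?x * ?a u ?x = 1" "?a v ?x * ?a v ?x = 1" "?a v ?y * ?a v ?y = 1"
        using ux z by blast+
      have c: "(?a u ?x * ?a v ?x) * (?a u ?x * ?a v ?x) = 1"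
      proof -
        have "(?a u ?x * ?a v ?x) * (?a u ?x * ?a v ?x) = (?a u ?x * ?a u ?x) * (?a v ?x * ?a v ?x)"
          by (simp only: mult_ac)
        then show ?thesis by (simp only: sq mult_1_right)
      qed
      have arith: "p = q * r * s" if "q * p * s * r = 1" "q * q = 1" "r * r = 1" "s * s = 1" for p q r s :: int
      proof -
        have "q * r * s * (q * p * s * r) = (q * q) * (r * r) * (s * s) * p" by (simp only: mult_ac)
        then show ?thesis by (simp only: that mult_1_left mult_1_right)
      qed
      have y: "?a u ?y = (?a u ?x * ?a v ?x) * ?a v ?y"
        by (rule arith[OF acdb sq])
      have "?a u j = (?a u ?x * ?a v ?x) * ?a v j" for j
      proof -
        consider "j = ?x" | "j = ?y" | "j \<noteq> ?x" "j \<noteq> ?y" by blast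
        then show ?thesis
        proof cases
          case 1
          then show ?thesis using ux(1)[of v] z by (simp add: mult.assoc)
        next
          case 2
          then show ?thesis using y by simp
        next
          case 3
          then show ?thesis using out z by simp
        qed
      qed
      then show ?thesis using c by blast
    next
      assume z: "d + 2 \<le> u \<and> d + 2 \<le> v"
      let ?y = "d + 1"
      have out: "?a w j = 0" if "d + 2 \<le> w" "j \<noteq> ?y" for w j
      proof -
        have "\<not> ((w, j) \<in> B_arcs n d \<or> (j, w) \<in> B_arcs n d)"
          using that d by (auto simp: B_arcs_def)
        then show ?thesis using nz by blast
      qed
      have "(?y, u) \<in> B_arcs n d" "(?y, v) \<in> B_arcs n d" using z uv X(1) by (auto simp: B_arcs_def)
      then have ux: "?a u ?y * ?a u ?y = 1" "?a v ?y * ?a v ?y = 1"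
        using unit[of u ?y] unit[of v ?y] nz by blast+
      have "(?a u ?y * ?a v ?y) * (?a u ?y * ?a v ?y) = (?a u ?y * ?a u ?y) * (?a v ?y * ?a v ?y)"
        by (simp only: mult_ac)
      then have c: "(?a u ?y * ?a v ?y) * (?a u ?y * ?a v ?y) = 1" by (simp only: ux mult_1_right)
      have "?a u j = (?a u ?y * ?a v ?y) * ?a v j" for j
        using out[of u j] out[of v j] z ux(2) by (cases "j = ?y") (simp_all add: mult.assoc)
      then show ?thesis using c by blast
    qed
    then obtain c where "c * c = 1" "\<And>j. ?a u j = c * ?a v j" by blast
    then show ?thesis by (intro pdet_proportional_rows[OF fX uv(1,2,3)])
  qed
  have "(\<Sum>X | X \<subseteq> {0..<n} \<and> card X = 2 * i. pdet ?a X) \<le>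
    int (scount (\<lambda>k. if k < d - 3 then 1 else if k < d - 1 then 3 else n - d - 2) i {..<d} 0)"
  proof (rule sum_pdet_levels_le[where l = ?l])
    show "?l v \<le> d" for v by (auto simp: B_level_def)
    show "(if k < d - 3 then 1 else if k < d - 1 then 3 else n - d - 2) =
        card {v \<in> {0..<n}. ?l v = k} * card {v \<in> {0..<n}. ?l v = Suc k}" if k: "k < d" for k
    proof -
      consider "k < d - 3" | "k = d - 3" | "k = d - 2" | "k = d - 1" using k by linarith
      then show ?thesis unfolding card_B_level[OF d] using d by cases auto
    qed
    show "finite {0..<n}" by simp
    show "?a j i = - ?a i j" for i j by (rule skew)
    show "?a i j * ?a i j = 1" if "?a i j \<noteq> 0" for i j using that by (rule unit)
    show "?l j = Suc (?l i) \<or> ?l i = Suc (?l j)" if "?a i j \<noteq> 0" for i j using that by (rule adj)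
    show "pdet ?a X = 0" if "X \<subseteq> {0..<n}" "\<not> inj_on ?l X" for X using that by (rule twins)
  qed
  then show ?thesis
    using skew_coeff_eq_sum_pdet[of D n i] or i by (simp add: orientation_def B_graph_arcs)
qed

section \<open>From arc walks and distances to edge sets and levels\<close>

lemma pcas_ends:
  "pcas u p v \<Longrightarrow> p \<noteq> [] \<Longrightarrow> fst (p ! 0) = u \<and> snd (p ! (length p - 1)) = v"
proof (induction p arbitrary: u)
  case (Cons e p)
  then show ?case by (cases p) auto
qed simp

lemma pcas_nth_Suc: "pcas u p v \<Longrightarrow> Suc k < length p \<Longrightarrow> fst (p ! Suc k) = snd (p ! k)"
proof (induction p arbitrary: u k)
  case (Cons e p)
  show ?case
  proof (cases k)
    case 0
    then show ?thesis using Cons.prems pcas_ends[of "snd e" p v] by auto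
  next
    case (Suc l)
    then show ?thesis using Cons.prems Cons.IH[of "snd e" l] by simp
  qed
qed simp

lemma pawalk_verts_eq: "pcas u p v \<Longrightarrow> pawalk_verts u p = u # map snd p"
  by (induction p arbitrary: u) auto

text \<open>Vertices are indexed by the heads \<open>h k\<close> of the arcs, with cyclic
  predecessor \<open>pr\<close> and successor \<open>sc\<close>. Vertex \<open>h k\<close> lies
  exactly on the edges numbered \<open>k\<close> and \<open>sc k\<close>, which differ because a
  length of at least 3 separates \<open>sc k\<close> from \<open>pr k\<close>.\<close>

lemma graph_cycle_regular:
  assumes "graph_cycle G C"
  shows "cycle_edges C \<subseteq> edges G" "cycle_edges C \<noteq> {}" "\<Union>(cycle_edges C) = cycle_verts C"
    "v \<in> \<Union>(cycle_edges C) \<Longrightarrow> card {e \<in> cycle_edges C. v \<in> e} = 2"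
proof -
  obtain u where u: "set C \<subseteq> parcs G" "pcas u C u" "distinct (tl (pawalk_verts u C))" "C \<noteq> []" "3 \<le> length C"
    using assms by (auto simp: graph_cycle_def pre_digraph.cycle_def pre_digraph.awalk_def
        cas_with_proj_eq awalk_verts_with_proj_eq)
  define m where "m = length C"
  define h where "h = (\<lambda>k. snd (C ! k))"
  define pr where "pr = (\<lambda>k. if k = 0 then m - 1 else k - 1)"
  define sc where "sc = (\<lambda>k. if Suc k = m then 0 else Suc k)"
  have m: "3 \<le> m" using u by (simp add: m_def)
  have inj: "h j = h k \<longleftrightarrow> j = k" if "j < m" "k < m" for j k
    using u(3) that nth_eq_iff_index_eq[of "map snd C" j k] unfolding pawalk_verts_eq[OF u(2)]
    by (simp add: h_def m_def)
  have t: "fst (C ! k) = h (pr k)" if "k < m" for k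
    using pcas_ends[OF u(2,4)] pcas_nth_Suc[OF u(2), of "k - 1"] that
    by (cases k) (auto simp: h_def pr_def m_def)
  have Ck: "C ! k = (h (pr k), h k)" if "k < m" for k
    using t[OF that] by (simp add: h_def prod_eq_iff)
  have setC: "set C = (\<lambda>k. (h (pr k), h k)) ` {..<m}"
  proof -
    have "set C = (\<lambda>k. C ! k) ` {..<m}" by (auto simp: set_conv_nth m_def)
    also have "\<dots> = (\<lambda>k. (h (pr k), h k)) ` {..<m}" using Ck by (intro image_cong) auto
    finally show ?thesis .
  qed
  have ce: "cycle_edges C = (\<lambda>k. {h (pr k), h k}) ` {..<m}"
    unfolding cycle_edges_def setC by (simp add: image_image)
  have pr: "pr k < m" if "k < m" for k using that m by (auto simp: pr_def)
  have sc: "sc k < m" "pr (sc k) = k" if "k < m" for k using that m by (auto simp: pr_def sc_def)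
  have scpr: "sc (pr k) = k" if "k < m" for k using that m by (auto simp: pr_def sc_def)
  have pr_ne: "sc k \<noteq> pr k" if "k < m" for k using that m by (auto simp: pr_def sc_def split: if_splits)
  show "cycle_edges C \<subseteq> edges G" using u(1) by (auto simp: cycle_edges_def edges_def)
  show "cycle_edges C \<noteq> {}" using u(4) by (simp add: cycle_edges_def)
  have cv: "cycle_verts C = (\<lambda>k. h (pr k)) ` {..<m}"
    unfolding cycle_verts_def setC by (simp add: image_image)
  have hv: "h k \<in> cycle_verts C" if "k < m" for k
    unfolding cv using sc[OF that] by (intro image_eqI[of _ _ "sc k"]) auto
  show U: "\<Union>(cycle_edges C) = cycle_verts C"
    using hv pr unfolding ce by (auto simp: cv)
  show "card {e \<in> cycle_edges C. v \<in> e} = 2" if v: "v \<in> \<Union>(cycle_edges C)"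
  proof -
    obtain k where k: "k < m" "v = h k" using v pr unfolding ce by auto
    have iff: "v \<in> {h (pr j), h j} \<longleftrightarrow> j = sc k \<or> j = k" if "j < m" for j
      using inj[OF k(1) pr[OF that]] inj[OF k(1) that] sc(2)[OF k(1)] scpr[OF that] k(2) by auto
    have "{e \<in> cycle_edges C. v \<in> e} = (\<lambda>j. {h (pr j), h j}) ` {j. j < m \<and> v \<in> {h (pr j), h j}}"
      unfolding ce by blast
    also have "{j. j < m \<and> v \<in> {h (pr j), h j}} = {sc k, k}"
      using iff sc(1)[OF k(1)] k(1) by blast
    also have "(\<lambda>j. {h (pr j), h j}) ` {sc k, k} = {{h k, h (sc k)}, {h (pr k), h k}}"
      using sc(2)[OF k(1)] by simp
    also have "card \<dots> = 2"
    proof -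
      have "h (sc k) \<noteq> h (pr k)" "h (pr k) \<noteq> h k \<or> h (sc k) \<noteq> h k"
        using inj[OF sc(1)[OF k(1)] pr[OF k(1)]] inj[OF pr[OF k(1)] k(1)] inj[OF sc(1)[OF k(1)] k(1)]
          pr_ne[OF k(1)] by auto
      then have "{h k, h (sc k)} \<noteq> {h (pr k), h k}" by (auto simp: doubleton_eq_iff)
      then show ?thesis by simp
    qed
    finally show ?thesis .
  qed
qed

lemma connected_reachable:
  assumes G: "pair_graph G" and conn: "Digraph_Component.connected (with_proj G)"
    and uv: "u \<in> pverts G" "v \<in> pverts G"
  shows "(u, v) \<in> (parcs G)\<^sup>*"
proof -
  interpret pair_graph G by (rule G)
  have sym: "(b, a) \<in> parcs G" if "(a, b) \<in> parcs G" for a b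
    using that pair_sym_arcs by (auto simp: symmetric_def sym_def)
  have "parcs (mk_symmetric (with_proj G)) = parcs G" using sym by (auto simp: mk_symmetric_def)
  moreover have "u \<rightarrow>\<^sup>*\<^bsub>with_proj (mk_symmetric (with_proj G))\<^esub> v"
    using conn uv unfolding connected_def strongly_connected_def by (simp add: mk_symmetric_def)
  ultimately have "(u, v) \<in> rtrancl_on (pverts (mk_symmetric (with_proj G))) (parcs G)"
    by (simp add: reachable_def)
  then show ?thesis by (induction rule: rtrancl_on_induct) auto
qed

text \<open>Turns walk lengths into relation powers, on which the distance function is a plain
  \<open>LEAST\<close>.\<close>

lemma awalk_iff_relpow:
  assumes G: "pair_graph G" and u: "u \<in> pverts G"
  shows "(\<exists>p. pre_digraph.awalk (with_proj G) u p v \<and> length p = k) \<longleftrightarrow> (u, v) \<in> parcs G ^^ k"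
proof -
  interpret pair_graph G by (rule G)
  have 1: "(a, v) \<in> parcs G ^^ length p" if "pcas a p v" "set p \<subseteq> parcs G" for a p
    using that
  proof (induction p arbitrary: a)
    case (Cons e p)
    then have "(a, snd e) \<in> parcs G" "(snd e, v) \<in> parcs G ^^ length p" by (auto simp: prod_eq_iff)
    then show ?case by (simp add: relpow_Suc_I2 del: relpow.simps)
  qed auto
  have 2: "\<exists>p. awalk u p v \<and> length p = k" if "(u, v) \<in> parcs G ^^ k" for k v
    using that
  proof (induction k arbitrary: v)
    case 0
    then show ?case using u by (intro exI[of _ "[]"]) (auto simp: awalk_Nil_iff)
  next
    case (Suc k)
    then obtain y where y: "(u, y) \<in> parcs G ^^ k" "(y, v) \<in> parcs G" by auto
    then obtain p where p: "awalk u p y" "length p = k" using Suc.IH by auto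
    have "awalk u (p @ [(y, v)]) v"
      using p(1) arc_implies_awalk[OF y(2)] by (auto intro: awalk_appendI)
    then show ?case using p(2) by (intro exI[of _ "p @ [(y, v)]"]) simp
  qed
  show ?thesis using 1 2 by (auto simp: awalk_def)
qed

text \<open>The maximum is attained at some pair \<open>u\<close>, \<open>v\<close>;
  \<open>\<delta>\<close> is the distance from \<open>u\<close>, and \<open>p\<close> is a shortest
  walk to \<open>v\<close>. As \<open>\<delta>\<close> changes by at most one along an edge and
  climbs from \<open>0\<close> to \<open>d\<close> in \<open>d\<close> steps, it equals
  \<open>k\<close> at step \<open>k\<close>.\<close>

lemma diameter_geodesic:
  assumes G: "pair_graph G" and conn: "Digraph_Component.connected (with_proj G)"
    and d: "diameter G = ereal (real d)"
  obtains p :: "nat \<Rightarrow> nat" and \<delta> :: "nat \<Rightarrow> nat"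
  where "\<And>k. k < d \<Longrightarrow> (p k, p (Suc k)) \<in> parcs G"
    "\<And>x y. (x, y) \<in> parcs G \<Longrightarrow> \<delta> x \<le> \<delta> y + 1" "\<And>k. k \<le> d \<Longrightarrow> \<delta> (p k) = k"
proof -
  interpret pair_graph G by (rule G)
  let ?R = "parcs G"
  let ?f = "\<lambda>(u, v). wf_digraph.\<mu> (with_proj G) (\<lambda>_. 1) u v"
  have sym: "(b, a) \<in> ?R" if "(a, b) \<in> ?R" for a b
    using that pair_sym_arcs by (auto simp: symmetric_def sym_def)
  have "pverts G \<noteq> {}" using conn by (auto simp: connected_def strongly_connected_def mk_symmetric_def)
  then have "Max (?f ` (pverts G \<times> pverts G)) \<in> ?f ` (pverts G \<times> pverts G)"
    using pair_finite_verts by (intro Max_in) auto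
  then obtain u v where uv: "u \<in> pverts G" "v \<in> pverts G" "\<mu> (\<lambda>_. 1) u v = ereal (real d)"
    using d unfolding diameter_def by auto
  have reach: "\<exists>k. (u, x) \<in> ?R ^^ k" if "x \<in> pverts G" for x
    using connected_reachable[OF G conn uv(1) that] by (simp add: rtrancl_power)
  define \<delta> where "\<delta> = (\<lambda>x. LEAST k. (u, x) \<in> ?R ^^ k)"
  have \<delta>: "(u, x) \<in> ?R ^^ \<delta> x" if "x \<in> pverts G" for x
    unfolding \<delta>_def using reach[OF that] by (rule LeastI_ex)
  have \<delta>_le: "\<delta> x \<le> k" if "(u, x) \<in> ?R ^^ k" for x k
    unfolding \<delta>_def using that by (rule Least_le)
  have lip: "\<delta> x \<le> \<delta> y + 1" if "(x, y) \<in> ?R" for x y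
  proof -
    have "y \<in> pverts G" using that wellformed' by auto
    from \<delta>[OF this] sym[OF that] have "(u, x) \<in> ?R ^^ Suc (\<delta> y)" by auto
    then show ?thesis using \<delta>_le by fastforce
  qed
  have cost: "awalk_cost (\<lambda>_. 1) p = real (length p)" for p :: "(nat \<times> nat) list"
    by (induction p) auto
  have "\<mu> (\<lambda>_. 1) u v = ereal (real (\<delta> v))"
  proof (rule antisym)
    obtain p where "awalk u p v" "length p = \<delta> v"
      using \<delta>[OF uv(2)] awalk_iff_relpow[OF G uv(1), of v "\<delta> v"] by auto
    then show "\<mu> (\<lambda>_. 1) u v \<le> ereal (real (\<delta> v))"
      using min_cost_le_walk_cost[of u p v "\<lambda>_. 1"] by (simp add: cost)
    show "ereal (real (\<delta> v)) \<le> \<mu> (\<lambda>_. 1) u v"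
      unfolding \<mu>_def
    proof (rule INF_greatest)
      fix p assume "p \<in> {p. awalk u p v}"
      then have "(u, v) \<in> ?R ^^ length p" using awalk_iff_relpow[OF G uv(1), of v "length p"] by auto
      then show "ereal (real (\<delta> v)) \<le> ereal (awalk_cost (\<lambda>_. 1) p)" using \<delta>_le by (simp add: cost)
    qed
  qed
  then have dv: "\<delta> v = d" using uv(3) by simp
  then obtain p where p: "p 0 = u" "p d = v" "\<And>k. k < d \<Longrightarrow> (p k, p (Suc k)) \<in> ?R"
    using \<delta>[OF uv(2)] unfolding relpow_fun_conv by auto
  have up: "\<delta> (p k) \<le> k" if "k \<le> d" for k
    using that
  proof (induction k)
    case 0
    then show ?case using \<delta>_le[of u 0] p(1) by simp
  next
    case (Suc k)
    then show ?case using lip[OF sym[OF p(3)[of k]]] by simp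
  qed
  have down: "\<delta> (p (d - j)) \<ge> d - j" if "j \<le> d" for j
    using that
  proof (induction j)
    case 0
    then show ?case using dv p(2) by simp
  next
    case (Suc j)
    then have "Suc (d - Suc j) = d - j" by simp
    then show ?case using lip[OF sym[OF p(3)[of "d - Suc j"]]] Suc by simp
  qed
  have "\<delta> (p k) = k" if "k \<le> d" for k
    using up[OF that] down[of "d - k"] that by simp
  then show ?thesis using that p(3) lip by blast
qed

theorem theorem3p4:
  fixes n d t :: nat
    and G G\<sigma> Bm :: pgraph
    and Ca Cb :: "(nat \<times> nat) list"
  assumes "3 \<le> d" and "d + 3 \<le> n"
    and "G \<in> \<B>\<^sub>d n d"
    and "\<not> digraph_iso (with_proj G) (with_proj (B_graph n d))"
    and "distinct_cycles G Ca Cb"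
    and "t = card (cycle_verts Ca \<inter> cycle_verts Cb)"
    and "t = 0"
    and "orientation G G\<sigma>"
    and "B_minus_orientation n d Bm"
  shows "G\<sigma> \<succ> Bm"
proof -
  have bic: "bicyclic n G" and diam: "diameter G = ereal (real d)"
    using assms(3) by (auto simp: bicyclic_diam_class_def bicyclic_class_def)
  then have G: "pair_graph G" "pverts G = {0..<n}" and conn: "Digraph_Component.connected (with_proj G)"
    and cE: "card (edges G) = n + 1" by (auto simp: bicyclic_def)
  have Ca: "graph_cycle G Ca" and Cb: "graph_cycle G Cb" using assms(5) by (auto simp: distinct_cycles_def)
  note ra = graph_cycle_regular[OF Ca] and rb = graph_cycle_regular[OF Cb]
  have "finite (cycle_verts Ca)" by (simp add: cycle_verts_def)
  then have disj: "\<Union>(cycle_edges Ca) \<inter> \<Union>(cycle_edges Cb) = {}"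
    using assms(6,7) unfolding ra(3) rb(3) by simp
  obtain p \<delta> where p: "\<And>k. k < d \<Longrightarrow> (p k, p (Suc k)) \<in> parcs G"
    "\<And>x y. (x, y) \<in> parcs G \<Longrightarrow> \<delta> x \<le> \<delta> y + 1" "\<And>k. k \<le> d \<Longrightarrow> \<delta> (p k) = k"
    using diameter_geodesic[OF G(1) conn diam] by blast
  have sub: "parcs G \<subseteq> {(x, y). {x, y} \<in> edges G \<and> x \<noteq> y}"
  proof clarify
    fix x y assume xy: "(x, y) \<in> parcs G"
    then have "{x, y} \<in> edges G" by (simp add: in_edges_iff[OF G(1)])
    moreover from this have "card {x, y} = 2" using edges_card_2[OF G(1)] by blast
    ultimately show "{x, y} \<in> edges G \<and> x \<noteq> y" by auto
  qed
  interpret two_cycles_geodesic "{0..<n}" "edges G" "cycle_edges Ca" "cycle_edges Cb" p d \<delta>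
  proof
    show "finite {0..<n}" by simp
    show "e \<subseteq> {0..<n} \<and> card e = 2" if "e \<in> edges G" for e
      using edges_card_2[OF G(1) that] G(2) by simp
    show "(u, v) \<in> {(x, y). {x, y} \<in> edges G \<and> x \<noteq> y}\<^sup>*" if "u \<in> {0..<n}" "v \<in> {0..<n}" for u v
      using connected_reachable[OF G(1) conn, of u v] that G(2) rtrancl_mono[OF sub] by auto
    show "card (edges G) = card {0..<n} + 1" using cE by simp
    show "{p k, p (Suc k)} \<in> edges G" if "k < d" for k using p(1)[OF that] by (simp add: in_edges_iff[OF G(1)])
    show "\<delta> x \<le> \<delta> y + 1" if "{x, y} \<in> edges G" for x y using p(2) that by (simp add: in_edges_iff[OF G(1)])
  qed (use ra rb disj p(3) assms(1) in auto)
  let ?T = "\<lambda>i. scount (\<lambda>k. if k < d - 3 then 1 else if k < d - 1 then 3 else n - d - 2) i {..<d} 0"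
  have ineq: "skew_coeff Bm (2 * i) + (if i = 2 then 1 else 0) \<le> skew_coeff G\<sigma> (2 * i)" if "i \<le> n div 2" for i
  proof -
    have i: "2 * i \<le> n" using that by simp
    \<comment> \<open>\<open>Suc m\<close> is the weight of the last path edge; its excess
      \<open>m\<close> is also the number of off-path edges of \<open>G\<close> beyond two per
      cycle.\<close>
    define m where "m = n - d - 3"
    have m: "n - d - 2 = Suc m" "card {0..<n} - d - 3 = m" using assms(2) by (simp_all add: m_def)
    have "?T i + (if i = 2 then 1 else 0) \<le> card {M. good M \<and> card M = i}"
      unfolding m(1) scount_weighted_path[OF assms(1)]
      using card_good_ge[of i] unfolding m(2) .
    then have "int (?T i) + (if i = 2 then 1 else 0) \<le> int (card {M. good M \<and> card M = i})"
      by (auto split: if_splits)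
    also have "\<dots> \<le> skew_coeff G\<sigma> (2 * i)"
    proof (rule skew_coeff_ge_card[OF G assms(8) i])
      fix M assume M: "M \<in> {M. good M \<and> card M = i}"
      then show "M \<subseteq> edges G \<and> pairwise disjnt M \<and> card M = i" by (simp add: good_def)
      show "M' = M" if "M' \<subseteq> edges G" "pairwise disjnt M'" "\<Union>M' = \<Union>M" for M'
        using good_unique[OF _ that] M by simp
    qed
    finally show ?thesis using skew_coeff_B_minus_le[OF assms(1,2,9) i] by linarith
  qed
  have cards: "card (pverts G\<sigma>) = n" "card (pverts Bm) = n"
    using assms(8,9) G(2) by (auto simp: orientation_def B_minus_orientation_def B_graph_arcs)
  have "skew_coeff Bm (2 * i) \<le> skew_coeff G\<sigma> (2 * i)" if "i \<le> n div 2" for i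
    using ineq[OF that] by (auto split: if_splits)
  \<comment> \<open>The pair across the two cycles makes the coefficient with index 4 strictly
    larger; that index is in range since \<open>n\<close> is at least 6.\<close>
  moreover have "2 \<le> n div 2" using assms(1,2) by simp
  then have "2 \<le> n div 2 \<and> skew_coeff Bm (2 * 2) < skew_coeff G\<sigma> (2 * 2)" using ineq[of 2] by simp
  ultimately show ?thesis unfolding skew_gt_def skew_ge_def cards by auto
qed

end
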